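(* Let $H=\mathbb{P}^3_p\subset P(4)=\mathbb{P}\,\mathrm{Sym}^4(V)$ be an osculating hyperplane of the Veronese curve $X_4$ (for some $p\in P(1)$), identified with $\mathbb{P}^3$ by a linear isomorphism, and let $\bar\omega_H\in H^0(\mathbb{P}^3,\Omega^1_{\mathbb{P}^3}(4))$ be the form obtained from the restriction $\omega_H$ of $\omega=2Q\,dC-3C\,dQ$ to $H$ by dividing by its codimension-one zeros. Let $\mathcal{E}\subset\mathcal{F}(3,2)$ be the closure of the orbit of (the class of) $\bar\omega_H$ under the action of $\mathrm{Aut}(\mathbb{P}^3)$ on $\mathbb{P}H^0(\mathbb{P}^3,\Omega^1_{\mathbb{P}^3}(4))$. Then $\mathcal{E}$ is an irreducible component of $\mathcal{F}(3,2)$. Furthermore, for the natural scheme structure on $\mathcal{F}(3,2)$ given by the integrability condition, $\mathcal{E}$ is a reduced component (i.e. the scheme $\mathcal{F}(3,2)$ is reduced at the generic point of $\mathcal{E}$).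
   Context: Everything is over $\mathbb{C}$. $\mathbb{P}W$ denotes the projective space of one-dimensional linear subspaces of $W$. Space of foliations. A global section of $\Omega^1_{\mathbb{P}^r}(d+2)$ is a 1-form $\omega=\sum_{i=0}^r a_i\,dx_i$ on $\mathbb{C}^{r+1}$ with $a_i$ homogeneous polynomials of degree $d+1$ and $\sum_i a_ix_i=0$. $\mathcal{F}(r,d)\subset\mathbb{P}H^0(\mathbb{P}^r,\Omega^1_{\mathbb{P}^r}(d+2))$ is the closed subset of classes of nonzero $\omega$ with $\omega\wedge d\omega=0$; the quadratic equations $\omega\wedge d\omega=0$ give it a natural scheme structure. Binary quartics. $V$ is a two-dimensional vector space with basis $t_0,t_1$, and $P(r)=\mathbb{P}\,\mathrm{Sym}^r(V)$ is the projective space of binary forms of degree $r$, whose points are identified with effective divisors of degree $r$ on $P(1)\cong\mathbb{P}^1$ (roots with multiplicity). Write a binary quartic as $\sum_{i=0}^4\binom{4}{i}a_it_0^{4-i}t_1^i$, and use $a_0,\dots,a_4$ as homogeneous coordinates on $P(4)$. Put $$Q=a_0a_4-4a_1a_3+3a_2^2,\qquad C=a_0a_2a_4-a_0a_3^2+2a_1a_2a_3-a_1^2a_4-a_2^3,$$ and $\omega=2Q\,dC-3C\,dQ\in H^0(P(4),\Omega^1_{P(4)}(5))$. The Veronese curve is $X_4=\{4p: p\in P(1)\}$. The osculating hyperplane of $X_4$ at $4p$ is $\mathbb{P}^3_p=\{p+q+r+s: q,r,s\in P(1)\}$. Division by codimension-one zeros. If a twisted 1-form $\eta$ on $\mathbb{P}^r$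 vanishes in codimension one, and $F$ is a homogeneous polynomial of maximal degree dividing $\eta$, then $\bar\eta=\eta/F$, well defined up to a multiplicative constant. $\omega_H$ denotes the restriction (pull-back) of $\omega$ to $H$, and $\bar\omega_H=\omega_H/F$ in this sense. *)

theory Defs
  imports "HOL-Analysis.Analysis" "HOL-Library.Poly_Mapping"
begin

section \<open>Polynomials\<close>

text \<open>Polynomials over \<open>'a\<close> in variables indexed by \<open>'v\<close>; a monomial is its exponent function.
  Multiplication is convolution, so this is the usual polynomial ring.\<close>

type_synonym 'v monomial = "'v \<Rightarrow>\<^sub>0 nat"
type_synonym ('v, 'a) mpoly = "'v monomial \<Rightarrow>\<^sub>0 'a"

definition Const :: "'a::comm_ring_1 \<Rightarrow> ('v, 'a) mpoly" where
  "Const c = Poly_Mapping.single 0 c"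

definition Var :: "'v \<Rightarrow> ('v, 'a::comm_ring_1) mpoly" where
  "Var v = Poly_Mapping.single (Poly_Mapping.single v 1) 1"

definition mdeg :: "'v monomial \<Rightarrow> nat" where
  "mdeg m = (\<Sum>v\<in>Poly_Mapping.keys m. Poly_Mapping.lookup m v)"

definition homog :: "nat \<Rightarrow> ('v, 'a::comm_ring_1) mpoly \<Rightarrow> bool" where
  "homog k p \<longleftrightarrow> (\<forall>m\<in>Poly_Mapping.keys p. mdeg m = k)"

definition pdiff :: "'v \<Rightarrow> ('v, 'a::comm_ring_1) mpoly \<Rightarrow> ('v, 'a) mpoly" where
  "pdiff v p = (\<Sum>m\<in>Poly_Mapping.keys p.
     Poly_Mapping.single (m - Poly_Mapping.single v 1) (of_nat (Poly_Mapping.lookup m v) * Poly_Mapping.lookup p m))"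

text \<open>Apply \<open>h\<close> to the coefficients and put \<open>x v\<close> for the variable \<open>v\<close>.\<close>

definition eval_with :: "('a::comm_ring_1 \<Rightarrow> 'b::comm_ring_1) \<Rightarrow> ('v \<Rightarrow> 'b) \<Rightarrow> ('v, 'a) mpoly \<Rightarrow> 'b" where
  "eval_with h x p = (\<Sum>m\<in>Poly_Mapping.keys p.
     h (Poly_Mapping.lookup p m) * (\<Prod>v\<in>Poly_Mapping.keys m. x v ^ Poly_Mapping.lookup m v))"

abbreviation peval :: "('v \<Rightarrow> 'a) \<Rightarrow> ('v, 'a::comm_ring_1) mpoly \<Rightarrow> 'a" where
  "peval \<equiv> eval_with (\<lambda>c. c)"

abbreviation psubst :: "('v \<Rightarrow> ('w, 'a) mpoly) \<Rightarrow> ('v, 'a::comm_ring_1) mpoly \<Rightarrow> ('w, 'a) mpoly" where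
  "psubst \<equiv> eval_with Const"


section \<open>Polynomial 1-forms\<close>

text \<open>\<open>\<omega> $ i\<close> is the coefficient of \<open>dx\<^sub>i\<close>. On \<open>\<P>\<^sup>r\<close> the index type has \<open>r + 1\<close> elements.\<close>

type_synonym ('n, 'a) form1 = "('n, 'a) mpoly ^ 'n"

definition ext_deriv :: "('n, 'a::comm_ring_1) mpoly \<Rightarrow> ('n::finite, 'a) form1" where
  "ext_deriv F = (\<chi> i. pdiff i F)"

text \<open>Contraction with the radial vector field.\<close>

definition contract :: "('n::finite, 'a::comm_ring_1) form1 \<Rightarrow> ('n, 'a) mpoly" where
  "contract \<omega> = (\<Sum>i\<in>UNIV. \<omega> $ i * Var i)"

text \<open>The coefficient of \<open>dx\<^sub>i \<and> dx\<^sub>j \<and> dx\<^sub>k\<close> in \<open>\<omega> \<and> d\<omega>\<close>.\<close>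

definition wedge_d :: "('n::finite, 'a::comm_ring_1) form1 \<Rightarrow> 'n \<Rightarrow> 'n \<Rightarrow> 'n \<Rightarrow> ('n, 'a) mpoly" where
  "wedge_d \<omega> i j k =
     \<omega> $ i * (pdiff j (\<omega> $ k) - pdiff k (\<omega> $ j)) +
     \<omega> $ j * (pdiff k (\<omega> $ i) - pdiff i (\<omega> $ k)) +
     \<omega> $ k * (pdiff i (\<omega> $ j) - pdiff j (\<omega> $ i))"

definition integrable_form :: "('n::finite, 'a::comm_ring_1) form1 \<Rightarrow> bool" where
  "integrable_form \<omega> \<longleftrightarrow> (\<forall>i j k. wedge_d \<omega> i j k = 0)"

definition linear_map :: "'a::comm_ring_1 ^ 'n ^ 'm \<Rightarrow> ('n::finite, 'a) mpoly ^ 'm" where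
  "linear_map A = (\<chi> i. \<Sum>j\<in>UNIV. Const (A $ i $ j) * Var j)"

definition pullback ::
  "('n::finite, 'a::comm_ring_1) mpoly ^ 'm \<Rightarrow> ('m::finite, 'a) form1 \<Rightarrow> ('n, 'a) form1" where
  "pullback \<phi> \<omega> = (\<chi> j. \<Sum>i\<in>UNIV. psubst (($) \<phi>) (\<omega> $ i) * pdiff j (\<phi> $ i))"

text \<open>\<open>\<eta>'\<close> is \<open>\<eta> / F\<close> for a homogeneous \<open>F\<close> of maximal degree dividing \<open>\<eta>\<close>
  (this never holds for \<open>\<eta> = 0\<close>).\<close>

definition codim1_quotient ::
  "('n::finite, 'a::comm_ring_1) form1 \<Rightarrow> ('n, 'a) form1 \<Rightarrow> bool" where
  "codim1_quotient \<eta> \<eta>' \<longleftrightarrow>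
     (\<exists>F k. homog k F \<and> F \<noteq> 0 \<and> \<eta> = F *s \<eta>' \<and>
        (\<forall>G l. homog l G \<and> G \<noteq> 0 \<and> (\<forall>i. G dvd \<eta> $ i) \<longrightarrow> l \<le> k))"


section \<open>The space of foliations\<close>

text \<open>\<open>H\<^sup>0(\<P>\<^sup>r, \<Omega>\<^sup>1(d + 2))\<close>.\<close>

definition twisted_forms :: "nat \<Rightarrow> ('n::finite, complex) form1 set" where
  "twisted_forms d = {\<omega>. (\<forall>i. homog (d + 1) (\<omega> $ i)) \<and> contract \<omega> = 0}"

text \<open>A point of a projective space is a line; \<open>proj_pt \<omega>\<close> is the line through \<open>\<omega>\<close>.\<close>

definition proj_pt :: "('n::finite, complex) form1 \<Rightarrow> ('n, complex) form1 set" where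
  "proj_pt \<omega> = {Const c *s \<omega> | c. True}"

definition foliations :: "nat \<Rightarrow> ('n::finite, complex) form1 set set" where
  "foliations d = {proj_pt \<omega> | \<omega>. \<omega> \<in> twisted_forms d \<and> \<omega> \<noteq> 0 \<and> integrable_form \<omega>}"

text \<open>The action of \<open>Aut(\<P>\<^sup>r) = PGL\<^sub>r\<^sub>+\<^sub>1\<close> by pull-back.\<close>

definition orbit :: "('n::finite, complex) form1 \<Rightarrow> ('n, complex) form1 set set" where
  "orbit \<eta> = {proj_pt (pullback (linear_map g) \<eta>) | g. invertible g}"

text \<open>Homogeneous coordinates: the variable \<open>(i, m)\<close>, with \<open>m\<close> a monomial of degree \<open>d + 1\<close>,
  stands for the coefficient of \<open>m\<close> in \<open>\<omega> $ i\<close>. So \<open>coord_ring d\<close> is the coordinate ring of the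
  space of all 1-forms with coefficients of degree \<open>d + 1\<close>, which contains \<open>twisted_forms d\<close> as
  the linear subspace \<open>contract \<omega> = 0\<close>.\<close>

type_synonym 'n coord_poly = "('n \<times> 'n monomial, complex) mpoly"

definition coord_ring :: "nat \<Rightarrow> 'n coord_poly set" where
  "coord_ring d = {f. \<forall>\<mu>\<in>Poly_Mapping.keys f. \<forall>v\<in>Poly_Mapping.keys \<mu>. mdeg (snd v) = d + 1}"

definition coord_forms :: "nat \<Rightarrow> nat \<Rightarrow> 'n coord_poly set" where
  "coord_forms d k = {f \<in> coord_ring d. homog k f}"

definition coords :: "('n::finite, complex) form1 \<Rightarrow> 'n \<times> 'n monomial \<Rightarrow> complex" where
  "coords \<omega> = (\<lambda>(i, m). Poly_Mapping.lookup (\<omega> $ i) m)"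

definition basic_open :: "nat \<Rightarrow> 'n coord_poly \<Rightarrow> ('n::finite, complex) form1 set set" where
  "basic_open d f =
     {proj_pt \<omega> | \<omega>. \<omega> \<in> twisted_forms d \<and> \<omega> \<noteq> 0 \<and> peval (coords \<omega>) f \<noteq> 0}"

text \<open>The Zariski topology on \<open>\<P>H\<^sup>0(\<P>\<^sup>r, \<Omega>\<^sup>1(d + 2))\<close>.\<close>

definition zariski :: "nat \<Rightarrow> ('n::finite, complex) form1 set topology" where
  "zariski d = topology_generated_by {basic_open d f | f k. f \<in> coord_forms d k}"


section \<open>Irreducible components\<close>

definition irreducible_in :: "'a topology \<Rightarrow> 'a set \<Rightarrow> bool" where
  "irreducible_in X S \<longleftrightarrow> S \<subseteq> topspace X \<and> S \<noteq> {} \<and>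
     (\<forall>A B. closedin X A \<and> closedin X B \<and> S \<subseteq> A \<union> B \<longrightarrow> S \<subseteq> A \<or> S \<subseteq> B)"

definition irreducible_component_of :: "'a topology \<Rightarrow> 'a set \<Rightarrow> bool" where
  "irreducible_component_of X S \<longleftrightarrow>
     irreducible_in X S \<and> (\<forall>T. irreducible_in X T \<and> S \<subseteq> T \<longrightarrow> T = S)"


section \<open>The scheme structure\<close>

text \<open>The 1-form whose coefficients are the coordinate functions themselves; the scheme of
  foliations is cut out by the linear equations \<open>contract \<omega> = 0\<close>, defining the ambient
  \<open>\<P>H\<^sup>0\<close>, and the quadratic equations \<open>\<omega> \<and> d\<omega> = 0\<close>, both read off from this form.\<close>

definition universal_form :: "nat \<Rightarrow> ('n::finite, 'n coord_poly) form1" where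
  "universal_form d = (\<chi> i. \<Sum>m\<in>{m. mdeg m = d + 1}. Poly_Mapping.single m (Var (i, m)))"

definition foliation_equations :: "nat \<Rightarrow> 'n::finite coord_poly set" where
  "foliation_equations d =
     {Poly_Mapping.lookup (contract (universal_form d)) m | m. True} \<union>
     {Poly_Mapping.lookup (wedge_d (universal_form d) i j k) m | i j k m. True}"

definition ideal_generated :: "'a::comm_ring_1 set \<Rightarrow> 'a set \<Rightarrow> 'a set" where
  "ideal_generated S G = {\<Sum>g\<in>B. s g * g | B s. finite B \<and> B \<subseteq> G \<and> s ` B \<subseteq> S}"

definition foliation_ideal :: "nat \<Rightarrow> 'n::finite coord_poly set" where
  "foliation_ideal d = ideal_generated (coord_ring d) (foliation_equations d)"

text \<open>The homogeneous ideal of a set of points.\<close>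

definition vanishing_ideal ::
  "nat \<Rightarrow> ('n::finite, complex) form1 set set \<Rightarrow> 'n coord_poly set" where
  "vanishing_ideal d E =
     {f \<in> coord_ring d. \<forall>\<omega>. \<omega> \<noteq> 0 \<and> proj_pt \<omega> \<in> E \<longrightarrow> peval (coords \<omega>) f = 0}"

text \<open>With \<open>S = coord_ring d\<close>, \<open>I = foliation_ideal d\<close> and \<open>P = vanishing_ideal d E\<close> for an
  irreducible closed \<open>E\<close>, the local ring at the generic point of \<open>E\<close> is the homogeneous
  localization \<open>(S/I)\<^sub>(\<^sub>P\<^sub>)\<close>. It is given here by fractions, i.e. pairs (numerator, denominator)
  of forms of the same degree, together with the equality of fractions.\<close>

definition stalk_fractions ::
  "nat \<Rightarrow> ('n::finite, complex) form1 set set \<Rightarrow> ('n coord_poly \<times> 'n coord_poly) set" where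
  "stalk_fractions d E =
     {(f, g) | f g k. f \<in> coord_forms d k \<and> g \<in> coord_forms d k \<and> g \<notin> vanishing_ideal d E}"

definition stalk_eq :: "nat \<Rightarrow> ('n::finite, complex) form1 set set \<Rightarrow>
    'n coord_poly \<times> 'n coord_poly \<Rightarrow> 'n coord_poly \<times> 'n coord_poly \<Rightarrow> bool" where
  "stalk_eq d E = (\<lambda>(f, g) (f', g').
     \<exists>h k. h \<in> coord_forms d k \<and> h \<notin> vanishing_ideal d E \<and>
       h * (f * g' - f' * g) \<in> foliation_ideal d)"

text \<open>No nonzero nilpotents in the local ring.\<close>

definition reduced_at_generic_point :: "nat \<Rightarrow> ('n::finite, complex) form1 set set \<Rightarrow> bool" where
  "reduced_at_generic_point d E \<longleftrightarrow>
     (\<forall>(f, g) \<in> stalk_fractions d E. \<forall>n::nat.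
        stalk_eq d E (f ^ n, g ^ n) (0, 1) \<longrightarrow> stalk_eq d E (f, g) (0, 1))"


section \<open>Binary quartics\<close>

text \<open>The coordinates \<open>a\<^sub>0, \<dots>, a\<^sub>4\<close> on binary quartics are indexed by the five-element type
  \<open>5\<close> (whose elements are \<open>0, \<dots>, 4\<close>), and the variables \<open>t\<^sub>0, t\<^sub>1\<close> by the type \<open>2\<close>.\<close>

definition binary_quartic :: "complex ^ 5 \<Rightarrow> (2, complex) mpoly" where
  "binary_quartic a =
     (\<Sum>k\<le>4. Const (of_nat (4 choose k) * a $ of_nat k) * Var 0 ^ (4 - k) * Var 1 ^ k)"

text \<open>Points of \<open>P(1)\<close> are represented by nonzero linear forms, and addition of divisors is
  multiplication of forms. This is the cone (without origin) over the osculating hyperplane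
  \<open>{p + q + r + s}\<close> at \<open>4p\<close>.\<close>

definition osculating_cone :: "(2, complex) mpoly \<Rightarrow> (complex ^ 5) set" where
  "osculating_cone p = {a. \<exists>q r s. homog 1 q \<and> q \<noteq> 0 \<and> homog 1 r \<and> r \<noteq> 0 \<and>
     homog 1 s \<and> s \<noteq> 0 \<and> binary_quartic a = p * q * r * s}"

abbreviation a_coord :: "5 \<Rightarrow> (5, complex) mpoly" (\<open>\<a>\<close>) where
  "\<a> \<equiv> Var"

definition Q_inv :: "(5, complex) mpoly" where
  "Q_inv = \<a> 0 * \<a> 4 - 4 * \<a> 1 * \<a> 3 + 3 * \<a> 2 ^ 2"

definition C_inv :: "(5, complex) mpoly" where
  "C_inv = \<a> 0 * \<a> 2 * \<a> 4 - \<a> 0 * \<a> 3 ^ 2 + 2 * \<a> 1 * \<a> 2 * \<a> 3 - \<a> 1 ^ 2 * \<a> 4 - \<a> 2 ^ 3"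

definition quartic_form :: "(5, complex) form1" where
  "quartic_form = (2 * Q_inv) *s ext_deriv C_inv - (3 * C_inv) *s ext_deriv Q_inv"

end

theory Submission
  imports Defs "HOL-Computational_Algebra.Fundamental_Theorem_Algebra"
begin

text \<open>Write \<open>\<eta>\<close> for the divided form. Every osculating hyperplane is carried to \<open>a\<^sub>4 = 0\<close> by a
  substitution in \<open>t\<^sub>0, t\<^sub>1\<close> that leaves \<open>\<omega>\<close> unchanged, because \<open>Q\<close> and \<open>C\<close> are invariants; hence up
  to a linear change of coordinates and a scalar \<open>\<eta>\<close> is one explicit cubic form \<open>eta0\<close> in four
  variables. Both claims concern only the closure of its orbit.

  The reason for them is infinitesimal rigidity: a twisted form \<open>\<omega>\<close> that satisfies the equations
  of the scheme of foliations to first order at \<open>eta0\<close>, that is \<open>eta0 \<and> d\<omega> + \<omega> \<and> d eta0 = 0\<close>, is the Lie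
  derivative of \<open>eta0\<close> along a linear vector field (\<open>eta0_rigid\<close>). This is a linear system in 80
  unknown coefficients. Its solution space has dimension 14, which is also the dimension of the
  cone over the orbit, as the stabilizer of \<open>eta0\<close> has dimension two. After subtracting a Lie derivative, 14
  coefficients of \<open>\<omega>\<close> vanish, and the equations make the other 66 vanish.

  Rigidity says that the tangent space of the scheme at \<open>eta0\<close> consists of velocities of curves in
  the orbit. The passage from tangent vectors to equations is \<open>tangent_criterion\<close>. Let \<open>f\<close> vanish on
  the orbit and let \<open>I\<close> be the ideal of the scheme. The leading form of \<open>f\<close> at \<open>eta0\<close> vanishes on
  all these velocities, so it lies in the ideal generated by the linear parts of elements of \<open>I\<close>;
  subtracting an element of \<open>I\<close> raises the order of vanishing of \<open>f\<close> at \<open>eta0\<close>, and this can be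
  repeated. Thus \<open>f\<close> lies in \<open>I\<close> up to every power of the maximal ideal, and Krull's intersection
  theorem, obtained from Hilbert's basis theorem for the Rees ring, gives \<open>h\<close> with \<open>h(eta0) \<noteq> 0\<close>
  and \<open>h f \<in> I\<close>; as \<open>I\<close> is homogeneous, \<open>h\<close> may be taken homogeneous.

  So \<open>I\<close> and the ideal of the orbit agree in the local ring at the generic point, which is reduced
  (\<open>rigid_reduced\<close>). If \<open>T\<close> is an irreducible set of foliations containing the orbit, then \<open>h f\<close>
  vanishes on \<open>T\<close> but \<open>h\<close> does not, so \<open>f\<close> vanishes on \<open>T\<close>, and \<open>T\<close> lies in the closure of the
  orbit (\<open>rigid_component\<close>). The closure itself is irreducible because two elements of the general
  linear group are joined by an affine line.\<close>

section \<open>Polynomials as a ring\<close>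

abbreviation lookup :: "('a \<Rightarrow>\<^sub>0 'b::zero) \<Rightarrow> 'a \<Rightarrow> 'b" where "lookup \<equiv> Poly_Mapping.lookup"
abbreviation keys :: "('a \<Rightarrow>\<^sub>0 'b::zero) \<Rightarrow> 'a set" where "keys \<equiv> Poly_Mapping.keys"
abbreviation single :: "'a \<Rightarrow> 'b \<Rightarrow> 'a \<Rightarrow>\<^sub>0 'b::zero" where "single \<equiv> Poly_Mapping.single"

lemma sum_single_keys: "p = (\<Sum>m\<in>keys p. single m (lookup p m))"
  by (rule poly_mapping_eqI)
     (simp add: lookup_sum lookup_single when_def sum.delta' in_keys_iff)

lemma mpoly_additive_induct [case_names zero single add]:
  assumes "P 0" "\<And>m c. P (single m c)" "\<And>p q. P p \<Longrightarrow> P q \<Longrightarrow> P (p + q)"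
  shows "P (p :: 'a \<Rightarrow>\<^sub>0 'b::comm_monoid_add)"
proof -
  have "P (\<Sum>m\<in>M. single m (lookup p m))" if "finite M" for M
    using that by (induction M) (auto intro: assms)
  from this[OF finite_keys[of p]] show ?thesis by (simp flip: sum_single_keys)
qed

lemma Const_0 [simp]: "Const 0 = 0" and Const_1 [simp]: "Const 1 = 1"
  by (simp_all add: Const_def)

lemma Const_add: "Const (a + b) = Const a + Const b"
  and Const_mult: "Const (a * b) = Const a * Const b"
  and Const_uminus: "Const (- a) = - Const a"
  and Const_diff: "Const (a - b) = Const a - Const b"
  by (simp_all add: Const_def single_add mult_single single_uminus single_diff)

lemma Const_numeral: "Const (numeral n) = numeral n"
  by (simp add: Const_def)

lemma lookup_Const_mult: "lookup (Const c * p) m = c * lookup p m"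
proof (induction p rule: mpoly_additive_induct)
  case (single n d)
  then show ?case by (simp add: Const_def mult_single lookup_single when_def)
qed (simp_all add: algebra_simps lookup_add)

lemma single_eq_Const_mult: "single m c = Const c * single m 1"
  by (simp add: Const_def mult_single)

text \<open>A monomial is a product of variables; stated as closure so that it serves every property
  that is compatible with products.\<close>

lemma single_monomial_ring:
  assumes "\<And>v. v \<in> keys m \<Longrightarrow> P (Var v)" "P 1" "\<And>p q. P p \<Longrightarrow> P q \<Longrightarrow> P (p * q)"
  shows "P (single m (1::'a::comm_ring_1))"
proof -
  have *: "P (single (single v k) 1)" if "P (Var v)" for v and k :: nat
  proof (induction k)
    case (Suc k)
    have "single (single v (Suc k)) (1::'a) = Var v * single (single v k) 1"
      by (simp add: Var_def mult_single single_add[symmetric])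
    then show ?case using assms(3)[OF that Suc] by simp
  qed (simp add: assms(2))
  have "P (single (\<Sum>v\<in>M. single v (lookup m v)) 1)" if "finite M" "M \<subseteq> keys m" for M
    using that
  proof (induction M)
    case (insert v M)
    have "single (\<Sum>v\<in>insert v M. single v (lookup m v)) (1::'a)
        = single (single v (lookup m v)) 1 * single (\<Sum>v\<in>M. single v (lookup m v)) 1"
      using insert by (simp add: mult_single)
    then show ?case using insert * assms(1) by (simp add: assms(3))
  qed (simp add: assms(2))
  from this[OF finite_keys order_refl] show ?thesis by (simp flip: sum_single_keys)
qed

lemma mpoly_ring_induct [case_names Const Var add mult]:
  fixes p :: "('v, 'a::comm_ring_1) mpoly"
  assumes C: "\<And>c. P (Const c)" and V: "\<And>m v. m \<in> keys p \<Longrightarrow> v \<in> keys m \<Longrightarrow> P (Var v)"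
    and a: "\<And>p q. P p \<Longrightarrow> P q \<Longrightarrow> P (p + q)" and m: "\<And>p q. P p \<Longrightarrow> P q \<Longrightarrow> P (p * q)"
  shows "P p"
proof -
  have 1: "P (single m c)" if "m \<in> keys p" for m c
  proof -
    have "P (single m 1)"
      by (rule single_monomial_ring[of m P]) (use C[of 1] in \<open>simp_all add: V[OF that] m\<close>)
    from m[OF C this] show ?thesis by (subst single_eq_Const_mult)
  qed
  have "P (\<Sum>m\<in>M. single m (lookup p m))" if "finite M" "M \<subseteq> keys p" for M
    using that
  proof (induction M)
    case empty
    then show ?case using C[of 0] by simp
  next
    case (insert m M)
    then show ?case by (simp add: a 1)
  qed
  from this[OF finite_keys order_refl] show ?thesis by (simp flip: sum_single_keys)
qed

subsection \<open>Evaluation\<close>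

definition mon_eval :: "('v \<Rightarrow> 'b::comm_ring_1) \<Rightarrow> 'v monomial \<Rightarrow> 'b" where
  "mon_eval x m = (\<Prod>v\<in>keys m. x v ^ lookup m v)"

lemma mon_eval_superset:
  "finite K \<Longrightarrow> keys m \<subseteq> K \<Longrightarrow> mon_eval x m = (\<Prod>v\<in>K. x v ^ lookup m v)"
  unfolding mon_eval_def by (rule prod.mono_neutral_left) (auto simp: in_keys_iff)

lemma keys_add_nat: "keys (m + n :: 'v monomial) = keys m \<union> keys n"
  by (auto simp: in_keys_iff lookup_add)

lemma mon_eval_add: "mon_eval x (m + n) = mon_eval x m * mon_eval x n"
proof -
  let ?K = "keys m \<union> keys n"
  have "mon_eval x (m + n) = (\<Prod>v\<in>?K. x v ^ lookup (m + n) v)"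
    by (rule mon_eval_superset) (auto simp: keys_add_nat)
  also have "\<dots> = (\<Prod>v\<in>?K. x v ^ lookup m v) * (\<Prod>v\<in>?K. x v ^ lookup n v)"
    by (simp add: lookup_add power_add prod.distrib)
  also have "\<dots> = mon_eval x m * mon_eval x n"
    using mon_eval_superset[of ?K m x] mon_eval_superset[of ?K n x] by simp
  finally show ?thesis .
qed

lemma mon_eval_0 [simp]: "mon_eval x 0 = 1"
  by (simp add: mon_eval_def)

lemma mon_eval_single [simp]: "mon_eval x (single v k) = x v ^ k"
  by (simp add: mon_eval_def)

locale coeff_hom =
  fixes h :: "'a::comm_ring_1 \<Rightarrow> 'b::comm_ring_1"
  assumes hom_1: "h 1 = 1" and hom_add: "h (a + b) = h a + h b" and hom_mult: "h (a * b) = h a * h b"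
begin

lemma hom_0: "h 0 = 0"
  using hom_add[of 0 0] by simp

lemma eval_with_superset:
  "finite K \<Longrightarrow> keys p \<subseteq> K \<Longrightarrow> eval_with h x p = (\<Sum>m\<in>K. h (lookup p m) * mon_eval x m)"
  unfolding eval_with_def mon_eval_def
  by (rule sum.mono_neutral_left) (auto simp: in_keys_iff hom_0)

lemma eval_add: "eval_with h x (p + q) = eval_with h x p + eval_with h x q"
proof -
  let ?K = "keys p \<union> keys q"
  have "eval_with h x (p + q) = (\<Sum>m\<in>?K. h (lookup (p + q) m) * mon_eval x m)"
    by (rule eval_with_superset) (use Poly_Mapping.keys_add[of p q] in auto)
  also have "\<dots> = (\<Sum>m\<in>?K. h (lookup p m) * mon_eval x m) + (\<Sum>m\<in>?K. h (lookup q m) * mon_eval x m)"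
    by (simp add: lookup_add hom_add algebra_simps sum.distrib)
  also have "\<dots> = eval_with h x p + eval_with h x q"
    using eval_with_superset[of ?K p x] eval_with_superset[of ?K q x] by simp
  finally show ?thesis .
qed

lemma eval_0: "eval_with h x 0 = 0"
  by (simp add: eval_with_def)

lemma eval_single: "eval_with h x (single m c) = h c * mon_eval x m"
  using eval_with_superset[of "{m}" "single m c" x] by simp

lemma eval_Const: "eval_with h x (Const c) = h c"
  by (simp add: Const_def eval_single)

lemma eval_Var: "eval_with h x (Var v) = x v"
  by (simp add: Var_def eval_single hom_1)

lemma eval_1: "eval_with h x 1 = 1"
  using eval_Const[of x 1] by (simp add: hom_1)

lemma eval_mult: "eval_with h x (p * q) = eval_with h x p * eval_with h x q"
proof (induction p rule: mpoly_additive_induct)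
  case (single m c)
  show ?case
    by (induction q rule: mpoly_additive_induct)
       (simp_all add: eval_0 eval_single mult_single mon_eval_add hom_mult eval_add algebra_simps)
qed (simp_all add: eval_0 eval_add algebra_simps)

lemma eval_uminus: "eval_with h x (- p) = - eval_with h x p"
proof -
  have "eval_with h x (- p) + eval_with h x p = 0"
    by (metis add.left_inverse eval_0 eval_add)
  then show ?thesis by (simp add: eq_neg_iff_add_eq_0)
qed

lemma eval_diff: "eval_with h x (p - q) = eval_with h x p - eval_with h x q"
  using eval_add[of x p "- q"] by (simp add: eval_uminus)

lemma eval_sum: "eval_with h x (sum f A) = (\<Sum>a\<in>A. eval_with h x (f a))"
  by (induction A rule: infinite_finite_induct) (simp_all add: eval_0 eval_add)

lemma eval_power: "eval_with h x (p ^ n) = eval_with h x p ^ n"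
  by (induction n) (simp_all add: eval_1 eval_mult)

lemma eval_of_nat: "eval_with h x (of_nat n) = of_nat n"
  by (induction n) (simp_all add: eval_0 eval_1 eval_add)

lemma eval_numeral: "eval_with h x (numeral n) = numeral n"
  using eval_of_nat[of x "numeral n"] by simp

lemmas eval_simps = eval_add eval_0 eval_1 eval_mult eval_uminus eval_diff eval_sum eval_power
  eval_of_nat eval_numeral eval_Const eval_Var

end

interpretation id_hom: coeff_hom "\<lambda>c. c" by standard simp_all
interpretation Const_hom: coeff_hom Const by standard (simp_all add: Const_add Const_mult)

lemmas peval_simps = id_hom.eval_simps
lemmas psubst_simps = Const_hom.eval_simps

lemma peval_psubst: "peval x (psubst y p) = peval (\<lambda>v. peval x (y v)) p"
  by (induction p rule: mpoly_ring_induct) (simp_all add: peval_simps psubst_simps)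

lemma peval_zero_point: "peval (\<lambda>_. 0) p = lookup p 0"
proof -
  have *: "mon_eval (\<lambda>_. 0) m = (if m = 0 then 1 else (0::'a))" for m :: "'b monomial"
  proof (cases "m = 0")
    case False
    then obtain v where "v \<in> keys m" by (metis keys_eq_empty equals0I)
    then have "\<exists>v\<in>keys m. (0::'a) ^ lookup m v = 0"
      by (intro bexI[of _ v]) (auto simp: in_keys_iff power_0_left)
    then show ?thesis using False unfolding mon_eval_def
      by (simp add: prod_zero)
  qed simp
  show ?thesis
    by (induction p rule: mpoly_additive_induct)
       (auto simp: peval_simps id_hom.eval_single * lookup_single lookup_add when_def)
qed

subsection \<open>Formal differentiation\<close>

lemma pdiff_superset:
  "finite K \<Longrightarrow> keys p \<subseteq> K \<Longrightarrow> pdiff v p =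
    (\<Sum>m\<in>K. single (m - single v 1) (of_nat (lookup m v) * lookup p m))"
  unfolding pdiff_def by (rule sum.mono_neutral_left) (auto simp: in_keys_iff)

lemma pdiff_0 [simp]: "pdiff v 0 = 0"
  by (simp add: pdiff_def)

lemma pdiff_add: "pdiff v (p + q) = pdiff v p + pdiff v q"
proof -
  let ?K = "keys p \<union> keys q"
  have "pdiff v (p + q) = (\<Sum>m\<in>?K. single (m - single v 1) (of_nat (lookup m v) * lookup (p + q) m))"
    by (rule pdiff_superset) (use Poly_Mapping.keys_add[of p q] in auto)
  also have "\<dots> = pdiff v p + pdiff v q"
    using pdiff_superset[of ?K p v] pdiff_superset[of ?K q v]
    by (simp add: lookup_add algebra_simps sum.distrib single_add)
  finally show ?thesis .
qed

lemma pdiff_single: "pdiff v (single m c) = single (m - single v 1) (of_nat (lookup m v) * c)"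
  using pdiff_superset[of "{m}" "single m c" v] by simp

lemma pdiff_Const [simp]: "pdiff v (Const c) = 0"
  by (simp add: Const_def pdiff_single)

lemma pdiff_1 [simp]: "pdiff v 1 = 0"
  using pdiff_Const[of v 1] by simp

lemma pdiff_Var: "pdiff v (Var w) = (if v = w then 1 else 0)"
  by (auto simp: Var_def pdiff_single lookup_single)

lemma lookup_pdiff: "lookup (pdiff v p) m = of_nat (lookup m v + 1) * lookup p (m + single v 1)"
proof (induction p rule: mpoly_additive_induct)
  case (single n c)
  show ?case
  proof (cases "lookup n v = 0")
    case True
    then have "n \<noteq> m + single v 1"
      by (metis add_is_0 lookup_add lookup_single_eq one_neq_zero)
    then show ?thesis using True by (simp add: pdiff_single lookup_single)
  next
    case False
    then have 1: "n - single v 1 + single v 1 = n"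
      by (intro poly_mapping_eqI) (auto simp: lookup_add lookup_minus lookup_single when_def)
    have 2: "m + single v 1 - single v 1 = m" by simp
    have "n - single v 1 = m \<longleftrightarrow> n = m + single v 1" using 1 2 by metis
    then show ?thesis
      by (auto simp: pdiff_single lookup_single lookup_add when_def)
  qed
qed (simp_all add: pdiff_add lookup_add algebra_simps)

lemma pdiff_mult: "pdiff v (p * q) = pdiff v p * q + p * pdiff v q"
proof (induction p rule: mpoly_additive_induct)
  case (single m c)
  show ?case
  proof (induction q rule: mpoly_additive_induct)
    case (single n d)
    have 1: "n + (m - single v 1) = m + n - single v 1" if "lookup m v > 0"
      using that by (intro poly_mapping_eqI) (auto simp: lookup_add lookup_minus lookup_single when_def)
    have 2: "m + (n - single v 1) = m + n - single v 1" if "lookup n v > 0"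
      using that by (intro poly_mapping_eqI) (auto simp: lookup_add lookup_minus lookup_single when_def)
    show ?case
      by (cases "lookup m v > 0"; cases "lookup n v > 0")
         (simp_all add: pdiff_single mult_single lookup_add 1 2 algebra_simps single_add[symmetric] del: One_nat_def)
  qed (simp_all add: pdiff_add algebra_simps)
qed (simp_all add: pdiff_add algebra_simps)

lemma pdiff_uminus: "pdiff v (- p) = - pdiff v p"
  by (metis add.left_inverse add_eq_0_iff pdiff_0 pdiff_add)

lemma pdiff_diff: "pdiff v (p - q) = pdiff v p - pdiff v q"
  using pdiff_add[of v p "- q"] by (simp add: pdiff_uminus)

lemma pdiff_sum: "pdiff v (sum f A) = (\<Sum>a\<in>A. pdiff v (f a))"
  by (induction A rule: infinite_finite_induct) (simp_all add: pdiff_add)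

lemma pdiff_of_nat [simp]: "pdiff v (of_nat n) = 0"
  by (induction n) (simp_all add: pdiff_add)

lemma pdiff_numeral [simp]: "pdiff v (numeral n) = 0"
  using pdiff_of_nat[of v "numeral n"] by simp

lemma pdiff_power: "pdiff v (p ^ n) = of_nat n * p ^ (n - 1) * pdiff v p"
proof (induction n)
  case (Suc n)
  then show ?case by (cases n) (simp_all add: pdiff_mult algebra_simps)
qed simp

lemma pdiff_psubst:
  fixes y :: "'v::finite \<Rightarrow> ('w, 'a::comm_ring_1) mpoly"
  shows "pdiff w (psubst y p) = (\<Sum>v\<in>UNIV. psubst y (pdiff v p) * pdiff w (y v))"
proof (induction p rule: mpoly_ring_induct)
  case (Var m v)
  have "(\<Sum>u\<in>UNIV. psubst y (pdiff u (Var v)) * pdiff w (y u))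
      = (\<Sum>u\<in>UNIV. if u = v then pdiff w (y u) else 0)"
    by (rule sum.cong) (simp_all add: pdiff_Var psubst_simps)
  then show ?case by (simp add: psubst_simps)
next
  case (mult p q)
  then show ?case
    by (simp add: pdiff_mult psubst_simps algebra_simps sum.distrib sum_distrib_left)
qed (simp_all add: psubst_simps pdiff_add algebra_simps sum.distrib)

subsection \<open>Polynomials and polynomial functions\<close>

lemma DERIV_peval:
  fixes p :: "('v, complex) mpoly"
  assumes "\<And>v. ((\<lambda>t. \<gamma> t v) has_field_derivative (if v = w then 1 else 0)) (at t)"
  shows "((\<lambda>t. peval (\<gamma> t) p) has_field_derivative peval (\<gamma> t) (pdiff w p)) (at t)"
proof (induction p rule: mpoly_ring_induct)
  case (Var m v)
  then show ?case using assms[of v] by (auto simp: peval_simps pdiff_Var)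
next
  case (mult p q)
  show ?case using DERIV_mult[OF mult] by (simp add: peval_simps pdiff_mult algebra_simps)
next
  case (add p q)
  show ?case using DERIV_add[OF add] by (simp add: peval_simps pdiff_add algebra_simps)
qed (simp add: peval_simps)

text \<open>A polynomial function that vanishes everywhere has vanishing derivatives of all orders
  at the origin, and these are the coefficients up to factorials.\<close>

lemma peval_inj_zero:
  fixes p :: "('v, complex) mpoly"
  assumes "\<And>x. peval x p = 0"
  shows "p = 0"
proof (rule poly_mapping_eqI)
  fix m
  show "lookup p m = lookup 0 m" using assms
  proof (induction "\<Sum>v\<in>keys m. lookup m v" arbitrary: m p)
    case 0
    then have "m = 0"
      by (intro poly_mapping_eqI) (auto simp: in_keys_iff)
    then show ?case using peval_zero_point[of p] 0 by simp
  next
    case (Suc n)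
    then have "keys m \<noteq> {}" by auto
    then obtain v where v: "v \<in> keys m" by blast
    have "peval x (pdiff v p) = 0" for x
    proof -
      have "((\<lambda>t. peval (x(v := t)) p) has_field_derivative peval (x(v := x v)) (pdiff v p)) (at (x v))"
        by (rule DERIV_peval) (auto intro!: derivative_eq_intros)
      moreover have "((\<lambda>t. peval (x(v := t)) p) has_field_derivative 0) (at (x v))"
        by (simp add: Suc)
      ultimately show ?thesis using DERIV_unique by fastforce
    qed
    moreover have m: "m - single v 1 + single v 1 = m"
      using v by (intro poly_mapping_eqI) (auto simp: lookup_add lookup_minus lookup_single when_def in_keys_iff)
    moreover have "n = (\<Sum>u\<in>keys (m - single v 1). lookup (m - single v 1) u)"
    proof -
      have sub: "keys (m - single v 1) \<subseteq> keys m" by (auto simp: in_keys_iff lookup_minus)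
      have "(\<Sum>u\<in>keys (m - single v 1). lookup (m - single v 1) u) = (\<Sum>u\<in>keys m. lookup (m - single v 1) u)"
        by (rule sum.mono_neutral_left) (use sub in \<open>auto simp: in_keys_iff\<close>)
      moreover have "lookup m u = lookup (m - single v 1) u + (if u = v then 1 else 0)" for u
        using v by (auto simp: lookup_minus lookup_single when_def in_keys_iff)
      then have "(\<Sum>u\<in>keys m. lookup m u) = (\<Sum>u\<in>keys m. lookup (m - single v 1) u + (if u = v then 1 else 0))"
        by (intro sum.cong refl)
      moreover have "\<dots> = (\<Sum>u\<in>keys m. lookup (m - single v 1) u) + 1"
        using v by (simp add: sum.distrib)
      ultimately show ?thesis using Suc.hyps(2) by simp
    qed
    ultimately have "lookup (pdiff v p) (m - single v 1) = 0"
      using Suc.hyps(1)[of "m - single v 1" "pdiff v p"] by simp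
    then show ?case using v m
      by (simp add: lookup_pdiff in_keys_iff del: of_nat_Suc of_nat_add)
  qed
qed

lemma peval_inj:
  fixes p q :: "('v, complex) mpoly"
  assumes "\<And>x. peval x p = peval x q"
  shows "p = q"
  using peval_inj_zero[of "p - q"] assms by (simp add: peval_simps)

lemma peval_on_line:
  fixes p :: "('v, complex) mpoly"
  shows "\<exists>q. \<forall>t. peval (\<lambda>v. x v + t * y v) p = poly q t"
proof (induction p rule: mpoly_ring_induct)
  case (Const c)
  have "\<forall>t. peval (\<lambda>v. x v + t * y v) (Const c) = poly [:c:] t" by (simp add: peval_simps)
  then show ?case by blast
next
  case (Var m v)
  have "\<forall>t. peval (\<lambda>v. x v + t * y v) (Var v) = poly [:x v, y v:] t" by (simp add: peval_simps)
  then show ?case by blast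
next
  case (add p q)
  then obtain a b where "\<forall>t. peval (\<lambda>v. x v + t * y v) p = poly a t"
    "\<forall>t. peval (\<lambda>v. x v + t * y v) q = poly b t" by blast
  then have "\<forall>t. peval (\<lambda>v. x v + t * y v) (p + q) = poly (a + b) t" by (simp add: peval_simps)
  then show ?case by blast
next
  case (mult p q)
  then obtain a b where "\<forall>t. peval (\<lambda>v. x v + t * y v) p = poly a t"
    "\<forall>t. peval (\<lambda>v. x v + t * y v) q = poly b t" by blast
  then have "\<forall>t. peval (\<lambda>v. x v + t * y v) (p * q) = poly (a * b) t" by (simp add: peval_simps)
  then show ?case by blast
qed

subsection \<open>Homogeneous polynomials\<close>

lemma mdeg_superset: "finite K \<Longrightarrow> keys m \<subseteq> K \<Longrightarrow> mdeg m = (\<Sum>v\<in>K. lookup m v)"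
  unfolding mdeg_def by (rule sum.mono_neutral_left) (auto simp: in_keys_iff)

lemma mdeg_add: "mdeg (m + n) = mdeg m + mdeg n"
  using mdeg_superset[of "keys m \<union> keys n" m] mdeg_superset[of "keys m \<union> keys n" n]
    mdeg_superset[of "keys m \<union> keys n" "m + n"]
  by (simp add: keys_add_nat lookup_add sum.distrib)

lemma mdeg_0 [simp]: "mdeg 0 = 0" by (simp add: mdeg_def)
lemma mdeg_single [simp]: "mdeg (single v k) = k" by (simp add: mdeg_def)

lemma homogI: "(\<And>m. lookup p m \<noteq> 0 \<Longrightarrow> mdeg m = k) \<Longrightarrow> homog k p"
  by (simp add: homog_def in_keys_iff)

lemma homogD: "homog k p \<Longrightarrow> lookup p m \<noteq> 0 \<Longrightarrow> mdeg m = k"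
  by (simp add: homog_def in_keys_iff)

lemma homog_0 [simp]: "homog k 0" by (simp add: homog_def)
lemma homog_Const [simp]: "homog 0 (Const c)" by (simp add: homog_def Const_def)
lemma homog_1 [simp]: "homog 0 1" using homog_Const[of 1] by simp
lemma homog_Var [simp]: "homog 1 (Var v)" by (simp add: homog_def Var_def)
lemma homog_add: "homog k p \<Longrightarrow> homog k q \<Longrightarrow> homog k (p + q)"
  using Poly_Mapping.keys_add[of p q] by (auto simp: homog_def)

lemma homog_uminus: "homog k p \<Longrightarrow> homog k (- p)"
  by (rule homogI) (auto dest: homogD)

lemma homog_diff: "homog k p \<Longrightarrow> homog k q \<Longrightarrow> homog k (p - q)"
  using homog_add[of k p "- q"] by (simp add: homog_uminus)

lemma homog_sum: "(\<And>a. a \<in> A \<Longrightarrow> homog k (f a)) \<Longrightarrow> homog k (sum f A)"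
  by (induction A rule: infinite_finite_induct) (simp_all add: homog_add)

lemma homog_mult: "homog j p \<Longrightarrow> homog k q \<Longrightarrow> homog (j + k) (p * q)"
  using keys_mult[of p q] by (fastforce simp: homog_def mdeg_add)

lemma homog_power: "homog k p \<Longrightarrow> homog (k * n) (p ^ n)"
  by (induction n) (simp_all add: homog_mult)

lemma mon_eval_scale: "mon_eval (\<lambda>v. c * x v) m = c ^ mdeg m * mon_eval x m"
  by (simp add: mon_eval_def mdeg_def power_mult_distrib prod.distrib power_sum)

lemma peval_scale: "homog k p \<Longrightarrow> peval (\<lambda>v. c * x v) p = c ^ k * peval x p"
  unfolding eval_with_def mon_eval_def[symmetric] mon_eval_scale sum_distrib_left
  by (rule sum.cong) (simp_all add: homog_def)

definition homog_component :: "nat \<Rightarrow> ('v, 'a::comm_ring_1) mpoly \<Rightarrow> ('v, 'a) mpoly" where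
  "homog_component k p = (\<Sum>m\<in>{m\<in>keys p. mdeg m = k}. single m (lookup p m))"

lemma lookup_homog_component: "lookup (homog_component k p) m = (if mdeg m = k then lookup p m else 0)"
proof -
  have "lookup (homog_component k p) m = (\<Sum>n\<in>{n\<in>keys p. mdeg n = k}. if n = m then lookup p n else 0)"
    by (simp add: homog_component_def lookup_sum lookup_single when_def)
  also have "\<dots> = (if m \<in> {n\<in>keys p. mdeg n = k} then lookup p m else 0)"
    by (subst sum.delta) auto
  finally show ?thesis by (auto simp: in_keys_iff)
qed

lemma homog_homog_component [simp]: "homog k (homog_component k p)"
  by (rule homogI) (auto simp: lookup_homog_component split: if_splits)

lemma keys_homog_component: "keys (homog_component k p) \<subseteq> keys p"
  by (auto simp: in_keys_iff lookup_homog_component split: if_splits)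

lemma homog_component_sum: "homog_component k (sum f A) = (\<Sum>a\<in>A. homog_component k (f a))"
  by (rule poly_mapping_eqI) (simp add: lookup_homog_component lookup_sum)

lemma homog_component_homog: "homog j p \<Longrightarrow> homog_component k p = (if j = k then p else 0)"
  by (rule poly_mapping_eqI) (auto simp: lookup_homog_component dest: homogD)

lemma sum_homog_component: "\<exists>n. p = (\<Sum>k<n. homog_component k p)"
proof
  let ?n = "Suc (Max (insert 0 (mdeg ` keys p)))"
  show "p = (\<Sum>k<?n. homog_component k p)"
  proof (rule poly_mapping_eqI)
    fix m
    have "lookup (\<Sum>k<?n. homog_component k p) m = (\<Sum>k<?n. if k = mdeg m then lookup p m else 0)"
      unfolding lookup_sum lookup_homog_component by (rule sum.cong) auto
    also have "\<dots> = (if mdeg m < ?n then lookup p m else 0)" by (simp add: sum.delta)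
    also have "\<dots> = lookup p m"
    proof (cases "m \<in> keys p")
      case True
      then have "mdeg m \<le> Max (insert 0 (mdeg ` keys p))" by (intro Max_ge) auto
      then show ?thesis by simp
    next
      case False
      then show ?thesis by (simp add: in_keys_iff)
    qed
    finally show "lookup p m = lookup (\<Sum>k<?n. homog_component k p) m" by simp
  qed
qed

lemma homog_component_mult_homog:
  assumes "homog j q"
  shows "homog_component (k + j) (p * q) = homog_component k p * q"
proof -
  obtain n where n: "p = (\<Sum>i<n. homog_component i p)" using sum_homog_component by blast
  have *: "homog_component (k + j) (r * q) = homog_component k r * q" if "homog i r" for i r
  proof -
    have "homog (i + j) (r * q)" using that assms by (rule homog_mult)
    then show ?thesis using that by (simp add: homog_component_homog)
  qed
  have "homog_component (k + j) ((\<Sum>i<n. homog_component i p) * q) = homog_component k (\<Sum>i<n. homog_component i p) * q"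
    by (simp add: sum_distrib_right homog_component_sum *[OF homog_homog_component])
  then show ?thesis by (simp only: n[symmetric])
qed

lemma homog_component_mult_homog_low:
  assumes "homog j q" "k < j"
  shows "homog_component k (p * q) = 0"
proof -
  obtain n where n: "p = (\<Sum>i<n. homog_component i p)" using sum_homog_component by blast
  have "homog_component k (homog_component i p * q) = 0" for i
    using homog_mult[OF homog_homog_component assms(1)] assms(2) by (subst homog_component_homog) auto
  then have "homog_component k ((\<Sum>i<n. homog_component i p) * q) = 0"
    by (simp add: sum_distrib_right homog_component_sum)
  then show ?thesis by (simp only: n[symmetric])
qed

subsection \<open>Polynomials in a given set of variables\<close>

definition polys :: "'v set \<Rightarrow> ('v, 'a::comm_ring_1) mpoly set" where
  "polys V = {p. \<forall>m\<in>keys p. keys m \<subseteq> V}"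

lemma polys_0 [simp]: "0 \<in> polys V" by (simp add: polys_def)
lemma polys_Const [simp]: "Const c \<in> polys V" by (simp add: polys_def Const_def)
lemma polys_1 [simp]: "1 \<in> polys V" using polys_Const[of 1] by simp
lemma polys_Var [simp]: "v \<in> V \<Longrightarrow> Var v \<in> polys V" by (simp add: polys_def Var_def)

lemma polys_add: "p \<in> polys V \<Longrightarrow> q \<in> polys V \<Longrightarrow> p + q \<in> polys V"
  using Poly_Mapping.keys_add[of p q] by (auto simp: polys_def)

lemma polys_uminus: "p \<in> polys V \<Longrightarrow> - p \<in> polys V"
  by (simp add: polys_def)

lemma polys_diff: "p \<in> polys V \<Longrightarrow> q \<in> polys V \<Longrightarrow> p - q \<in> polys V"
  using polys_add[of p V "- q"] by (simp add: polys_uminus)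

lemma polys_mult: "p \<in> polys V \<Longrightarrow> q \<in> polys V \<Longrightarrow> p * q \<in> polys V"
  using keys_mult[of p q] by (fastforce simp: polys_def keys_add_nat)

lemma polys_sum: "(\<And>a. a \<in> A \<Longrightarrow> f a \<in> polys V) \<Longrightarrow> sum f A \<in> polys V"
  by (induction A rule: infinite_finite_induct) (simp_all add: polys_add)

lemma polys_induct [consumes 1, case_names Const Var add mult]:
  assumes "p \<in> polys V" "\<And>c. P (Const c)" "\<And>v. v \<in> V \<Longrightarrow> P (Var v)"
    "\<And>p q. P p \<Longrightarrow> P q \<Longrightarrow> P (p + q)" "\<And>p q. P p \<Longrightarrow> P q \<Longrightarrow> P (p * q)"
  shows "P p"
  by (induction p rule: mpoly_ring_induct) (use assms in \<open>auto simp: polys_def\<close>)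

section \<open>Noetherian rings and Krull's intersection theorem\<close>

subsection \<open>Generated ideals\<close>

definition subring :: "'a::comm_ring_1 set \<Rightarrow> bool" where
  "subring S \<longleftrightarrow> 1 \<in> S \<and> (\<forall>a\<in>S. \<forall>b\<in>S. a - b \<in> S \<and> a * b \<in> S)"

lemma subringD:
  assumes "subring S"
  shows "1 \<in> S" "0 \<in> S" "a \<in> S \<Longrightarrow> - a \<in> S" "a \<in> S \<Longrightarrow> b \<in> S \<Longrightarrow> a + b \<in> S"
    "a \<in> S \<Longrightarrow> b \<in> S \<Longrightarrow> a - b \<in> S" "a \<in> S \<Longrightarrow> b \<in> S \<Longrightarrow> a * b \<in> S"
proof -
  have 1: "1 \<in> S" and d: "\<And>a b. a \<in> S \<Longrightarrow> b \<in> S \<Longrightarrow> a - b \<in> S"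
    and m: "\<And>a b. a \<in> S \<Longrightarrow> b \<in> S \<Longrightarrow> a * b \<in> S"
    using assms by (auto simp: subring_def)
  have 0: "0 \<in> S" using d[OF 1 1] by simp
  have n: "\<And>a. a \<in> S \<Longrightarrow> - a \<in> S" using d[OF 0] by simp
  show "1 \<in> S" "0 \<in> S" "a \<in> S \<Longrightarrow> - a \<in> S" "a \<in> S \<Longrightarrow> b \<in> S \<Longrightarrow> a - b \<in> S"
    "a \<in> S \<Longrightarrow> b \<in> S \<Longrightarrow> a * b \<in> S" using 1 0 n d m by auto
  show "a \<in> S \<Longrightarrow> b \<in> S \<Longrightarrow> a + b \<in> S" using d[of a "- b"] n by simp
qed

lemma subring_sum: "subring S \<Longrightarrow> (\<And>i. i \<in> A \<Longrightarrow> f i \<in> S) \<Longrightarrow> sum f A \<in> S"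
  by (induction A rule: infinite_finite_induct) (auto intro: subringD)

lemma subring_power: "subring S \<Longrightarrow> a \<in> S \<Longrightarrow> a ^ n \<in> S"
  by (induction n) (auto intro: subringD)

definition ideal_of :: "'a::comm_ring_1 set \<Rightarrow> 'a set \<Rightarrow> bool" where
  "ideal_of S J \<longleftrightarrow> J \<subseteq> S \<and> 0 \<in> J \<and> (\<forall>a\<in>J. \<forall>b\<in>J. a + b \<in> J) \<and> (\<forall>s\<in>S. \<forall>a\<in>J. s * a \<in> J)"

lemma ideal_ofD:
  assumes "ideal_of S J"
  shows "a \<in> J \<Longrightarrow> a \<in> S" "0 \<in> J" "a \<in> J \<Longrightarrow> b \<in> J \<Longrightarrow> a + b \<in> J" "s \<in> S \<Longrightarrow> a \<in> J \<Longrightarrow> s * a \<in> J"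
  using assms by (auto simp: ideal_of_def)

lemma ideal_of_diff: "subring S \<Longrightarrow> ideal_of S J \<Longrightarrow> a \<in> J \<Longrightarrow> b \<in> J \<Longrightarrow> a - b \<in> J"
  using ideal_ofD(3)[of S J a "- b"] ideal_ofD(4)[of S J "-1" b] subringD(3)[of S 1] subringD(1)[of S]
  by simp

lemma ideal_of_sum: "ideal_of S J \<Longrightarrow> (\<And>i. i \<in> A \<Longrightarrow> f i \<in> J) \<Longrightarrow> sum f A \<in> J"
  by (induction A rule: infinite_finite_induct) (auto intro: ideal_ofD)

lemma ideal_generated_in:
  assumes "ideal_of S J" "G \<subseteq> J"
  shows "ideal_generated S G \<subseteq> J"
proof
  fix a assume "a \<in> ideal_generated S G"
  then obtain B s where B: "a = (\<Sum>g\<in>B. s g * g)" "finite B" "B \<subseteq> G" "s ` B \<subseteq> S"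
    by (auto simp: ideal_generated_def)
  show "a \<in> J" unfolding B(1)
    by (rule ideal_of_sum[OF assms(1)]) (use B assms ideal_ofD(4)[OF assms(1)] in blast)
qed

lemma ideal_generatedI:
  "finite A \<Longrightarrow> A \<subseteq> G \<Longrightarrow> s ` A \<subseteq> S \<Longrightarrow> (\<Sum>g\<in>A. s g * g) \<in> ideal_generated S G"
  unfolding ideal_generated_def by blast

lemma ideal_generated_ideal:
  assumes S: "subring S" and G: "G \<subseteq> S"
  shows "ideal_of S (ideal_generated S G)"
  unfolding ideal_of_def
proof (intro conjI ballI)
  show "ideal_generated S G \<subseteq> S"
    by (rule ideal_generated_in[OF _ G]) (use S in \<open>auto simp: ideal_of_def intro: subringD\<close>)
  show "0 \<in> ideal_generated S G"
    unfolding ideal_generated_def by (rule CollectI, rule exI[of _ "{}"]) auto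
next
  fix a b assume "a \<in> ideal_generated S G" "b \<in> ideal_generated S G"
  then obtain A s B t where A: "a = (\<Sum>g\<in>A. s g * g)" "finite A" "A \<subseteq> G" "s ` A \<subseteq> S"
    and B: "b = (\<Sum>g\<in>B. t g * g)" "finite B" "B \<subseteq> G" "t ` B \<subseteq> S"
    by (auto simp: ideal_generated_def)
  define u where "u g = (if g \<in> A then s g else 0) + (if g \<in> B then t g else 0)" for g
  have "(\<Sum>g\<in>A\<union>B. (if g \<in> A then s g else 0) * g) = a"
    unfolding A(1) by (rule sum.mono_neutral_cong_right) (use A B in auto)
  moreover have "(\<Sum>g\<in>A\<union>B. (if g \<in> B then t g else 0) * g) = b"
    unfolding B(1) by (rule sum.mono_neutral_cong_right) (use A B in auto)
  ultimately have "a + b = (\<Sum>g\<in>A\<union>B. u g * g)"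
    by (simp add: u_def algebra_simps sum.distrib)
  moreover have "u g \<in> S" for g
    unfolding u_def by (rule subringD(4)[OF S]) (use A(4) B(4) subringD(2)[OF S] in auto)
  then have "u ` (A \<union> B) \<subseteq> S" by auto
  ultimately show "a + b \<in> ideal_generated S G"
    using A(2,3) B(2,3) by (simp add: ideal_generatedI)
next
  fix r a assume r: "r \<in> S" and "a \<in> ideal_generated S G"
  then obtain A s where A: "a = (\<Sum>g\<in>A. s g * g)" "finite A" "A \<subseteq> G" "s ` A \<subseteq> S"
    by (auto simp: ideal_generated_def)
  have "r * a = (\<Sum>g\<in>A. (r * s g) * g)" by (simp add: A sum_distrib_left algebra_simps)
  moreover have "(\<lambda>g. r * s g) ` A \<subseteq> S" using A(4) subringD(6)[OF S r] by auto
  ultimately show "r * a \<in> ideal_generated S G"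
    using ideal_generatedI[OF A(2,3)] by simp
qed

lemma ideal_generated_incl:
  assumes "subring S" "g \<in> G"
  shows "g \<in> ideal_generated S G"
  unfolding ideal_generated_def
  by (rule CollectI, rule exI[of _ "{g}"], rule exI[of _ "\<lambda>_. 1"]) (use assms(2) subringD(1)[OF assms(1)] in auto)

lemma ideal_generated_mono: "G \<subseteq> H \<Longrightarrow> ideal_generated S G \<subseteq> ideal_generated S H"
  unfolding ideal_generated_def by blast

subsection \<open>Hilbert's basis theorem\<close>

definition noetherian :: "'a::comm_ring_1 set \<Rightarrow> bool" where
  "noetherian S \<longleftrightarrow> subring S \<and>
     (\<forall>J. ideal_of S J \<longrightarrow> (\<exists>B. finite B \<and> B \<subseteq> J \<and> J \<subseteq> ideal_generated S B))"

text \<open>In a Noetherian ring some term of a sequence is a combination of its predecessors,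
  because finitely many generators of the ideal of the sequence involve finitely many terms. This
  form of the chain condition is the one that is applied.\<close>

lemma noetherian_sequence:
  assumes N: "noetherian S" and f: "\<And>i. f i \<in> S"
  shows "\<exists>n::nat. \<exists>s. (\<forall>i<n. s i \<in> S) \<and> f n = (\<Sum>i<n. s i * f i)"
proof -
  have S: "subring S" using N by (simp add: noetherian_def)
  have fS: "range f \<subseteq> S" using f by auto
  obtain B where B: "finite B" "B \<subseteq> ideal_generated S (range f)"
    "ideal_generated S (range f) \<subseteq> ideal_generated S B"
    using N ideal_generated_ideal[OF S fS] unfolding noetherian_def by blast
  have "\<exists>n. b \<in> ideal_generated S (f ` {..<n})" if b: "b \<in> B" for b
  proof -
    obtain A s where A: "b = (\<Sum>g\<in>A. s g * g)" "finite A" "A \<subseteq> range f" "s ` A \<subseteq> S"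
      using B(2) b unfolding ideal_generated_def by blast
    obtain I where I: "finite I" "A = f ` I" using finite_subset_image[OF A(2,3)] by auto
    obtain n where "I \<subseteq> {..<n}" using I(1) finite_nat_iff_bounded by blast
    then have "A \<subseteq> f ` {..<n}" using I(2) by blast
    then show ?thesis using ideal_generatedI[OF A(2) _ A(4)] A(1) by blast
  qed
  then obtain n where n: "\<And>b. b \<in> B \<Longrightarrow> b \<in> ideal_generated S (f ` {..<n b})" by metis
  define N where "N = Max (insert 0 (n ` B))"
  have "n b \<le> N" if "b \<in> B" for b unfolding N_def by (rule Max_ge) (use B(1) that in auto)
  then have "f ` {..<n b} \<subseteq> f ` {..<N}" if "b \<in> B" for b using that by fastforce
  then have "B \<subseteq> ideal_generated S (f ` {..<N})"
    using n ideal_generated_mono[of "f ` {..<n _}" "f ` {..<N}" S] by blast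
  moreover have "f ` {..<N} \<subseteq> S" using f by auto
  ultimately have "ideal_generated S B \<subseteq> ideal_generated S (f ` {..<N})"
    using ideal_generated_in ideal_generated_ideal[OF S] by blast
  moreover have "f N \<in> ideal_generated S (range f)" by (rule ideal_generated_incl[OF S]) auto
  ultimately have "f N \<in> ideal_generated S (f ` {..<N})" using B(3) by blast
  then obtain A s where A: "f N = (\<Sum>g\<in>A. s g * g)" "finite A" "A \<subseteq> f ` {..<N}" "s ` A \<subseteq> S"
    unfolding ideal_generated_def by blast
  obtain I where I: "I \<subseteq> {..<N}" "inj_on f I" "A = f ` I"
    using A(3) by (meson subset_image_inj)
  define t where "t i = (if i \<in> I then s (f i) else 0)" for i
  have "f N = (\<Sum>i\<in>I. s (f i) * f i)" unfolding A(1) I(3) by (simp add: sum.reindex[OF I(2)])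
  also have "\<dots> = (\<Sum>i<N. t i * f i)"
    by (rule sum.mono_neutral_cong_left) (use I(1) in \<open>auto simp: t_def\<close>)
  finally have "f N = (\<Sum>i<N. t i * f i)" .
  moreover have "\<forall>i<N. t i \<in> S" using A(4) I(3) subringD(2)[OF S] by (auto simp: t_def)
  ultimately show ?thesis by (intro exI[of _ N] exI[of _ t]) simp
qed

text \<open>The subring generated by a subring and one element, as the image of a polynomial ring,
  so that the basis theorem applies to it directly.\<close>

definition adjoin :: "'a::comm_ring_1 set \<Rightarrow> 'a \<Rightarrow> 'a set" where
  "adjoin S x = {poly p x | p. \<forall>i. coeff p i \<in> S}"

lemma adjoinI: "(\<And>i. coeff p i \<in> S) \<Longrightarrow> poly p x \<in> adjoin S x"
  unfolding adjoin_def by blast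

lemma adjoin_subring:
  assumes S: "subring S"
  shows "subring (adjoin S x)" "S \<subseteq> adjoin S x" "x \<in> adjoin S x"
proof -
  have "poly [:s:] x \<in> adjoin S x" if "s \<in> S" for s
    by (rule adjoinI) (use that subringD(2)[OF S] in \<open>simp add: coeff_pCons split: nat.split\<close>)
  then show sub: "S \<subseteq> adjoin S x" by auto
  have "poly [:0, 1:] x \<in> adjoin S x"
    by (rule adjoinI) (use subringD(1,2)[OF S] in \<open>simp add: coeff_pCons split: nat.split\<close>)
  then show "x \<in> adjoin S x" by simp
  have "poly p x - poly q x \<in> adjoin S x \<and> poly p x * poly q x \<in> adjoin S x"
    if p: "\<And>i. coeff p i \<in> S" and q: "\<And>i. coeff q i \<in> S" for p q
  proof -
    have "poly (p - q) x \<in> adjoin S x"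
      by (rule adjoinI) (simp add: subringD(5)[OF S] p q)
    moreover have "poly (p * q) x \<in> adjoin S x"
      by (rule adjoinI) (simp add: coeff_mult subring_sum[OF S] subringD(6)[OF S] p q)
    ultimately show ?thesis by simp
  qed
  moreover have "1 \<in> adjoin S x" using sub subringD(1)[OF S] by blast
  ultimately show "subring (adjoin S x)" unfolding subring_def
    by (fastforce simp: adjoin_def)
qed

text \<open>Hilbert's argument: choosing polynomials of least degree outside the ideal generated by
  the previous ones, the leading coefficients would form a sequence without relations.\<close>

theorem noetherian_adjoin:
  assumes N: "noetherian S"
  shows "noetherian (adjoin S x)"
  unfolding noetherian_def
proof (intro conjI allI impI)
  have S: "subring S" using N by (simp add: noetherian_def)
  note [intro] = subringD[OF S]
  show T: "subring (adjoin S x)" using adjoin_subring[OF S] by blast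
  fix J assume J: "ideal_of (adjoin S x) J"
  define P where "P = {p. (\<forall>i. coeff p i \<in> S) \<and> poly p x \<in> J}"
  show "\<exists>B. finite B \<and> B \<subseteq> J \<and> J \<subseteq> ideal_generated (adjoin S x) B"
  proof (rule ccontr)
    assume no: "\<not> ?thesis"
    define ok where "ok g n p \<longleftrightarrow> p \<in> P \<and> poly p x \<notin> ideal_generated (adjoin S x) ((\<lambda>i. poly (g i) x) ` {..<n})"
      for g :: "nat \<Rightarrow> 'a poly" and n :: nat and p
    have ex: "\<exists>p. ok g n p" if "\<And>i. i < n \<Longrightarrow> g i \<in> P" for g n
    proof -
      have "(\<lambda>i. poly (g i) x) ` {..<n} \<subseteq> J" using that by (auto simp: P_def)
      moreover have "finite ((\<lambda>i. poly (g i) x) ` {..<n})" by simp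
      ultimately have "\<not> J \<subseteq> ideal_generated (adjoin S x) ((\<lambda>i. poly (g i) x) ` {..<n})"
        using no by metis
      then obtain a where a: "a \<in> J" "a \<notin> ideal_generated (adjoin S x) ((\<lambda>i. poly (g i) x) ` {..<n})"
        by (auto simp: subset_iff)
      then obtain p where "a = poly p x" "\<forall>i. coeff p i \<in> S"
        using ideal_ofD(1)[OF J] by (auto simp: adjoin_def)
      then have "ok g n p" using a by (simp add: ok_def P_def)
      then show ?thesis by blast
    qed
    define nxt where "nxt g n = arg_min degree (ok g n)" for g n
    have cong: "ok g n = ok g' n" if "\<And>i. i < n \<Longrightarrow> g i = g' i" for g g' n
    proof -
      have "(\<lambda>i. poly (g i) x) ` {..<n} = (\<lambda>i. poly (g' i) x) ` {..<n}"
        using that by (intro image_cong) auto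
      then show ?thesis unfolding ok_def by (intro ext) simp
    qed
    \<comment> \<open>Each choice depends on all previous ones, so the recursion builds the list of choices.\<close>
    define gs where "gs = rec_nat [] (\<lambda>n l. l @ [nxt (\<lambda>i. l ! i) n])"
    have gs_Suc: "gs (Suc n) = gs n @ [nxt (\<lambda>i. gs n ! i) n]" for n by (simp add: gs_def)
    have len: "length (gs n) = n" for n by (induction n) (simp add: gs_def, simp add: gs_Suc)
    define g where "g n = gs (Suc n) ! n" for n
    have gs_g: "gs n ! i = g i" if "i < n" for n i
      using that
    proof (induction n)
      case (Suc n)
      show ?case
      proof (cases "i = n")
        case False
        then show ?thesis using Suc by (simp add: gs_Suc nth_append len)
      qed (simp add: g_def)
    qed simp
    have g_nxt: "g n = nxt g n" for n
    proof -
      have "g n = nxt (\<lambda>i. gs n ! i) n" by (simp add: g_def gs_Suc nth_append len)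
      also have "\<dots> = nxt g n" unfolding nxt_def by (subst cong[of n "\<lambda>i. gs n ! i" g]) (auto simp: gs_g)
      finally show ?thesis .
    qed
    have okg: "ok g n (g n)" and min: "\<And>p. ok g n p \<Longrightarrow> degree (g n) \<le> degree p" for n
    proof -
      have *: "ok g n (g n) \<and> (\<forall>p. ok g n p \<longrightarrow> degree (g n) \<le> degree p)" for n
      proof (induction n rule: less_induct)
        case (less n)
        then have "\<exists>p. ok g n p" using ex by (auto simp: ok_def)
        then show ?case unfolding g_nxt[of n] nxt_def
          by (meson arg_min_nat_lemma)
      qed
      show "ok g n (g n)" "\<And>p. ok g n p \<Longrightarrow> degree (g n) \<le> degree p" using * by auto
    qed
    have gP: "g n \<in> P" for n using okg by (auto simp: ok_def)
    have "lead_coeff (g n) \<in> S" for n using gP by (auto simp: P_def)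
    then obtain n s where s: "\<And>i. i < n \<Longrightarrow> s i \<in> S"
      "lead_coeff (g n) = (\<Sum>i<n. s i * lead_coeff (g i))"
      using noetherian_sequence[OF N, of "\<lambda>n. lead_coeff (g n)"] by blast
    let ?I = "ideal_generated (adjoin S x) ((\<lambda>i. poly (g i) x) ` {..<n})"
    have sub: "(\<lambda>i. poly (g i) x) ` {..<n} \<subseteq> adjoin S x"
      using gP ideal_ofD(1)[OF J] by (auto simp: P_def)
    have I: "ideal_of (adjoin S x) ?I" by (rule ideal_generated_ideal[OF T sub])
    have dle: "degree (g i) \<le> degree (g n)" if "i < n" for i
    proof (rule min)
      have "(\<lambda>j. poly (g j) x) ` {..<i} \<subseteq> (\<lambda>j. poly (g j) x) ` {..<n}" using that by auto
      then show "ok g i (g n)"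
        using okg[of n] ideal_generated_mono unfolding ok_def by blast
    qed
    \<comment> \<open>The combination with the same leading term as \<open>g n\<close>, from the relation between leading coefficients.\<close>
    define q where "q = (\<Sum>i<n. monom (s i) (degree (g n) - degree (g i)) * g i)"
    have qS: "\<forall>k. coeff q k \<in> S"
    proof
      fix k
      have "coeff (monom (s i) j * g i) k \<in> S" if "i < n" for i j
        using s(1)[OF that] gP[of i] by (auto simp: coeff_monom_mult P_def)
      then show "coeff q k \<in> S" unfolding q_def coeff_sum by (intro subring_sum[OF S]) auto
    qed
    have pq: "poly q x = (\<Sum>i<n. (s i * x ^ (degree (g n) - degree (g i))) * poly (g i) x)"
      by (simp add: q_def poly_sum poly_monom)
    have qI: "poly q x \<in> ?I" unfolding pq
    proof (rule ideal_of_sum[OF I])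
      fix i assume i: "i \<in> {..<n}"
      have "s i * x ^ (degree (g n) - degree (g i)) \<in> adjoin S x"
        using adjoin_subring[OF S, of x] s(1) i
        by (intro subringD(6)[OF T] subring_power[OF T]) auto
      moreover have "poly (g i) x \<in> ?I"
        by (rule ideal_generated_incl[OF T]) (use i in auto)
      ultimately show "(s i * x ^ (degree (g n) - degree (g i))) * poly (g i) x \<in> ?I"
        by (rule ideal_ofD(4)[OF I])
    qed
    have qJ: "poly q x \<in> J"
      using qI ideal_generated_in[OF J, of "(\<lambda>i. poly (g i) x) ` {..<n}"] gP by (auto simp: P_def)
    have gq: "g n - q \<in> P"
      using gP[of n] qS qJ ideal_of_diff[OF T J] by (auto simp: P_def)
    have nI: "poly (g n) x \<notin> ?I" using okg by (simp add: ok_def)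
    have "poly (g n - q) x \<notin> ?I"
    proof
      assume "poly (g n - q) x \<in> ?I"
      then have "poly (g n - q) x + poly q x \<in> ?I" using ideal_ofD(3)[OF I _ qI] by blast
      then show False using nI by simp
    qed
    then have ok': "ok g n (g n - q)" using gq by (simp add: ok_def)
    have degq: "degree q \<le> degree (g n)" unfolding q_def
    proof (rule degree_sum_le)
      fix i assume i: "i \<in> {..<n}"
      have "degree (monom (s i) (degree (g n) - degree (g i)) * g i)
          \<le> degree (monom (s i) (degree (g n) - degree (g i))) + degree (g i)" by (rule degree_mult_le)
      also have "\<dots> \<le> (degree (g n) - degree (g i)) + degree (g i)"
        using degree_monom_le add_right_mono by blast
      finally show "degree (monom (s i) (degree (g n) - degree (g i)) * g i) \<le> degree (g n)"
        using dle i by simp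
    qed simp
    have "coeff q (degree (g n)) = (\<Sum>i<n. s i * lead_coeff (g i))"
      unfolding q_def coeff_sum
      by (rule sum.cong) (use dle in \<open>auto simp: coeff_monom_mult\<close>)
    then have c0: "coeff (g n - q) (degree (g n)) = 0" using s(2) by simp
    have dn: "degree (g n - q) \<le> degree (g n)" using degq by (simp add: degree_diff_le)
    have ge: "degree (g n) \<le> degree (g n - q)" by (rule min[OF ok'])
    then have "degree (g n - q) = degree (g n)" using dn by simp
    then have "lead_coeff (g n - q) = 0" using c0 by metis
    then have "g n - q = 0" by (simp only: leading_coeff_0_iff)
    then have "poly (g n) x = poly q x" by simp
    then show False using qI nI by simp
  qed
qed

lemma noetherian_adjoin_list:
  assumes "noetherian S"
  shows "noetherian (fold (\<lambda>x T. adjoin T x) xs S) \<and> S \<subseteq> fold (\<lambda>x T. adjoin T x) xs S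
    \<and> set xs \<subseteq> fold (\<lambda>x T. adjoin T x) xs S"
  using assms
proof (induction xs arbitrary: S)
  case (Cons x xs)
  have S: "subring S" using Cons.prems by (simp add: noetherian_def)
  show ?case using Cons.IH[OF noetherian_adjoin[OF Cons.prems, of x]] adjoin_subring[OF S, of x] by auto
qed simp

text \<open>For the Rees ring: the powers of \<open>T\<close> carry coefficients vanishing at the
  point, since this holds for the generators.\<close>

lemma fold_adjoin_invariant:
  assumes "S \<subseteq> {a. Q a}" "\<And>x. x \<in> set xs \<Longrightarrow> Q x" "Q 0"
    "\<And>a b. Q a \<Longrightarrow> Q b \<Longrightarrow> Q (a + b)" "\<And>a b. Q a \<Longrightarrow> Q b \<Longrightarrow> Q (a * b)"
  shows "fold (\<lambda>x T. adjoin T x) xs S \<subseteq> {a. Q a}"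
  using assms(1,2)
proof (induction xs arbitrary: S)
  case (Cons x xs)
  have "Q (poly p x)" if "\<forall>i. coeff p i \<in> S" for p
    using that
  proof (induction p)
    case (pCons c p)
    have "Q c" using pCons(3) Cons.prems(1) by (metis coeff_pCons_0 mem_Collect_eq subsetD)
    moreover have "\<forall>i. coeff p i \<in> S" using pCons(3) by (metis coeff_pCons_Suc)
    ultimately show ?case using pCons(2) Cons.prems(2) assms(4,5) by simp
  qed (use assms(3) in simp)
  then have "adjoin S x \<subseteq> {a. Q a}" by (auto simp: adjoin_def)
  then show ?case using Cons by simp
qed simp

lemma noetherian_field:
  assumes S: "subring S" and inv: "\<And>a. a \<in> S \<Longrightarrow> a \<noteq> 0 \<Longrightarrow> \<exists>b\<in>S. b * a = 1"
  shows "noetherian S"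
  unfolding noetherian_def
proof (intro conjI allI impI)
  fix J assume J: "ideal_of S J"
  show "\<exists>B. finite B \<and> B \<subseteq> J \<and> J \<subseteq> ideal_generated S B"
  proof (cases "J \<subseteq> {0}")
    case True
    then show ?thesis using ideal_generated_ideal[OF S, of "{}"] ideal_ofD(2)
      by (intro exI[of _ "{}"]) auto
  next
    case False
    then obtain a where a: "a \<in> J" "a \<noteq> 0" by auto
    then obtain b where b: "b \<in> S" "b * a = 1" using inv ideal_ofD(1)[OF J] by blast
    have aS: "{a} \<subseteq> S" using a ideal_ofD(1)[OF J] by auto
    have I: "ideal_of S (ideal_generated S {a})" by (rule ideal_generated_ideal[OF S aS])
    have "1 \<in> ideal_generated S {a}"
      using ideal_ofD(4)[OF I b(1) ideal_generated_incl[OF S, of a "{a}"]] b(2) by simp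
    then have "c \<in> ideal_generated S {a}" if "c \<in> J" for c
      using ideal_ofD(4)[OF I ideal_ofD(1)[OF J that]] by fastforce
    then show ?thesis using a by (intro exI[of _ "{a}"]) auto
  qed
qed (rule S)

subsection \<open>Powers of the maximal ideal of a point\<close>

lemma polys_subring: "subring (polys V)"
  by (simp add: subring_def polys_diff polys_mult)

lemma peval_cong_polys:
  assumes "p \<in> polys V" "\<And>v. v \<in> V \<Longrightarrow> x v = y v"
  shows "peval x p = peval y p"
  using assms(1) by (induction rule: polys_induct) (simp_all add: peval_simps assms(2))

text \<open>The local study of the affine space of coordinates \<open>V\<close> at the point
  \<open>e\<close>.\<close>

locale point =
  fixes V :: "'v set" and e :: "'v \<Rightarrow> complex"
  assumes finV: "finite V"
begin

definition xc :: "'v \<Rightarrow> ('v, complex) mpoly" where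
  "xc v = Var v - Const (e v)"

lemma peval_xc [simp]: "peval y (xc v) = y v - e v"
  by (simp add: xc_def peval_simps)

lemma xc_polys [simp]: "v \<in> V \<Longrightarrow> xc v \<in> polys V"
  by (simp add: xc_def polys_diff)

text \<open>Powers of the maximal ideal of the point. Unfolding one power at a time gives a
  recursion that all later estimates follow.\<close>

primrec mpow :: "nat \<Rightarrow> ('v, complex) mpoly set" where
  "mpow 0 = polys V"
| "mpow (Suc k) = {\<Sum>v\<in>V. xc v * r v | r. \<forall>v\<in>V. r v \<in> mpow k}"

lemma mpow_SucI: "(\<And>v. v \<in> V \<Longrightarrow> r v \<in> mpow k) \<Longrightarrow> (\<Sum>v\<in>V. xc v * r v) \<in> mpow (Suc k)"
  by auto

lemma mpow_SucE:
  assumes "p \<in> mpow (Suc k)"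
  obtains r where "p = (\<Sum>v\<in>V. xc v * r v)" "\<And>v. v \<in> V \<Longrightarrow> r v \<in> mpow k"
  using assms by auto

lemma mpow_polys: "p \<in> mpow k \<Longrightarrow> p \<in> polys V"
proof (induction k arbitrary: p)
  case (Suc k)
  then show ?case by (elim mpow_SucE) (auto intro!: polys_sum polys_mult)
qed simp

lemma mpow_add: "p \<in> mpow k \<Longrightarrow> q \<in> mpow k \<Longrightarrow> p + q \<in> mpow k"
proof (induction k arbitrary: p q)
  case (Suc k)
  from Suc.prems obtain r s where r: "p = (\<Sum>v\<in>V. xc v * r v)" "\<And>v. v \<in> V \<Longrightarrow> r v \<in> mpow k"
    and s: "q = (\<Sum>v\<in>V. xc v * s v)" "\<And>v. v \<in> V \<Longrightarrow> s v \<in> mpow k"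
    by (elim mpow_SucE) blast
  have "p + q = (\<Sum>v\<in>V. xc v * (r v + s v))" by (simp add: r s algebra_simps sum.distrib)
  then show ?case using mpow_SucI[of "\<lambda>v. r v + s v" k] Suc.IH r s by simp
qed (simp add: polys_add)

lemma mpow_0: "0 \<in> mpow k"
proof (induction k)
  case (Suc k)
  then show ?case using mpow_SucI[of "\<lambda>_. 0" k] by simp
qed simp

lemma mpow_sum: "(\<And>i. i \<in> A \<Longrightarrow> f i \<in> mpow k) \<Longrightarrow> sum f A \<in> mpow k"
  by (induction A rule: infinite_finite_induct) (simp_all add: mpow_0 mpow_add)

lemma mpow_mult: "p \<in> mpow j \<Longrightarrow> q \<in> mpow k \<Longrightarrow> p * q \<in> mpow (j + k)"
proof (induction j arbitrary: p)
  case 0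
  then have "p \<in> polys V" by simp
  with 0(2) show ?case
  proof (induction k arbitrary: q)
    case (Suc k)
    from Suc.prems(1) obtain r where r: "q = (\<Sum>v\<in>V. xc v * r v)" "\<And>v. v \<in> V \<Longrightarrow> r v \<in> mpow k"
      by (elim mpow_SucE) blast
    have "p * q = (\<Sum>v\<in>V. xc v * (p * r v))" by (simp add: r sum_distrib_left mult.left_commute)
    then show ?case using mpow_SucI[of "\<lambda>v. p * r v" k] Suc r by simp
  qed (simp add: polys_mult)
next
  case (Suc j)
  from Suc.prems(1) obtain r where r: "p = (\<Sum>v\<in>V. xc v * r v)" "\<And>v. v \<in> V \<Longrightarrow> r v \<in> mpow j"
    by (elim mpow_SucE) blast
  have "p * q = (\<Sum>v\<in>V. xc v * (r v * q))" by (simp add: r sum_distrib_right mult.assoc)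
  then show ?case using mpow_SucI[of "\<lambda>v. r v * q" "j + k"] Suc r by simp
qed

lemma mpow_mult_polys: "p \<in> polys V \<Longrightarrow> q \<in> mpow k \<Longrightarrow> p * q \<in> mpow k"
  using mpow_mult[of p 0 q k] by simp

lemma xc_mpow: "v \<in> V \<Longrightarrow> xc v \<in> mpow 1"
proof -
  assume v: "v \<in> V"
  have "xc v = (\<Sum>u\<in>V. xc u * (if u = v then 1 else 0))"
    using v finV by (simp add: if_distrib[of "\<lambda>y. _ * y"] cong: if_cong)
  then show ?thesis using mpow_SucI[of "\<lambda>u. if u = v then 1 else 0" 0] by simp
qed

lemma sub_value_mpow:
  assumes "p \<in> polys V"
  shows "p - Const (peval e p) \<in> mpow 1"
proof -
  have "p \<in> polys V \<and> p - Const (peval e p) \<in> mpow 1"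
    using assms
  proof (induction rule: polys_induct)
    case (mult p q)
    have "p * q - Const (peval e (p * q)) = p * (q - Const (peval e q)) + Const (peval e q) * (p - Const (peval e p))"
      by (simp add: peval_simps Const_mult algebra_simps)
    then show ?case using mult mpow_add[OF mpow_mult_polys[of p "q - Const (peval e q)" 1]
        mpow_mult_polys[OF polys_Const, of "p - Const (peval e p)" 1 "peval e q"]]
      by (simp only: polys_mult simp_thms)
  next
    case (add p q)
    have "p + q - Const (peval e (p + q)) = (p - Const (peval e p)) + (q - Const (peval e q))"
      by (simp add: peval_simps Const_add)
    then show ?case using add mpow_add[of "p - Const (peval e p)" 1 "q - Const (peval e q)"]
      by (simp only: polys_add simp_thms)
  next
    case (Var v)
    then show ?case using xc_mpow[of v] by (simp add: peval_simps xc_def del: mpow.simps)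
  qed (simp add: peval_simps mpow_0 del: mpow.simps)
  then show ?thesis by blast
qed

subsection \<open>Krull's intersection theorem at a point\<close>

definition rees_gens :: "('v, complex) mpoly poly list" where
  "rees_gens = map (\<lambda>v. [:Var v:]) (SOME l. set l = V) @ map (\<lambda>v. [:0, xc v:]) (SOME l. set l = V)"

text \<open>The Rees ring of the maximal ideal of the point: an element is a polynomial in an
  auxiliary variable \<open>T\<close> whose coefficient at \<open>T\<^sup>k\<close> lies in the
  \<open>k\<close>-th power of the ideal.\<close>

definition rees :: "('v, complex) mpoly poly set" where
  "rees = fold (\<lambda>x T. adjoin T x) rees_gens {[:Const c:] | c. True}"

lemma set_rees_gens: "set rees_gens = (\<lambda>v. [:Var v:]) ` V \<union> (\<lambda>v. [:0, xc v:]) ` V"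
proof -
  have "set (SOME l. set l = V) = V" using finite_list[OF finV] by (rule someI_ex)
  then show ?thesis by (simp add: rees_gens_def)
qed

lemma noetherian_constants: "noetherian {[:Const c:] | c :: complex. True}"
proof (rule noetherian_field)
  have "(1 :: ('a, complex) mpoly poly) = [:Const 1:]" by (simp add: one_pCons)
  moreover have "[:Const a:] - [:Const b:] = [:Const (a - b):]"
    "[:Const a:] * [:Const b:] = [:Const (a * b):]" for a b :: complex
    by (simp_all add: Const_diff Const_mult)
  ultimately show "subring {[:Const c:] :: ('a, complex) mpoly poly | c. True}"
    unfolding subring_def by blast
next
  fix a :: "('a, complex) mpoly poly"
  assume "a \<in> {[:Const c:] | c. True}" "a \<noteq> 0"
  then obtain c where c: "a = [:Const c:]" by auto
  with \<open>a \<noteq> 0\<close> have "c \<noteq> 0" by auto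
  have "[:Const (inverse c):] * a = 1" using c \<open>c \<noteq> 0\<close> by (simp add: one_pCons Const_mult[symmetric])
  then show "\<exists>b\<in>{[:Const c:] | c. True}. b * a = 1" by blast
qed

lemma noetherian_rees: "noetherian rees"
  and const_rees: "[:Const c:] \<in> rees"
  and gens_rees: "v \<in> V \<Longrightarrow> [:Var v:] \<in> rees" "v \<in> V \<Longrightarrow> [:0, xc v:] \<in> rees"
  using noetherian_adjoin_list[OF noetherian_constants, of rees_gens]
  unfolding rees_def set_rees_gens by blast+

lemma subring_rees: "subring rees"
  using noetherian_rees by (simp add: noetherian_def)

lemma polys_rees: "p \<in> polys V \<Longrightarrow> [:p:] \<in> rees"
proof (induction rule: polys_induct)
  case (add p q)
  then show ?case using subringD(4)[OF subring_rees add] by simp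
next
  case (mult p q)
  then show ?case using subringD(6)[OF subring_rees mult] by (simp add: mult.commute)
qed (simp_all add: const_rees gens_rees)

lemma mpow_rees: "p \<in> mpow k \<Longrightarrow> monom p k \<in> rees"
proof (induction k arbitrary: p)
  case (Suc k)
  from Suc.prems obtain r where r: "p = (\<Sum>v\<in>V. xc v * r v)" "\<And>v. v \<in> V \<Longrightarrow> r v \<in> mpow k"
    by (elim mpow_SucE) blast
  have "monom p (Suc k) = (\<Sum>v\<in>V. [:0, xc v:] * monom (r v) k)"
  proof (rule poly_eqI)
    fix n show "coeff (monom p (Suc k)) n = coeff (\<Sum>v\<in>V. [:0, xc v:] * monom (r v) k) n"
      by (cases n) (auto simp: r coeff_sum)
  qed
  also have "\<dots> \<in> rees"
    by (rule subring_sum[OF subring_rees], rule subringD(6)[OF subring_rees])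
       (use gens_rees Suc.IH r in auto)
  finally show ?case .
qed (simp add: monom_0 polys_rees)

lemma rees_coeff:
  assumes "p \<in> rees"
  shows "coeff p i \<in> polys V" "i > 0 \<Longrightarrow> peval e (coeff p i) = 0"
proof -
  define Q where "Q p \<longleftrightarrow> (\<forall>i. coeff p i \<in> polys V \<and> (i > 0 \<longrightarrow> peval e (coeff p i) = 0))"
    for p :: "('v, complex) mpoly poly"
  have "rees \<subseteq> {p. Q p}"
    unfolding rees_def
  proof (rule fold_adjoin_invariant)
    show "{[:Const c:] | c. True} \<subseteq> {p. Q p}"
      by (auto simp: Q_def coeff_pCons peval_simps split: nat.split)
  next
    fix p assume "p \<in> set rees_gens"
    then show "Q p" unfolding set_rees_gens
      by (auto simp: Q_def coeff_pCons peval_simps split: nat.split)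
  next
    fix p q assume pq: "Q p" "Q q"
    then show "Q (p + q)" by (simp add: Q_def peval_simps polys_add)
    show "Q (p * q)" unfolding Q_def coeff_mult peval_simps
    proof (intro allI conjI impI)
      fix i show "(\<Sum>j\<le>i. coeff p j * coeff q (i - j)) \<in> polys V"
        using pq by (intro polys_sum polys_mult) (simp_all add: Q_def)
    next
      fix i :: nat assume "i > 0"
      then have "peval e (coeff p j) * peval e (coeff q (i - j)) = 0" if "j \<le> i" for j
        using pq that by (cases "j = 0") (simp_all add: Q_def)
      then show "(\<Sum>j\<le>i. peval e (coeff p j) * peval e (coeff q (i - j))) = 0" by (intro sum.neutral) auto
    qed
  qed (simp add: Q_def peval_simps)
  then show "coeff p i \<in> polys V" "i > 0 \<Longrightarrow> peval e (coeff p i) = 0"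
    using assms by (auto simp: Q_def)
qed

text \<open>Write \<open>f\<close> modulo \<open>I\<close> as \<open>p\<^sub>k\<close> in the
  \<open>k\<close>-th power of the maximal ideal. By the chain condition in the Rees ring some
  \<open>p\<^sub>n T\<^sup>n\<close> is a combination of the earlier ones; comparing coefficients of
  \<open>T\<^sup>n\<close> gives \<open>p\<^sub>n = \<Sum> c\<^sub>i p\<^sub>i\<close> with
  \<open>c\<^sub>i\<close> vanishing at the point, so that \<open>(1 - \<Sum> c\<^sub>i) f \<in>
  I\<close>.\<close>

theorem krull_intersection:
  assumes I: "ideal_of (polys V) I" and f: "f \<in> polys V"
    and near: "\<And>k. \<exists>p\<in>mpow k. f - p \<in> I"
  shows "\<exists>h\<in>polys V. peval e h \<noteq> 0 \<and> h * f \<in> I"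
proof -
  obtain p where p: "\<And>k. p k \<in> mpow k" "\<And>k. f - p k \<in> I" using near by metis
  obtain n s where s: "\<And>i. i < n \<Longrightarrow> s i \<in> rees"
    "monom (p n) n = (\<Sum>i<n. s i * monom (p i) i)"
    using noetherian_sequence[OF noetherian_rees, of "\<lambda>k. monom (p k) k"] mpow_rees[OF p(1)] by blast
  define c where "c i = coeff (s i) (n - i)" for i
  have c: "c i \<in> polys V" "peval e (c i) = 0" if "i < n" for i
    using rees_coeff[OF s(1)[OF that]] that by (simp_all add: c_def)
  have "p n = coeff (\<Sum>i<n. monom (p i) i * s i) n"
    using s(2) by (metis (no_types, lifting) coeff_monom mult.commute sum.cong)
  also have "\<dots> = (\<Sum>i<n. p i * c i)"
    unfolding coeff_sum by (rule sum.cong) (simp_all add: coeff_monom_mult c_def)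
  finally have pn: "p n = (\<Sum>i<n. c i * p i)" by (simp add: mult.commute)
  define h where "h = 1 - (\<Sum>i<n. c i)"
  have "h * f = (f - p n) - (\<Sum>i<n. c i * (f - p i))"
    by (simp add: h_def algebra_simps sum_subtractf sum_distrib_left flip: pn)
  also have "\<dots> \<in> I"
    by (rule ideal_of_diff[OF polys_subring I p(2)], rule ideal_of_sum[OF I], rule ideal_ofD(4)[OF I])
       (use c p in auto)
  finally have "h * f \<in> I" .
  moreover have "h \<in> polys V" using c by (auto simp: h_def intro!: polys_diff polys_sum)
  moreover have "peval e h \<noteq> 0" using c by (simp add: h_def peval_simps)
  ultimately show ?thesis by blast
qed

section \<open>The tangent space criterion\<close>

subsection \<open>Leading forms\<close>

text \<open>Homogeneous polynomials of degree \<open>k\<close> in the centred coordinates.\<close>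

primrec lead_forms :: "nat \<Rightarrow> ('v, complex) mpoly set" where
  "lead_forms 0 = range Const"
| "lead_forms (Suc k) = {\<Sum>v\<in>V. xc v * r v | r. \<forall>v\<in>V. r v \<in> lead_forms k}"

lemma lead_forms_SucE:
  assumes "p \<in> lead_forms (Suc k)"
  obtains r where "p = (\<Sum>v\<in>V. xc v * r v)" "\<And>v. v \<in> V \<Longrightarrow> r v \<in> lead_forms k"
  using assms by auto

lemma lead_forms_mpow: "p \<in> lead_forms k \<Longrightarrow> p \<in> mpow k"
proof (induction k arbitrary: p)
  case (Suc k)
  from Suc.prems show ?case by (elim lead_forms_SucE) (use Suc.IH in auto)
qed auto

lemma leading_form:
  assumes "p \<in> mpow k"
  shows "\<exists>q\<in>lead_forms k. p - q \<in> mpow (Suc k)"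
  using assms
proof (induction k arbitrary: p)
  case 0
  then show ?case using sub_value_mpow[of p] by auto
next
  case (Suc k)
  from Suc.prems obtain r where r: "p = (\<Sum>v\<in>V. xc v * r v)" "\<And>v. v \<in> V \<Longrightarrow> r v \<in> mpow k"
    by (elim mpow_SucE) blast
  obtain s where s: "\<And>v. v \<in> V \<Longrightarrow> s v \<in> lead_forms k" "\<And>v. v \<in> V \<Longrightarrow> r v - s v \<in> mpow (Suc k)"
    using Suc.IH[OF r(2)] by metis
  have "p - (\<Sum>v\<in>V. xc v * s v) = (\<Sum>v\<in>V. xc v * (r v - s v))"
    by (simp add: r algebra_simps sum_subtractf)
  moreover have "\<dots> \<in> mpow (Suc (Suc k))" by (rule mpow_SucI) (rule s(2))
  moreover have "(\<Sum>v\<in>V. xc v * s v) \<in> lead_forms (Suc k)" using s(1) by auto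
  ultimately show ?case by (intro bexI[of _ "\<Sum>v\<in>V. xc v * s v"]) (simp_all del: mpow.simps)
qed

text \<open>Only values and derivatives at parameter \<open>0\<close> are prescribed, as the curves
  are used for limits at the point.\<close>

definition curve_to :: "(complex \<Rightarrow> 'v \<Rightarrow> complex) \<Rightarrow> ('v \<Rightarrow> complex) \<Rightarrow> bool" where
  "curve_to \<gamma> w \<longleftrightarrow> (\<forall>v\<in>V. \<gamma> 0 v = e v \<and> ((\<lambda>t. \<gamma> t v) has_field_derivative w v) (at 0))"

lemma curve_tendsto:
  assumes "curve_to \<gamma> w" "p \<in> polys V"
  shows "((\<lambda>t. peval (\<gamma> t) p) \<longlongrightarrow> peval e p) (at 0)"
  using assms(2)
proof (induction rule: polys_induct)
  case (Var v)
  then have "isCont (\<lambda>t. \<gamma> t v) 0" "\<gamma> 0 v = e v"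
    using assms(1) DERIV_isCont unfolding curve_to_def by blast+
  then show ?case by (simp add: peval_simps isCont_def)
qed (simp_all add: peval_simps tendsto_intros)

lemma curve_xc:
  assumes "curve_to \<gamma> w" "v \<in> V"
  shows "((\<lambda>t. peval (\<gamma> t) (xc v) / t) \<longlongrightarrow> w v) (at 0)"
  using assms by (auto simp: curve_to_def DERIV_def)

lemma mpow_growth:
  assumes g: "curve_to \<gamma> w" and "p \<in> mpow k"
  shows "\<exists>l. ((\<lambda>t. peval (\<gamma> t) p / t ^ k) \<longlongrightarrow> l) (at 0)"
  using assms(2)
proof (induction k arbitrary: p)
  case 0
  then show ?case using curve_tendsto[OF g] by auto
next
  case (Suc k)
  from Suc.prems obtain r where r: "p = (\<Sum>v\<in>V. xc v * r v)" "\<And>v. v \<in> V \<Longrightarrow> r v \<in> mpow k"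
    by (elim mpow_SucE) blast
  define l where "l v = (SOME l. ((\<lambda>t. peval (\<gamma> t) (r v) / t ^ k) \<longlongrightarrow> l) (at 0))" for v
  have l: "((\<lambda>t. peval (\<gamma> t) (r v) / t ^ k) \<longlongrightarrow> l v) (at 0)" if "v \<in> V" for v
    unfolding l_def using Suc.IH[OF r(2)[OF that]] by (rule someI_ex)
  have "((\<lambda>t. \<Sum>v\<in>V. (peval (\<gamma> t) (xc v) / t) * (peval (\<gamma> t) (r v) / t ^ k)) \<longlongrightarrow> (\<Sum>v\<in>V. w v * l v)) (at 0)"
    by (intro tendsto_sum tendsto_mult curve_xc[OF g] l)
  moreover have "(\<lambda>t. \<Sum>v\<in>V. (peval (\<gamma> t) (xc v) / t) * (peval (\<gamma> t) (r v) / t ^ k))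
      = (\<lambda>t. peval (\<gamma> t) p / t ^ Suc k)"
    by (simp only: r peval_simps times_divide_times_eq power_Suc sum_divide_distrib)
  ultimately show ?case by auto
qed

lemma lead_forms_growth:
  assumes g: "curve_to \<gamma> w" and "p \<in> lead_forms k"
  shows "((\<lambda>t. peval (\<gamma> t) p / t ^ k) \<longlongrightarrow> peval (\<lambda>v. e v + w v) p) (at 0)"
  using assms(2)
proof (induction k arbitrary: p)
  case 0
  then show ?case by (auto simp: peval_simps)
next
  case (Suc k)
  from Suc.prems obtain r where r: "p = (\<Sum>v\<in>V. xc v * r v)" "\<And>v. v \<in> V \<Longrightarrow> r v \<in> lead_forms k"
    by (elim lead_forms_SucE) blast
  have "((\<lambda>t. \<Sum>v\<in>V. (peval (\<gamma> t) (xc v) / t) * (peval (\<gamma> t) (r v) / t ^ k))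
      \<longlongrightarrow> (\<Sum>v\<in>V. w v * peval (\<lambda>v. e v + w v) (r v))) (at 0)"
    by (intro tendsto_sum tendsto_mult curve_xc[OF g] Suc.IH r)
  moreover have "(\<lambda>t. \<Sum>v\<in>V. (peval (\<gamma> t) (xc v) / t) * (peval (\<gamma> t) (r v) / t ^ k))
      = (\<lambda>t. peval (\<gamma> t) p / t ^ Suc k)"
    by (simp only: r peval_simps times_divide_times_eq power_Suc sum_divide_distrib)
  moreover have "(\<Sum>v\<in>V. w v * peval (\<lambda>v. e v + w v) (r v)) = peval (\<lambda>v. e v + w v) p"
    by (simp add: r peval_simps)
  ultimately show ?case by simp
qed

text \<open>Divide the values along the curve by \<open>t\<^sup>k\<close> and let \<open>t\<close>
  tend to \<open>0\<close>: only the leading form at the velocity survives.\<close>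

lemma leading_form_vanishes:
  assumes g: "curve_to \<gamma> w" and p: "p \<in> mpow k" and q: "q \<in> lead_forms k" "p - q \<in> mpow (Suc k)"
    and z: "\<forall>\<^sub>F t in at 0. peval (\<gamma> t) p = 0"
  shows "peval (\<lambda>v. e v + w v) q = 0"
proof -
  obtain l where l: "((\<lambda>t. peval (\<gamma> t) (p - q) / t ^ Suc k) \<longlongrightarrow> l) (at 0)"
    using mpow_growth[OF g q(2)] by blast
  have "((\<lambda>t. t * (peval (\<gamma> t) (p - q) / t ^ Suc k)) \<longlongrightarrow> 0 * l) (at 0)"
    by (intro tendsto_mult l) (rule tendsto_ident_at)
  moreover have "\<forall>\<^sub>F t in at 0. t * (peval (\<gamma> t) (p - q) / t ^ Suc k) = - (peval (\<gamma> t) q / t ^ k)"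
    using z eventually_neq_at_within[of 0 0 UNIV]
    by eventually_elim (simp add: peval_simps)
  ultimately have 1: "((\<lambda>t. - (peval (\<gamma> t) q / t ^ k)) \<longlongrightarrow> 0) (at 0)"
    using tendsto_cong by fastforce
  have 2: "((\<lambda>t. - (peval (\<gamma> t) q / t ^ k)) \<longlongrightarrow> - peval (\<lambda>v. e v + w v) q) (at 0)"
    by (intro tendsto_minus lead_forms_growth[OF g q(1)])
  show ?thesis using LIM_unique[OF 1 2] by simp
qed

end

subsection \<open>A projection onto the annihilator of a space of functionals\<close>

text \<open>Gaussian elimination: if some functional in \<open>L\<close> involves the new variable,
  it expresses this variable by the others on the annihilator; otherwise the variable is free. The
  matrix \<open>P\<close> projects onto the annihilator of \<open>L\<close>, and the rows of
  \<open>1 - P\<close> lie in \<open>L\<close>.\<close>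

lemma annihilator_projection:
  fixes L :: "('v \<Rightarrow> complex) set"
  assumes "finite W" and z: "(\<lambda>_. 0) \<in> L" and a: "\<And>l m. l \<in> L \<Longrightarrow> m \<in> L \<Longrightarrow> (\<lambda>v. l v + m v) \<in> L"
    and s: "\<And>c l. l \<in> L \<Longrightarrow> (\<lambda>v. c * l v) \<in> L"
  shows "\<exists>P. (\<forall>v\<in>W. (\<lambda>u. if u \<in> W then (if u = v then 1 else 0) - P v u else 0) \<in> L) \<and>
     (\<forall>w. \<forall>l\<in>L. (\<forall>v. v \<notin> W \<longrightarrow> l v = 0) \<longrightarrow> (\<Sum>v\<in>W. l v * (\<Sum>u\<in>W. P v u * w u)) = 0)"
  using assms(1)
proof (induction W)
  case (insert z0 W)
  then obtain P where P: "(\<forall>v\<in>W. (\<lambda>u. if u \<in> W then (if u = v then 1 else 0) - P v u else 0) \<in> L) \<and>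
     (\<forall>w. \<forall>l\<in>L. (\<forall>v. v \<notin> W \<longrightarrow> l v = 0) \<longrightarrow> (\<Sum>v\<in>W. l v * (\<Sum>u\<in>W. P v u * w u)) = 0)"
    by blast
  have P1: "\<And>v. v \<in> W \<Longrightarrow> (\<lambda>u. if u \<in> W then (if u = v then 1 else 0) - P v u else 0) \<in> L"
    and P2: "\<And>w l. l \<in> L \<Longrightarrow> (\<forall>v. v \<notin> W \<longrightarrow> l v = 0) \<Longrightarrow> (\<Sum>v\<in>W. l v * (\<Sum>u\<in>W. P v u * w u)) = 0"
    using P by blast+
  have sm: "(\<lambda>u. \<Sum>v\<in>A. f v u) \<in> L" if "\<And>v. v \<in> A \<Longrightarrow> f v \<in> L" "finite A" for A and f :: "'v \<Rightarrow> 'v \<Rightarrow> complex"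
    using that(2,1) by (induction A) (simp_all add: z a)
  let ?W = "insert z0 W"
  have nz: "v \<noteq> z0" if "v \<in> W" for v using that insert.hyps by auto
  show ?case
  proof (cases "\<exists>l\<in>L. (\<forall>v. v \<notin> ?W \<longrightarrow> l v = 0) \<and> l z0 \<noteq> 0")
    case True
    then obtain l1 where l1: "l1 \<in> L" "\<forall>v. v \<notin> ?W \<longrightarrow> l1 v = 0" "l1 z0 \<noteq> 0" by blast
    define l0 where "l0 v = inverse (l1 z0) * l1 v" for v
    have "l0 = (\<lambda>v. inverse (l1 z0) * l1 v)" by (simp add: l0_def fun_eq_iff)
    then have l0: "l0 \<in> L" "\<And>v. v \<notin> ?W \<Longrightarrow> l0 v = 0" "l0 z0 = 1"
      using l1 s[OF l1(1), of "inverse (l1 z0)"] by simp_all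
    \<comment> \<open>The functional \<open>l0\<close> solves for the coordinate \<open>z0\<close>.\<close>
    define R where "R v u = (if u = z0 then 0 else if v = z0 then - (\<Sum>y\<in>W. l0 y * P y u) else P v u)" for v u
    have row: "(\<lambda>u. if u \<in> ?W then (if u = v then 1 else 0) - R v u else 0) \<in> L" if v: "v \<in> ?W" for v
    proof (cases "v = z0")
      case False
      then have "(\<lambda>u. if u \<in> ?W then (if u = v then 1 else 0) - R v u else 0)
          = (\<lambda>u. if u \<in> W then (if u = v then 1 else 0) - P v u else 0)"
        using insert.hyps by (auto simp: R_def fun_eq_iff)
      then show ?thesis using P1[of v] False v by simp
    next
      case True
      let ?g = "\<lambda>u. l0 u + (-1) * (\<Sum>y\<in>W. l0 y * (if u \<in> W then (if u = y then 1 else 0) - P y u else 0))"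
      have "?g \<in> L"
        by (intro a l0 s sm P1 insert.hyps)
      moreover have "?g = (\<lambda>u. if u \<in> ?W then (if u = v then 1 else 0) - R v u else 0)"
      proof
        fix u
        show "?g u = (if u \<in> ?W then (if u = v then 1 else 0) - R v u else 0)"
        proof (cases "u \<in> W")
          case uW: True
          have "(\<Sum>y\<in>W. l0 y * ((if u = y then 1 else 0) - P y u)) = l0 u - (\<Sum>y\<in>W. l0 y * P y u)"
            using uW insert.hyps(1)
            by (simp add: right_diff_distrib sum_subtractf if_distrib[of "\<lambda>x. _ * x"] cong: if_cong)
          then show ?thesis using uW nz[OF uW] True by (simp add: R_def)
        next
          case False
          then show ?thesis using l0 True by (auto simp: R_def)
        qed
      qed
      ultimately show ?thesis by simp
    qed
    moreover have "(\<Sum>v\<in>?W. l v * (\<Sum>u\<in>?W. R v u * w u)) = 0"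
      if l: "l \<in> L" "\<forall>v. v \<notin> ?W \<longrightarrow> l v = 0" for w l
    proof -
      have 1: "(\<Sum>u\<in>?W. R v u * w u) = (\<Sum>u\<in>W. P v u * w u)" if "v \<in> W" for v
        using insert.hyps nz that by (simp add: R_def cong: sum.cong)
      have "(\<Sum>u\<in>?W. R z0 u * w u) = (\<Sum>u\<in>W. - (\<Sum>y\<in>W. l0 y * P y u) * w u)"
        using insert.hyps nz by (simp add: R_def cong: sum.cong)
      also have "\<dots> = - (\<Sum>y\<in>W. l0 y * (\<Sum>u\<in>W. P y u * w u))"
        by (simp add: sum_distrib_left sum_distrib_right sum_negf algebra_simps) (rule sum.swap)
      finally have 2: "(\<Sum>u\<in>?W. R z0 u * w u) = - (\<Sum>y\<in>W. l0 y * (\<Sum>u\<in>W. P y u * w u))" .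
      have m: "(\<lambda>v. l v + (- l z0) * l0 v) \<in> L" by (intro a l s l0)
      have "(\<Sum>v\<in>W. (l v + (- l z0) * l0 v) * (\<Sum>u\<in>W. P v u * w u)) = 0"
      proof (rule P2[OF m], intro allI impI)
        fix v assume "v \<notin> W"
        then show "l v + (- l z0) * l0 v = 0" using l l0 by (cases "v = z0") simp_all
      qed
      then have "(\<Sum>v\<in>W. l v * (\<Sum>u\<in>W. P v u * w u)) = l z0 * (\<Sum>y\<in>W. l0 y * (\<Sum>u\<in>W. P y u * w u))"
        by (simp add: algebra_simps sum_subtractf sum_distrib_left sum.distrib)
      moreover have "(\<Sum>v\<in>?W. l v * (\<Sum>u\<in>?W. R v u * w u))
          = l z0 * (\<Sum>u\<in>?W. R z0 u * w u) + (\<Sum>v\<in>W. l v * (\<Sum>u\<in>?W. R v u * w u))"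
        by (rule sum.insert) (use insert.hyps in auto)
      ultimately show ?thesis unfolding 2 by (simp add: 1 cong: sum.cong)
    qed
    ultimately show ?thesis by (intro exI[of _ R]) blast
  next
    case False
    \<comment> \<open>No functional restricts the coordinate \<open>z0\<close>.\<close>
    define R where "R v u = (if v = z0 \<or> u = z0 then (if u = v then 1 else 0) else P v u)" for v u
    have row: "(\<lambda>u. if u \<in> ?W then (if u = v then 1 else 0) - R v u else 0) \<in> L" if v: "v \<in> ?W" for v
    proof (cases "v = z0")
      case False
      then have "(\<lambda>u. if u \<in> ?W then (if u = v then 1 else 0) - R v u else 0)
          = (\<lambda>u. if u \<in> W then (if u = v then 1 else 0) - P v u else 0)"
        using insert.hyps by (auto simp: R_def fun_eq_iff)
      then show ?thesis using P1[of v] False v by simp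
    next
      case True
      then have "(\<lambda>u. if u \<in> ?W then (if u = v then 1 else 0) - R v u else 0) = (\<lambda>_. 0)"
        by (auto simp: R_def fun_eq_iff)
      then show ?thesis using z by simp
    qed
    moreover have "(\<Sum>v\<in>?W. l v * (\<Sum>u\<in>?W. R v u * w u)) = 0"
      if l: "l \<in> L" "\<forall>v. v \<notin> ?W \<longrightarrow> l v = 0" for w l
    proof -
      have lz: "l z0 = 0" using False l by blast
      have 1: "(\<Sum>u\<in>?W. R v u * w u) = (\<Sum>u\<in>W. P v u * w u)" if "v \<in> W" for v
        using insert.hyps nz that by (auto simp: R_def cong: sum.cong)
      have "(\<Sum>v\<in>W. l v * (\<Sum>u\<in>W. P v u * w u)) = 0"
      proof (rule P2[OF l(1)], intro allI impI)
        fix v assume "v \<notin> W"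
        then show "l v = 0" using l lz by (cases "v = z0") simp_all
      qed
      moreover have "(\<Sum>v\<in>?W. l v * (\<Sum>u\<in>?W. R v u * w u))
          = l z0 * (\<Sum>u\<in>?W. R z0 u * w u) + (\<Sum>v\<in>W. l v * (\<Sum>u\<in>?W. R v u * w u))"
        by (rule sum.insert) (use insert.hyps in auto)
      ultimately show ?thesis using lz by (simp add: 1 cong: sum.cong)
    qed
    ultimately show ?thesis by (intro exI[of _ R]) blast
  qed
qed simp

context point
begin

subsection \<open>From tangent vectors to local equations\<close>

text \<open>The conormal space of the scheme defined by \<open>I\<close> at the point, for
  \<open>I\<close> vanishing there: the annihilator of these functionals is the Zariski tangent
  space.\<close>

definition linear_parts :: "('v, complex) mpoly set \<Rightarrow> ('v \<Rightarrow> complex) set" where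
  "linear_parts I = {l. (\<forall>v. v \<notin> V \<longrightarrow> l v = 0) \<and> (\<exists>a\<in>I. (\<Sum>v\<in>V. Const (l v) * xc v) - a \<in> mpow 2)}"

lemma linear_partsI:
  "(\<And>v. v \<notin> V \<Longrightarrow> l v = 0) \<Longrightarrow> a \<in> I \<Longrightarrow> (\<Sum>v\<in>V. Const (l v) * xc v) - a \<in> mpow 2 \<Longrightarrow> l \<in> linear_parts I"
  unfolding linear_parts_def by blast

lemma linear_partsE:
  assumes "l \<in> linear_parts I"
  obtains a where "a \<in> I" "(\<Sum>v\<in>V. Const (l v) * xc v) - a \<in> mpow 2" "\<And>v. v \<notin> V \<Longrightarrow> l v = 0"
  using assms unfolding linear_parts_def by blast

lemma linear_parts_zero:
  assumes "ideal_of (polys V) I"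
  shows "(\<lambda>_. 0) \<in> linear_parts I"
proof (rule linear_partsI[OF _ ideal_ofD(2)[OF assms]])
  show "(\<Sum>v\<in>V. Const 0 * xc v) - 0 \<in> mpow 2" using mpow_0[of 2] by (simp del: mpow.simps)
qed simp

lemma linear_parts_add:
  assumes I: "ideal_of (polys V) I" and l: "l \<in> linear_parts I" and m: "m \<in> linear_parts I"
  shows "(\<lambda>v. l v + m v) \<in> linear_parts I"
proof -
  obtain a where a: "a \<in> I" "(\<Sum>v\<in>V. Const (l v) * xc v) - a \<in> mpow 2" "\<And>v. v \<notin> V \<Longrightarrow> l v = 0"
    by (rule linear_partsE[OF l]) (rule that)
  obtain b where b: "b \<in> I" "(\<Sum>v\<in>V. Const (m v) * xc v) - b \<in> mpow 2" "\<And>v. v \<notin> V \<Longrightarrow> m v = 0"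
    by (rule linear_partsE[OF m]) (rule that)
  have eq: "(\<Sum>v\<in>V. Const (l v + m v) * xc v) - (a + b)
      = ((\<Sum>v\<in>V. Const (l v) * xc v) - a) + ((\<Sum>v\<in>V. Const (m v) * xc v) - b)"
    by (simp add: Const_add algebra_simps sum.distrib)
  show ?thesis
  proof (rule linear_partsI[OF _ ideal_ofD(3)[OF I a(1) b(1)]])
    show "(\<Sum>v\<in>V. Const (l v + m v) * xc v) - (a + b) \<in> mpow 2"
      unfolding eq by (rule mpow_add[OF a(2) b(2)])
  qed (simp add: a b)
qed

lemma linear_parts_scale:
  assumes I: "ideal_of (polys V) I" and l: "l \<in> linear_parts I"
  shows "(\<lambda>v. c * l v) \<in> linear_parts I"
proof -
  obtain a where a: "a \<in> I" "(\<Sum>v\<in>V. Const (l v) * xc v) - a \<in> mpow 2" "\<And>v. v \<notin> V \<Longrightarrow> l v = 0"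
    by (rule linear_partsE[OF l]) (rule that)
  have eq: "(\<Sum>v\<in>V. Const (c * l v) * xc v) - Const c * a = Const c * ((\<Sum>v\<in>V. Const (l v) * xc v) - a)"
    by (simp add: Const_mult algebra_simps sum_distrib_left)
  show ?thesis
  proof (rule linear_partsI[OF _ ideal_ofD(4)[OF I polys_Const a(1)]])
    show "(\<Sum>v\<in>V. Const (c * l v) * xc v) - Const c * a \<in> mpow 2"
      unfolding eq by (rule mpow_mult_polys[OF polys_Const a(2)])
  qed (simp add: a)
qed

text \<open>Modulo \<open>I\<close> and higher order, each coordinate may be replaced by its
  projection to the tangent space, hence a leading form by its composition with the
  projection.\<close>

lemma project_form:
  assumes I: "ideal_of (polys V) I"
    and P: "\<And>v. v \<in> V \<Longrightarrow> \<exists>a\<in>I. xc v - (\<Sum>u\<in>V. Const (P v u) * xc u) - a \<in> mpow 2"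
    and "r \<in> lead_forms k"
  shows "\<exists>s\<in>mpow k. (\<exists>a\<in>I. r - s - a \<in> mpow (Suc k)) \<and>
    (\<forall>w. peval (\<lambda>v. e v + w v) s = peval (\<lambda>v. e v + (\<Sum>u\<in>V. P v u * w u)) r)"
  using assms(3)
proof (induction k arbitrary: r)
  case 0
  then obtain c where c: "r = Const c" by auto
  have "\<exists>a\<in>I. r - r - a \<in> mpow (Suc 0)"
    using mpow_0[of "Suc 0"] by (intro bexI[of _ 0] ideal_ofD(2)[OF I]) (simp del: mpow.simps)
  then show ?case by (rule bexI[of _ r, OF conjI]) (simp_all add: c peval_simps)
next
  case (Suc k)
  from Suc.prems obtain r' where r: "r = (\<Sum>v\<in>V. xc v * r' v)" "\<And>v. v \<in> V \<Longrightarrow> r' v \<in> lead_forms k"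
    by (elim lead_forms_SucE) blast
  define \<pi> where "\<pi> v = (\<Sum>u\<in>V. Const (P v u) * xc u)" for v
  have \<pi>1: "\<pi> v \<in> mpow 1" for v
    unfolding \<pi>_def by (intro mpow_sum mpow_mult_polys polys_Const xc_mpow)
  have "\<forall>v\<in>V. \<exists>a. a \<in> I \<and> xc v - \<pi> v - a \<in> mpow 2" using P unfolding \<pi>_def by blast
  then have "\<exists>a. \<forall>v\<in>V. a v \<in> I \<and> xc v - \<pi> v - a v \<in> mpow 2" by (rule bchoice)
  then obtain a where a: "\<forall>v\<in>V. a v \<in> I \<and> xc v - \<pi> v - a v \<in> mpow 2" by (rule exE)
  have "\<forall>v\<in>V. \<exists>sb. fst sb \<in> mpow k \<and> snd sb \<in> I \<and> r' v - fst sb - snd sb \<in> mpow (Suc k) \<and>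
    (\<forall>w. peval (\<lambda>v. e v + w v) (fst sb) = peval (\<lambda>v. e v + (\<Sum>u\<in>V. P v u * w u)) (r' v))"
  proof
    fix v assume "v \<in> V"
    from Suc.IH[OF r(2)[OF this]] obtain s b where "s \<in> mpow k" "b \<in> I" "r' v - s - b \<in> mpow (Suc k)"
      "\<forall>w. peval (\<lambda>v. e v + w v) s = peval (\<lambda>v. e v + (\<Sum>u\<in>V. P v u * w u)) (r' v)"
      by (elim bexE conjE)
    then show "\<exists>sb. fst sb \<in> mpow k \<and> snd sb \<in> I \<and> r' v - fst sb - snd sb \<in> mpow (Suc k) \<and>
      (\<forall>w. peval (\<lambda>v. e v + w v) (fst sb) = peval (\<lambda>v. e v + (\<Sum>u\<in>V. P v u * w u)) (r' v))"
      by (intro exI[of _ "(s, b)"]) (simp del: mpow.simps)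
  qed
  then obtain sb where sb: "\<forall>v\<in>V. fst (sb v) \<in> mpow k \<and> snd (sb v) \<in> I \<and> r' v - fst (sb v) - snd (sb v) \<in> mpow (Suc k) \<and>
    (\<forall>w. peval (\<lambda>v. e v + w v) (fst (sb v)) = peval (\<lambda>v. e v + (\<Sum>u\<in>V. P v u * w u)) (r' v))"
    by (rule bchoice[THEN exE])
  define s where "s v = fst (sb v)" for v
  define b where "b v = snd (sb v)" for v
  have s: "s v \<in> mpow k" "b v \<in> I" "r' v - s v - b v \<in> mpow (Suc k)"
    "peval (\<lambda>v. e v + w v) (s v) = peval (\<lambda>v. e v + (\<Sum>u\<in>V. P v u * w u)) (r' v)" if "v \<in> V" for v w
    using sb that unfolding s_def b_def by blast+
  have r'p: "r' v \<in> mpow k" if "v \<in> V" for v using lead_forms_mpow[OF r(2)[OF that]] .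
  have \<pi>p: "\<pi> v \<in> polys V" for v using mpow_polys[OF \<pi>1] .
  define S where "S = (\<Sum>v\<in>V. \<pi> v * s v)"
  define A where "A = (\<Sum>v\<in>V. r' v * a v + \<pi> v * b v)"
  have "S \<in> mpow (Suc k)"
    unfolding S_def using mpow_mult[OF \<pi>1 s(1)] by (intro mpow_sum) simp
  moreover have "A \<in> I" unfolding A_def
    by (intro ideal_of_sum[OF I] ideal_ofD(3,4)[OF I]) (use a s(2) mpow_polys[OF r'p] \<pi>p in auto)
  moreover have "r - S - A \<in> mpow (Suc (Suc k))"
  proof -
    have "r - S - A = (\<Sum>v\<in>V. (xc v - \<pi> v - a v) * r' v + \<pi> v * (r' v - s v - b v))"
      unfolding r S_def A_def sum_subtractf[symmetric] by (rule sum.cong) (simp_all add: algebra_simps)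
    also have "\<dots> \<in> mpow (Suc (Suc k))"
    proof (intro mpow_sum mpow_add)
      fix v assume v: "v \<in> V"
      show "(xc v - \<pi> v - a v) * r' v \<in> mpow (Suc (Suc k))"
        using mpow_mult[OF conjunct2[OF bspec[OF a v]] r'p[OF v]] by (simp del: mpow.simps)
      show "\<pi> v * (r' v - s v - b v) \<in> mpow (Suc (Suc k))"
        using mpow_mult[OF \<pi>1[of v] s(3)[OF v]] by (simp del: mpow.simps)
    qed
    finally show ?thesis .
  qed
  moreover have "peval (\<lambda>v. e v + w v) S = peval (\<lambda>v. e v + (\<Sum>u\<in>V. P v u * w u)) r" for w
    unfolding S_def r \<pi>_def peval_simps by (rule sum.cong) (simp_all add: s(4) peval_simps)
  ultimately show ?case by blast
qed

text \<open>The leading form at the point of an element vanishing on the curves vanishes on the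
  tangent space. It can therefore be absorbed by \<open>I\<close>, so that \<open>f\<close> lies in
  \<open>I\<close> up to arbitrarily high order. Geometrically, \<open>f\<close> vanishes near the
  point on the scheme defined by \<open>I\<close>.\<close>

theorem tangent_criterion:
  assumes I: "ideal_of (polys V) I" and f: "f \<in> polys V"
    and curves: "\<And>w. (\<And>l. l \<in> linear_parts I \<Longrightarrow> (\<Sum>v\<in>V. l v * w v) = 0) \<Longrightarrow>
      \<exists>\<gamma>. curve_to \<gamma> w \<and> (\<forall>g\<in>insert f I. \<forall>\<^sub>F t in at 0. peval (\<gamma> t) g = 0)"
  shows "\<exists>h\<in>polys V. peval e h \<noteq> 0 \<and> h * f \<in> I"
proof (rule krull_intersection[OF I f])
  obtain P where P1: "\<forall>v\<in>V. (\<lambda>u. if u \<in> V then (if u = v then 1 else 0) - P v u else 0) \<in> linear_parts I"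
    and P2': "\<forall>w. \<forall>l\<in>linear_parts I. (\<forall>v. v \<notin> V \<longrightarrow> l v = 0) \<longrightarrow> (\<Sum>v\<in>V. l v * (\<Sum>u\<in>V. P v u * w u)) = 0"
    using annihilator_projection[OF finV linear_parts_zero[OF I] linear_parts_add[OF I] linear_parts_scale[OF I]]
    by blast
  have P2: "(\<Sum>v\<in>V. l v * (\<Sum>u\<in>V. P v u * w u)) = 0" if "l \<in> linear_parts I" for w l
    using P2' that unfolding linear_parts_def by blast
  have P: "\<exists>a\<in>I. xc v - (\<Sum>u\<in>V. Const (P v u) * xc u) - a \<in> mpow 2" if v: "v \<in> V" for v
  proof -
    have "(\<Sum>u\<in>V. Const (if u \<in> V then (if u = v then 1 else 0) - P v u else 0) * xc u)
        = (\<Sum>u\<in>V. (if u = v then xc u else 0) - Const (P v u) * xc u)"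
      by (rule sum.cong) (auto simp: Const_diff algebra_simps)
    also have "\<dots> = xc v - (\<Sum>u\<in>V. Const (P v u) * xc u)" using v finV by (simp add: sum_subtractf)
    finally have eq: "(\<Sum>u\<in>V. Const (if u \<in> V then (if u = v then 1 else 0) - P v u else 0) * xc u)
        = xc v - (\<Sum>u\<in>V. Const (P v u) * xc u)" .
    obtain a where "a \<in> I"
      "(\<Sum>u\<in>V. Const (if u \<in> V then (if u = v then 1 else 0) - P v u else 0) * xc u) - a \<in> mpow 2"
      by (rule linear_partsE[OF bspec[OF P1 v]]) (rule that)
    then show ?thesis unfolding eq by (rule bexI[rotated])
  qed
  fix k show "\<exists>p\<in>mpow k. f - p \<in> I"
  proof (induction k)
    case 0
    then show ?case using f ideal_ofD(2)[OF I] by (intro bexI[of _ f]) auto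
  next
    case (Suc k)
    then obtain p where p: "p \<in> mpow k" "f - p \<in> I" by blast
    obtain q where q: "q \<in> lead_forms k" "p - q \<in> mpow (Suc k)" using leading_form[OF p(1)] by blast
    obtain s a where s: "s \<in> mpow k" "a \<in> I" "q - s - a \<in> mpow (Suc k)"
      "\<And>w. peval (\<lambda>v. e v + w v) s = peval (\<lambda>v. e v + (\<Sum>u\<in>V. P v u * w u)) q"
      using project_form[OF I P q(1)] by blast
    have "peval y s = 0" for y
    proof -
      define w where "w v = y v - e v" for v
      obtain \<gamma> where g: "curve_to \<gamma> (\<lambda>v. \<Sum>u\<in>V. P v u * w u)"
        and z: "\<And>g. g \<in> insert f I \<Longrightarrow> \<forall>\<^sub>F t in at 0. peval (\<gamma> t) g = 0"
        using curves[of "\<lambda>v. \<Sum>u\<in>V. P v u * w u"] P2 by blast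
      have "\<forall>\<^sub>F t in at 0. peval (\<gamma> t) p = 0"
        using z[OF insertI1] z[OF insertI2[OF p(2)]] by eventually_elim (simp add: peval_simps)
      then have "peval (\<lambda>v. e v + (\<Sum>u\<in>V. P v u * w u)) q = 0"
        by (rule leading_form_vanishes[OF g p(1) q])
      then have "peval (\<lambda>v. e v + w v) s = 0" using s(4) by simp
      then show ?thesis by (simp add: w_def)
    qed
    then have "s = 0" by (rule peval_inj_zero)
    \<comment> \<open>The leading form \<open>q\<close> is replaced by the element \<open>a\<close> of the ideal.\<close>
    define p' where "p' = (p - q) + (q - s - a)"
    have "p' \<in> mpow (Suc k)" unfolding p'_def by (rule mpow_add[OF q(2) s(3)])
    moreover have "f - p' = (f - p) + a" by (simp add: p'_def \<open>s = 0\<close>)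
    then have "f - p' \<in> I" using ideal_ofD(3)[OF I p(2) s(2)] by (simp only:)
    ultimately show ?case by blast
  qed
qed

text \<open>An element of the ideal agrees with its linear part up to second order, and the tangent
  vector annihilates the linear part.\<close>

lemma derivative_along_tangent:
  assumes I: "ideal_of (polys V) I" and a: "a \<in> I" "peval e a = 0"
    and w: "\<And>l. l \<in> linear_parts I \<Longrightarrow> (\<Sum>v\<in>V. l v * w v) = 0"
  shows "((\<lambda>t. peval (\<lambda>v. e v + t * w v) a / t) \<longlongrightarrow> 0) (at 0)"
proof -
  have c: "curve_to (\<lambda>t v. e v + t * w v) w"
    by (auto simp: curve_to_def intro!: derivative_eq_intros)
  have "a \<in> mpow (Suc 0)" using sub_value_mpow[OF ideal_ofD(1)[OF I a(1)]] a(2) by (simp del: mpow.simps)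
  then obtain q where q: "q \<in> lead_forms (Suc 0)" "a - q \<in> mpow (Suc (Suc 0))"
    using leading_form[of a "Suc 0"] by blast
  then have q2: "a - q \<in> mpow 2" by (simp only: numeral_2_eq_2)
  obtain r where r: "q = (\<Sum>v\<in>V. xc v * r v)" "\<And>v. v \<in> V \<Longrightarrow> r v \<in> lead_forms 0"
    using q(1) by (rule lead_forms_SucE) (rule that)
  define l where "l v = (SOME c. r v = Const c)" for v
  have l: "r v = Const (l v)" if "v \<in> V" for v
    unfolding l_def by (rule someI_ex) (use r(2)[OF that] in auto)
  define m where "m v = (if v \<in> V then l v else 0)" for v
  have qm: "q = (\<Sum>v\<in>V. Const (m v) * xc v)"
    unfolding r(1) by (rule sum.cong) (simp_all add: l m_def mult.commute)
  have "(q - a) \<in> mpow 2"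
    using mpow_mult_polys[OF polys_Const[of "-1"] q2] by (simp add: Const_uminus algebra_simps del: mpow.simps)
  then have "m \<in> linear_parts I"
    by (intro linear_partsI[OF _ a(1)]) (simp_all add: qm m_def del: mpow.simps)
  from w[OF this] have mw: "(\<Sum>v\<in>V. m v * w v) = 0" .
  have "peval (\<lambda>v. e v + w v) q = 0" unfolding qm using mw by (simp add: peval_simps)
  then have l1: "((\<lambda>t. peval (\<lambda>v. e v + t * w v) q / t ^ 1) \<longlongrightarrow> 0) (at 0)"
    using lead_forms_growth[OF c q(1)] by (simp del: lead_forms.simps)
  obtain L where L: "((\<lambda>t. peval (\<lambda>v. e v + t * w v) (a - q) / t ^ 2) \<longlongrightarrow> L) (at 0)"
    using mpow_growth[OF c q2] by blast
  have l2: "((\<lambda>t. t * (peval (\<lambda>v. e v + t * w v) (a - q) / t ^ 2)) \<longlongrightarrow> 0 * L) (at 0)"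
    by (intro tendsto_mult L tendsto_ident_at)
  have l3: "((\<lambda>t. peval (\<lambda>v. e v + t * w v) q / t ^ 1 + t * (peval (\<lambda>v. e v + t * w v) (a - q) / t ^ 2)) \<longlongrightarrow> 0 + 0 * L) (at 0)"
    by (rule tendsto_add[OF l1 l2])
  have ev: "\<forall>\<^sub>F t in at 0. peval (\<lambda>v. e v + t * w v) q / t ^ 1 + t * (peval (\<lambda>v. e v + t * w v) (a - q) / t ^ 2)
      = peval (\<lambda>v. e v + t * w v) a / t"
    using eventually_neq_at_within[of 0 0 UNIV]
    by eventually_elim (simp add: peval_simps field_simps power2_eq_square)
  show ?thesis using l3 tendsto_cong[OF ev] by simp
qed

end

section \<open>Forms under linear maps and in families\<close>

subsection \<open>Coefficients of products\<close>

lemma finite_mdeg_le: "finite {m :: 'n::finite monomial. mdeg m \<le> k}"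
proof (rule finite_imageD)
  let ?F = "{f :: 'n \<Rightarrow> nat. \<forall>x. (x \<in> UNIV \<longrightarrow> f x \<in> {..k}) \<and> (x \<notin> UNIV \<longrightarrow> f x = 0)}"
  have "lookup m v \<le> k" if "mdeg m \<le> k" for m :: "'n monomial" and v
  proof -
    have "lookup m v \<le> mdeg m"
      unfolding mdeg_superset[OF finite subset_UNIV, of m] by (rule member_le_sum) auto
    then show ?thesis using that by simp
  qed
  then have "lookup ` {m :: 'n monomial. mdeg m \<le> k} \<subseteq> ?F" by auto
  moreover have "finite ?F" by (rule finite_set_of_finite_funs) auto
  ultimately show "finite (lookup ` {m :: 'n monomial. mdeg m \<le> k})" by (rule finite_subset)
  show "inj_on lookup {m :: 'n monomial. mdeg m \<le> k}"
    by (intro inj_onI poly_mapping_eqI) simp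
qed

lemma finite_mdeg: "finite {m :: 'n::finite monomial. mdeg m = k}"
  by (rule finite_subset[OF _ finite_mdeg_le[of k]]) auto

text \<open>A finite index set for the coefficients of a product that does not depend on the
  factors, so that coefficients of products of families can be differentiated term by term.\<close>

definition divisors :: "'n monomial \<Rightarrow> 'n monomial set" where
  "divisors k = {m. \<exists>n. k = m + n}"

lemma finite_divisors [simp]: "finite (divisors (k :: 'n::finite monomial))"
  by (rule finite_subset[OF _ finite_mdeg_le[of "mdeg k"]]) (auto simp: divisors_def mdeg_add)

lemma lookup_mult_divisors:
  fixes p q :: "('n::finite, 'a::comm_ring_1) mpoly"
  shows "lookup (p * q) k = (\<Sum>m\<in>divisors k. lookup p m * lookup q (k - m))"
proof (induction p rule: mpoly_additive_induct)
  case (single m c)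
  have *: "lookup (single m c * q) k = (if m \<in> divisors k then c * lookup q (k - m) else 0)"
  proof (induction q rule: mpoly_additive_induct)
    case (single n d)
    have "m + n = k \<longleftrightarrow> m \<in> divisors k \<and> n = k - m" by (auto simp: divisors_def)
    then show ?case by (auto simp: mult_single lookup_single when_def)
  qed (simp_all add: lookup_add algebra_simps)
  have "(\<Sum>m'\<in>divisors k. lookup (single m c) m' * lookup q (k - m'))
      = (\<Sum>m'\<in>divisors k. if m' = m then c * lookup q (k - m) else 0)"
    by (rule sum.cong) (auto simp: lookup_single when_def)
  then show ?case unfolding * by simp
qed (simp_all add: lookup_add algebra_simps sum.distrib)

subsection \<open>Mapping coefficients\<close>

definition map_coeffs :: "('a::comm_ring_1 \<Rightarrow> 'b::comm_ring_1) \<Rightarrow> ('v, 'a) mpoly \<Rightarrow> ('v, 'b) mpoly" where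
  "map_coeffs h = eval_with (\<lambda>c. Const (h c)) Var"

lemma psubst_Var [simp]: "psubst Var p = p"
  by (induction p rule: mpoly_ring_induct) (simp_all add: psubst_simps)

lemma mon_eval_Var: "mon_eval Var m = single m 1"
  using Const_hom.eval_single[of Var m 1, symmetric] by simp

context coeff_hom
begin

lemma Const_comp: "coeff_hom (\<lambda>c. Const (h c))"
  by standard (simp_all add: hom_1 hom_add hom_mult Const_add Const_mult)

interpretation C: coeff_hom "\<lambda>c. Const (h c)" by (rule Const_comp)

lemmas map_coeffs_simps =
  C.eval_simps[where x = Var, folded map_coeffs_def]

lemma lookup_map_coeffs: "lookup (map_coeffs h p) m = h (lookup p m)"
proof (induction p rule: mpoly_additive_induct)
  case (single n c)
  have "map_coeffs h (single n c) = single n (h c)"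
    unfolding map_coeffs_def C.eval_single mon_eval_Var by (simp add: Const_def mult_single)
  then show ?case by (simp add: lookup_single when_def hom_0)
qed (simp_all add: map_coeffs_simps lookup_add hom_add hom_0)

lemma hom_of_nat: "h (of_nat n) = of_nat n"
  by (induction n) (simp_all add: hom_0 hom_1 hom_add)

lemma pdiff_map_coeffs: "pdiff v (map_coeffs h p) = map_coeffs h (pdiff v p)"
  by (rule poly_mapping_eqI)
     (simp only: lookup_pdiff lookup_map_coeffs hom_mult hom_of_nat)

end

subsection \<open>Polynomials with coefficients depending on a parameter\<close>

definition has_coeff_derivative :: "(complex \<Rightarrow> ('n, complex) mpoly) \<Rightarrow> ('n, complex) mpoly \<Rightarrow> bool" where
  "has_coeff_derivative F p \<longleftrightarrow> (\<forall>m. ((\<lambda>t. lookup (F t) m) has_field_derivative lookup p m) (at 0))"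

lemma has_coeff_derivative_const: "has_coeff_derivative (\<lambda>t. p) 0"
  by (simp add: has_coeff_derivative_def)

lemma has_coeff_derivative_add: "has_coeff_derivative F p \<Longrightarrow> has_coeff_derivative G q \<Longrightarrow> has_coeff_derivative (\<lambda>t. F t + G t) (p + q)"
  unfolding has_coeff_derivative_def lookup_add by (intro allI DERIV_add) auto

lemma has_coeff_derivative_sum: "(\<And>i. i \<in> A \<Longrightarrow> has_coeff_derivative (F i) (p i)) \<Longrightarrow> has_coeff_derivative (\<lambda>t. \<Sum>i\<in>A. F i t) (\<Sum>i\<in>A. p i)"
  by (induction A rule: infinite_finite_induct) (simp_all add: has_coeff_derivative_const has_coeff_derivative_add)

lemma has_coeff_derivative_mult:
  fixes F G :: "complex \<Rightarrow> ('n::finite, complex) mpoly"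
  assumes "has_coeff_derivative F p" "has_coeff_derivative G q"
  shows "has_coeff_derivative (\<lambda>t. F t * G t) (p * G 0 + F 0 * q)"
  unfolding has_coeff_derivative_def
proof
  fix k
  have "((\<lambda>t. \<Sum>m\<in>divisors k. lookup (F t) m * lookup (G t) (k - m)) has_field_derivative
      (\<Sum>m\<in>divisors k. lookup p m * lookup (G 0) (k - m) + lookup q (k - m) * lookup (F 0) m)) (at 0)"
    using assms by (intro DERIV_sum DERIV_mult) (auto simp: has_coeff_derivative_def)
  moreover have "(\<Sum>m\<in>divisors k. lookup p m * lookup (G 0) (k - m) + lookup q (k - m) * lookup (F 0) m)
      = lookup (p * G 0 + F 0 * q) k"
    unfolding lookup_add lookup_mult_divisors sum.distrib[symmetric]
    by (rule sum.cong) (simp_all add: mult.commute)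
  ultimately show "((\<lambda>t. lookup (F t * G t) k) has_field_derivative lookup (p * G 0 + F 0 * q) k) (at 0)"
    by (simp only: lookup_mult_divisors)
qed

lemma has_coeff_derivative_psubst:
  fixes y :: "complex \<Rightarrow> 'n::finite \<Rightarrow> ('n, complex) mpoly"
  assumes "\<And>v. has_coeff_derivative (\<lambda>t. y t v) (z v)"
  shows "has_coeff_derivative (\<lambda>t. psubst (y t) p) (\<Sum>v\<in>UNIV. psubst (y 0) (pdiff v p) * z v)"
proof (induction p rule: mpoly_ring_induct)
  case (Const c)
  then show ?case by (simp add: psubst_simps has_coeff_derivative_const)
next
  case (Var m u)
  have "(\<Sum>v\<in>UNIV. psubst (y 0) (pdiff v (Var u)) * z v) = (\<Sum>v\<in>UNIV. if v = u then z v else 0)"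
    by (rule sum.cong) (simp_all add: pdiff_Var psubst_simps)
  then show ?case using assms by (simp add: psubst_simps)
next
  case (add p q)
  have "(\<Sum>v\<in>UNIV. psubst (y 0) (pdiff v (p + q)) * z v)
      = (\<Sum>v\<in>UNIV. psubst (y 0) (pdiff v p) * z v) + (\<Sum>v\<in>UNIV. psubst (y 0) (pdiff v q) * z v)"
    by (simp add: pdiff_add psubst_simps algebra_simps sum.distrib)
  then show ?case using has_coeff_derivative_add[OF add] by (simp add: psubst_simps)
next
  case (mult p q)
  have "(\<Sum>v\<in>UNIV. psubst (y 0) (pdiff v (p * q)) * z v)
      = (\<Sum>v\<in>UNIV. psubst (y 0) (pdiff v p) * z v) * psubst (y 0) q
       + psubst (y 0) p * (\<Sum>v\<in>UNIV. psubst (y 0) (pdiff v q) * z v)"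
    by (simp add: pdiff_mult psubst_simps algebra_simps sum.distrib sum_distrib_left)
  then show ?case using has_coeff_derivative_mult[OF mult] by (simp add: psubst_simps)
qed

definition poly_family :: "(complex \<Rightarrow> ('n, complex) mpoly) \<Rightarrow> bool" where
  "poly_family F \<longleftrightarrow> (\<forall>m. \<exists>q. \<forall>t. lookup (F t) m = poly q t)"

lemma poly_fun_sum:
  "(\<And>i. i \<in> A \<Longrightarrow> \<exists>q. \<forall>t. f i t = poly q t) \<Longrightarrow> \<exists>q. \<forall>t. (\<Sum>i\<in>A. f i t) = poly q (t :: complex)"
proof (induction A rule: infinite_finite_induct)
  case (insert i A)
  then obtain q r where "\<forall>t. f i t = poly q t" "\<forall>t. (\<Sum>i\<in>A. f i t) = poly r t" by blast
  then have "\<forall>t. (\<Sum>i\<in>insert i A. f i t) = poly (q + r) t" using insert by simp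
  then show ?case by blast
qed (auto intro: exI[of _ 0])

lemma poly_fun_mult:
  assumes "\<exists>q. \<forall>t. f t = poly q t" "\<exists>q. \<forall>t. g t = poly q t"
  shows "\<exists>q. \<forall>t. f t * g t = poly q (t :: complex)"
proof -
  obtain q r where "\<forall>t. f t = poly q t" "\<forall>t. g t = poly r t" using assms by blast
  then have "\<forall>t. f t * g t = poly (q * r) t" by simp
  then show ?thesis by blast
qed

lemma poly_family_const: "poly_family (\<lambda>t. p)"
  unfolding poly_family_def
proof
  fix m show "\<exists>q. \<forall>t. lookup p m = poly q t" by (rule exI[of _ "[:lookup p m:]"]) simp
qed

lemma poly_family_sum: "(\<And>i. i \<in> A \<Longrightarrow> poly_family (F i)) \<Longrightarrow> poly_family (\<lambda>t. \<Sum>i\<in>A. F i t)"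
  unfolding poly_family_def lookup_sum by (intro allI poly_fun_sum) auto

lemma poly_family_mult:
  fixes F G :: "complex \<Rightarrow> ('n::finite, complex) mpoly"
  shows "poly_family F \<Longrightarrow> poly_family G \<Longrightarrow> poly_family (\<lambda>t. F t * G t)"
  unfolding poly_family_def lookup_mult_divisors
  by (intro allI poly_fun_sum poly_fun_mult) auto

lemma poly_family_psubst:
  fixes y :: "complex \<Rightarrow> 'n::finite \<Rightarrow> ('n, complex) mpoly"
  assumes "\<And>v. poly_family (\<lambda>t. y t v)"
  shows "poly_family (\<lambda>t. psubst (y t) p)"
proof (induction p rule: mpoly_ring_induct)
  case (add p q)
  have "poly_family (\<lambda>t. \<Sum>r\<in>{True, False}. if r then psubst (y t) p else psubst (y t) q)"
  proof (rule poly_family_sum)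
    fix r show "poly_family (\<lambda>t. if r then psubst (y t) p else psubst (y t) q)"
      by (cases r) (use add in simp_all)
  qed
  then show ?case by (simp add: psubst_simps)
qed (simp_all add: psubst_simps poly_family_const assms poly_family_mult)

lemma poly_family_peval:
  fixes F :: "complex \<Rightarrow> 'v \<Rightarrow> complex"
  assumes "\<And>v. \<exists>q. \<forall>t. F t v = poly q t"
  shows "\<exists>q. \<forall>t. peval (F t) p = poly q t"
proof (induction p rule: mpoly_ring_induct)
  case (Const c)
  have "\<forall>t. peval (F t) (Const c) = poly [:c:] t" by (simp add: peval_simps)
  then show ?case by blast
next
  case (add p q)
  then obtain a b where "\<forall>t. peval (F t) p = poly a t" "\<forall>t. peval (F t) q = poly b t" by blast
  then have "\<forall>t. peval (F t) (p + q) = poly (a + b) t" by (simp add: peval_simps)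
  then show ?case by blast
next
  case (mult p q)
  then show ?case unfolding peval_simps by (rule poly_fun_mult)
qed (simp add: peval_simps assms)

subsection \<open>Linear pull-back\<close>

lemma psubst_linear: "peval x (linear_map g $ i) = (g *v (\<chi> v. x v)) $ i"
  by (simp add: linear_map_def peval_simps matrix_vector_mult_def)

lemma pdiff_linear_map: "pdiff j (linear_map g $ i) = Const (g $ i $ j)"
proof -
  have "pdiff j (linear_map g $ i) = (\<Sum>l\<in>UNIV. if l = j then Const (g $ i $ j) else 0)"
    unfolding linear_map_def vec_lambda_beta pdiff_sum
    by (rule sum.cong) (auto simp: pdiff_mult pdiff_Var)
  then show ?thesis by simp
qed

lemma pullback_linear:
  "pullback (linear_map g) \<omega> $ j = (\<Sum>i\<in>UNIV. psubst (($) (linear_map g)) (\<omega> $ i) * Const (g $ i $ j))"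
  by (simp add: pullback_def pdiff_linear_map)

lemma peval_pullback:
  "peval x (pullback (linear_map g) \<omega> $ j) = (\<Sum>i\<in>UNIV. peval (($) (g *v (\<chi> v. x v))) (\<omega> $ i) * g $ i $ j)"
  by (simp add: pullback_linear peval_simps peval_psubst psubst_linear)

lemma pullback_compose:
  fixes g :: "complex ^ 'n::finite ^ 'm::finite" and h :: "complex ^ 'm ^ 'k::finite"
  shows "pullback (linear_map g) (pullback (linear_map h) \<omega>) = pullback (linear_map (h ** g)) \<omega>"
proof (intro vec_eq_iff[THEN iffD2] allI peval_inj)
  fix j x
  let ?y = "g *v (\<chi> v. x v)"
  have "peval x (pullback (linear_map g) (pullback (linear_map h) \<omega>) $ j)
      = (\<Sum>i\<in>UNIV. (\<Sum>k\<in>UNIV. peval (($) (h *v ?y)) (\<omega> $ k) * h $ k $ i) * g $ i $ j)"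
    unfolding peval_pullback[of x g] by (simp add: peval_pullback)
  also have "\<dots> = (\<Sum>k\<in>UNIV. peval (($) (h *v ?y)) (\<omega> $ k) * (h ** g) $ k $ j)"
    unfolding matrix_matrix_mult_def sum_distrib_right vec_lambda_beta sum_distrib_left
    by (subst sum.swap) (simp add: algebra_simps)
  finally show "peval x (pullback (linear_map g) (pullback (linear_map h) \<omega>) $ j)
      = peval x (pullback (linear_map (h ** g)) \<omega> $ j)"
    unfolding peval_pullback by (simp add: matrix_vector_mul_assoc)
qed

lemma pullback_id:
  fixes \<omega> :: "('n::finite, complex) form1"
  shows "pullback (linear_map (mat 1)) \<omega> = \<omega>"
proof (intro vec_eq_iff[THEN iffD2] allI peval_inj)
  fix j x
  have "peval x (pullback (linear_map (mat 1)) \<omega> $ j) = (\<Sum>i\<in>UNIV. if i = j then peval x (\<omega> $ i) else 0)"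
    unfolding peval_pullback matrix_vector_mul_lid
    by (rule sum.cong) (auto simp: mat_def vec_lambda_inverse)
  then show "peval x (pullback (linear_map (mat 1)) \<omega> $ j) = peval x (\<omega> $ j)" by simp
qed

lemma pullback_scale: "pullback (linear_map g) (Const c *s \<omega>) = Const c *s pullback (linear_map g) \<omega>"
  by (simp add: vec_eq_iff pullback_linear psubst_simps sum_distrib_left algebra_simps)

lemma homog_psubst:
  assumes "homog k p" and y: "\<And>v. homog 1 (y v)"
  shows "homog k (psubst y p)"
proof -
  have 1: "homog (mdeg m) (mon_eval y m)" for m
  proof -
    have "homog (\<Sum>v\<in>M. lookup m v) (\<Prod>v\<in>M. y v ^ lookup m v)" if "finite M" for M
      using that
    proof (induction M)
      case (insert v M)
      then show ?case using homog_mult[OF homog_power[OF y[of v], of "lookup m v"]] by simp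
    qed simp
    then show ?thesis by (simp add: mdeg_def mon_eval_def)
  qed
  show ?thesis unfolding eval_with_def mon_eval_def[symmetric]
  proof (rule homog_sum)
    fix m assume "m \<in> keys p"
    then have "mdeg m = k" using assms(1) by (simp add: homog_def)
    then show "homog k (Const (lookup p m) * mon_eval y m)"
      using homog_mult[OF homog_Const 1[of m]] by simp
  qed
qed

lemma homog_linear_map: "homog 1 (linear_map g $ i)"
proof -
  have "homog (0 + 1) (Const (g $ i $ j) * Var j)" for j by (intro homog_mult homog_Const homog_Var)
  then show ?thesis by (simp add: linear_map_def homog_sum)
qed

lemma homog_pullback:
  assumes "\<And>i. homog k (\<omega> $ i)"
  shows "homog k (pullback (linear_map g) \<omega> $ j)"
proof -
  have "homog (k + 0) (psubst (($) (linear_map g)) (\<omega> $ i) * Const (g $ i $ j))" for i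
    by (intro homog_mult homog_psubst assms homog_linear_map homog_Const)
  then show ?thesis by (simp add: pullback_linear homog_sum)
qed

lemma contract_pullback:
  fixes g :: "complex ^ 'n::finite ^ 'm::finite"
  assumes "contract \<omega> = 0"
  shows "contract (pullback (linear_map g) \<omega>) = 0"
proof (rule peval_inj_zero)
  fix x
  let ?y = "g *v (\<chi> v. x v)"
  have "peval x (contract (pullback (linear_map g) \<omega>))
      = (\<Sum>j\<in>UNIV. (\<Sum>i\<in>UNIV. peval (($) ?y) (\<omega> $ i) * g $ i $ j) * x j)"
    by (simp add: contract_def peval_simps peval_pullback)
  also have "\<dots> = (\<Sum>i\<in>UNIV. peval (($) ?y) (\<omega> $ i) * ?y $ i)"
  proof -
    have y: "?y $ i = (\<Sum>j\<in>UNIV. g $ i $ j * x j)" for i by (simp add: matrix_vector_mult_def)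
    show ?thesis unfolding sum_distrib_right y
      by (subst sum.swap) (simp only: sum_distrib_left mult.assoc)
  qed
  also have "\<dots> = peval (($) ?y) (contract \<omega>)" by (simp add: contract_def peval_simps)
  finally show "peval x (contract (pullback (linear_map g) \<omega>)) = 0" using assms by (simp add: peval_simps)
qed

lemma twisted_pullback: "\<omega> \<in> twisted_forms d \<Longrightarrow> pullback (linear_map g) \<omega> \<in> twisted_forms d"
  by (simp add: twisted_forms_def homog_pullback contract_pullback)

lemma pdiff_pullback:
  "pdiff l (pullback (linear_map g) \<omega> $ k) =
    (\<Sum>b\<in>UNIV. \<Sum>c\<in>UNIV. psubst (($) (linear_map g)) (pdiff b (\<omega> $ c)) * Const (g $ b $ l * g $ c $ k))"
proof -
  have "pdiff l (pullback (linear_map g) \<omega> $ k) =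
    (\<Sum>c\<in>UNIV. \<Sum>b\<in>UNIV. psubst (($) (linear_map g)) (pdiff b (\<omega> $ c)) * Const (g $ b $ l * g $ c $ k))"
    by (simp add: pullback_linear pdiff_sum pdiff_mult pdiff_psubst pdiff_linear_map sum_distrib_right
      sum_distrib_left Const_mult algebra_simps)
  then show ?thesis by (subst sum.swap)
qed

text \<open>The formula \<open>g\<^sup>*\<omega> \<and> d(g\<^sup>*\<omega>) = g\<^sup>*(\<omega>
  \<and> d\<omega>)\<close> in coordinates, before the terms with permuted indices are
  collected.\<close>

lemma wedge_d_pullback:
  "wedge_d (pullback (linear_map g) \<omega>) i j k =
    (\<Sum>a\<in>UNIV. \<Sum>b\<in>UNIV. \<Sum>c\<in>UNIV.
      psubst (($) (linear_map g)) (\<omega> $ a * (pdiff b (\<omega> $ c) - pdiff c (\<omega> $ b))) *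
      Const (g $ a $ i * g $ b $ j * g $ c $ k + g $ a $ j * g $ b $ k * g $ c $ i + g $ a $ k * g $ b $ i * g $ c $ j))"
proof -
  let ?S = "psubst (($) (linear_map g))"
  have d: "pdiff j (pullback (linear_map g) \<omega> $ k) - pdiff k (pullback (linear_map g) \<omega> $ j)
      = (\<Sum>b\<in>UNIV. \<Sum>c\<in>UNIV. ?S (pdiff b (\<omega> $ c) - pdiff c (\<omega> $ b)) * Const (g $ b $ j * g $ c $ k))" for j k
  proof -
    have "pdiff k (pullback (linear_map g) \<omega> $ j)
        = (\<Sum>b\<in>UNIV. \<Sum>c\<in>UNIV. ?S (pdiff c (\<omega> $ b)) * Const (g $ b $ j * g $ c $ k))"
      unfolding pdiff_pullback by (subst sum.swap) (simp add: mult.commute)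
    then show ?thesis unfolding pdiff_pullback[of j g \<omega> k]
      by (simp add: psubst_simps left_diff_distrib sum_subtractf)
  qed
  have t: "pullback (linear_map g) \<omega> $ i * (pdiff j (pullback (linear_map g) \<omega> $ k) - pdiff k (pullback (linear_map g) \<omega> $ j))
      = (\<Sum>a\<in>UNIV. \<Sum>b\<in>UNIV. \<Sum>c\<in>UNIV. ?S (\<omega> $ a * (pdiff b (\<omega> $ c) - pdiff c (\<omega> $ b))) * Const (g $ a $ i * g $ b $ j * g $ c $ k))" for i j k
    unfolding d pullback_linear[of g \<omega> i]
    by (subst sum_distrib_right, unfold sum_distrib_left, intro sum.cong refl)
       (simp add: psubst_simps Const_mult algebra_simps)
  show ?thesis unfolding wedge_d_def t
    by (simp add: sum.distrib[symmetric] Const_add distrib_left mult.assoc)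
qed

text \<open>Cyclic relabelling of the summation indices collects the summands into multiples of the
  pulled back coefficients of \<open>\<omega> \<and> d\<omega>\<close>.\<close>

lemma integrable_pullback:
  fixes g :: "complex ^ 'n::finite ^ 'm::finite"
  assumes "integrable_form \<omega>"
  shows "integrable_form (pullback (linear_map g) \<omega>)"
  unfolding integrable_form_def
proof (intro allI)
  fix i j k
  let ?S = "psubst (($) (linear_map g))"
  define w where "w a b c = ?S (\<omega> $ a * (pdiff b (\<omega> $ c) - pdiff c (\<omega> $ b)))" for a b c
  define G :: "'m \<Rightarrow> 'm \<Rightarrow> 'm \<Rightarrow> ('n, complex) mpoly"
    where "G a b c = Const (g $ a $ i * g $ b $ j * g $ c $ k)" for a b c
  have w0: "w a b c + w b c a + w c a b = 0" for a b c
  proof -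
    have "w a b c + w b c a + w c a b = ?S (wedge_d \<omega> a b c)"
      by (simp add: w_def wedge_d_def psubst_simps)
    then show ?thesis using assms by (simp add: integrable_form_def psubst_simps)
  qed
  have rot: "(\<Sum>a\<in>UNIV. \<Sum>b\<in>UNIV. \<Sum>c\<in>UNIV. f a b c) = (\<Sum>a\<in>UNIV. \<Sum>b\<in>UNIV. \<Sum>c\<in>UNIV. f b c a)"
    for f :: "'m \<Rightarrow> 'm \<Rightarrow> 'm \<Rightarrow> ('n, complex) mpoly"
  proof -
    have "(\<Sum>a\<in>UNIV. \<Sum>b\<in>UNIV. \<Sum>c\<in>UNIV. f a b c) = (\<Sum>a\<in>UNIV. \<Sum>c\<in>UNIV. \<Sum>b\<in>UNIV. f a b c)"
      by (intro sum.cong refl sum.swap)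
    also have "\<dots> = (\<Sum>c\<in>UNIV. \<Sum>a\<in>UNIV. \<Sum>b\<in>UNIV. f a b c)" by (rule sum.swap)
    finally show ?thesis .
  qed
  have "wedge_d (pullback (linear_map g) \<omega>) i j k
      = (\<Sum>a\<in>UNIV. \<Sum>b\<in>UNIV. \<Sum>c\<in>UNIV. w a b c * G a b c)
       + (\<Sum>a\<in>UNIV. \<Sum>b\<in>UNIV. \<Sum>c\<in>UNIV. w a b c * G c a b)
       + (\<Sum>a\<in>UNIV. \<Sum>b\<in>UNIV. \<Sum>c\<in>UNIV. w a b c * G b c a)"
    unfolding wedge_d_pullback w_def[symmetric] G_def
    by (simp add: sum.distrib[symmetric] Const_add distrib_left mult.commute mult.left_commute)
  also have "(\<Sum>a\<in>UNIV. \<Sum>b\<in>UNIV. \<Sum>c\<in>UNIV. w a b c * G c a b) = (\<Sum>a\<in>UNIV. \<Sum>b\<in>UNIV. \<Sum>c\<in>UNIV. w b c a * G a b c)"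
    by (rule rot)
  also have "(\<Sum>a\<in>UNIV. \<Sum>b\<in>UNIV. \<Sum>c\<in>UNIV. w a b c * G b c a) = (\<Sum>a\<in>UNIV. \<Sum>b\<in>UNIV. \<Sum>c\<in>UNIV. w c a b * G a b c)"
    by (rule rot[THEN trans], rule rot)
  also have "(\<Sum>a\<in>UNIV. \<Sum>b\<in>UNIV. \<Sum>c\<in>UNIV. w a b c * G a b c)
       + (\<Sum>a\<in>UNIV. \<Sum>b\<in>UNIV. \<Sum>c\<in>UNIV. w b c a * G a b c)
       + (\<Sum>a\<in>UNIV. \<Sum>b\<in>UNIV. \<Sum>c\<in>UNIV. w c a b * G a b c)
      = (\<Sum>a\<in>UNIV. \<Sum>b\<in>UNIV. \<Sum>c\<in>UNIV. (w a b c + w b c a + w c a b) * G a b c)"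
    by (simp add: sum.distrib[symmetric] distrib_right)
  finally show "wedge_d (pullback (linear_map g) \<omega>) i j k = 0" by (simp add: w0)
qed

lemma pullback_invertible_nonzero:
  fixes g :: "complex ^ 'n::finite ^ 'n"
  assumes "invertible g" "\<omega> \<noteq> 0"
  shows "pullback (linear_map g) \<omega> \<noteq> 0"
proof
  assume *: "pullback (linear_map g) \<omega> = 0"
  obtain h where "g ** h = mat 1" using assms(1) by (auto simp: invertible_def)
  then have "\<omega> = pullback (linear_map h) (pullback (linear_map g) \<omega>)"
    by (simp add: pullback_compose pullback_id)
  also have "\<dots> = 0" unfolding * by (simp add: vec_eq_iff pullback_linear psubst_simps)
  finally show False using assms(2) by simp
qed

text \<open>The Lie derivative along the linear vector field with matrix \<open>a\<close>.\<close>

definition lie :: "complex ^ 'n ^ 'n \<Rightarrow> ('n::finite, complex) form1 \<Rightarrow> ('n, complex) form1" where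
  "lie a \<omega> = (\<chi> j. (\<Sum>l\<in>UNIV. pdiff l (\<omega> $ j) * linear_map a $ l) + (\<Sum>i\<in>UNIV. \<omega> $ i * Const (a $ i $ j)))"

definition line_mat :: "complex ^ 'n ^ 'm \<Rightarrow> complex ^ 'n ^ 'm \<Rightarrow> complex \<Rightarrow> complex ^ 'n ^ 'm" where
  "line_mat b a t = (\<chi> i j. b $ i $ j + t * a $ i $ j)"

lemma line_mat_nth [simp]: "line_mat b a t $ i $ j = b $ i $ j + t * a $ i $ j"
  by (simp add: line_mat_def)

lemma line_mat_0 [simp]: "line_mat b a 0 = b"
  by (simp add: vec_eq_iff)

lemma linear_map_family: "linear_map (line_mat b a t) $ v = linear_map b $ v + Const t * linear_map a $ v"
  for a b :: "complex ^ 'n::finite ^ 'm::finite"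
  by (simp add: linear_map_def Const_add Const_mult algebra_simps sum.distrib sum_distrib_left)

lemma linear_map_id [simp]: "linear_map (mat 1) $ v = Var v"
proof -
  have "linear_map (mat 1) $ v = (\<Sum>j\<in>UNIV. if j = v then Var j else 0)"
    unfolding linear_map_def vec_lambda_beta by (rule sum.cong) (auto simp: mat_def)
  then show ?thesis by simp
qed

lemma has_coeff_derivative_Const: "(f has_field_derivative c) (at 0) \<Longrightarrow> has_coeff_derivative (\<lambda>t. Const (f t)) (Const c)"
  unfolding has_coeff_derivative_def Const_def lookup_single when_def by auto

lemma pullback_has_coeff_derivative:
  "has_coeff_derivative (\<lambda>t. pullback (linear_map (line_mat (mat 1) a t)) \<omega> $ j) (lie a \<omega> $ j)"
proof -
  have y: "has_coeff_derivative (\<lambda>t. linear_map (line_mat (mat 1) a t) $ v) (linear_map a $ v)" for v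
  proof -
    have "has_coeff_derivative (\<lambda>t. Const t * linear_map a $ v) (Const 1 * linear_map a $ v + Const 0 * 0)"
      by (intro has_coeff_derivative_mult has_coeff_derivative_Const has_coeff_derivative_const DERIV_ident)
    from has_coeff_derivative_add[OF has_coeff_derivative_const this] show ?thesis unfolding linear_map_family by simp
  qed
  have c: "has_coeff_derivative (\<lambda>t. Const ((line_mat (mat 1) a t) $ i $ j)) (Const (a $ i $ j))" for i
    by (rule has_coeff_derivative_Const) (auto intro!: derivative_eq_intros)
  have y0: "($) (linear_map (line_mat (mat 1) a 0)) = Var" by (simp add: fun_eq_iff)
  have "has_coeff_derivative (\<lambda>t. pullback (linear_map (line_mat (mat 1) a t)) \<omega> $ j)
    (\<Sum>i\<in>UNIV. (\<Sum>l\<in>UNIV. psubst (($) (linear_map (line_mat (mat 1) a 0))) (pdiff l (\<omega> $ i)) * linear_map a $ l) * Const ((line_mat (mat 1) a 0) $ i $ j)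
      + psubst (($) (linear_map (line_mat (mat 1) a 0))) (\<omega> $ i) * Const (a $ i $ j))"
    unfolding pullback_linear
    by (intro has_coeff_derivative_sum has_coeff_derivative_mult has_coeff_derivative_psubst y c)
  also have "(\<Sum>i\<in>UNIV. (\<Sum>l\<in>UNIV. psubst (($) (linear_map (line_mat (mat 1) a 0))) (pdiff l (\<omega> $ i)) * linear_map a $ l) * Const ((line_mat (mat 1) a 0) $ i $ j)
      + psubst (($) (linear_map (line_mat (mat 1) a 0))) (\<omega> $ i) * Const (a $ i $ j))
    = (\<Sum>i\<in>UNIV. if i = j then (\<Sum>l\<in>UNIV. pdiff l (\<omega> $ i) * linear_map a $ l) else 0) + (\<Sum>i\<in>UNIV. \<omega> $ i * Const (a $ i $ j))"
    unfolding y0 psubst_Var sum.distrib by (intro arg_cong2[of _ _ _ _ "(+)"] sum.cong refl) (auto simp: mat_def)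
  also have "\<dots> = lie a \<omega> $ j" by (simp add: lie_def)
  finally show ?thesis .
qed

lemma pullback_poly_family:
  fixes a b :: "complex ^ 'n::finite ^ 'n"
  shows "poly_family (\<lambda>t. pullback (linear_map (line_mat b a t)) \<omega> $ j)"
proof -
  have c: "poly_family (\<lambda>t. Const (x + t * y))" for x y
    unfolding poly_family_def Const_def lookup_single when_def
  proof
    fix m show "\<exists>q. \<forall>t. (if 0 = m then x + t * y else 0) = poly q t"
      by (rule exI[of _ "if 0 = m then [:x, y:] else 0"]) simp
  qed
  have y: "poly_family (\<lambda>t. linear_map (line_mat b a t) $ v)" for v
    using c unfolding linear_map_def by (auto intro!: poly_family_sum poly_family_mult poly_family_const)
  show ?thesis unfolding pullback_linear
    using c by (auto intro!: poly_family_sum poly_family_mult poly_family_psubst y)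
qed

section \<open>The scheme of foliations\<close>

subsection \<open>Coordinates\<close>

definition coord_vars :: "nat \<Rightarrow> ('n \<times> 'n monomial) set" where
  "coord_vars d = {v. mdeg (snd v) = d + 1}"

lemma coord_ring_polys: "coord_ring d = polys (coord_vars d)"
  by (auto simp: coord_ring_def polys_def coord_vars_def)

lemma finite_coord_vars: "finite (coord_vars d :: ('n::finite \<times> 'n monomial) set)"
proof -
  have "coord_vars d = (UNIV :: 'n set) \<times> {m. mdeg m = d + 1}" by (auto simp: coord_vars_def)
  then show ?thesis using finite_cartesian_product[OF finite[of "UNIV :: 'n set"] finite_mdeg[of "d + 1"]] by (simp only:)
qed

interpretation peval_hom: coeff_hom "peval x" for x :: "'v \<Rightarrow> 'a::comm_ring_1"
  by standard (simp_all add: peval_simps)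

definition hom_form :: "nat \<Rightarrow> ('n::finite, complex) form1 \<Rightarrow> bool" where
  "hom_form d \<omega> \<longleftrightarrow> (\<forall>i. homog (d + 1) (\<omega> $ i))"

lemma twisted_forms_iff: "\<omega> \<in> twisted_forms d \<longleftrightarrow> hom_form d \<omega> \<and> contract \<omega> = 0"
  by (simp add: twisted_forms_def hom_form_def)

lemma lookup_universal: "lookup (universal_form d $ i) m = (if mdeg m = d + 1 then Var (i, m) else 0)"
proof -
  have "lookup (universal_form d $ i) m = (\<Sum>n\<in>{n. mdeg n = d + 1}. if n = m then Var (i, n) else 0)"
    by (simp add: universal_form_def lookup_sum lookup_single when_def)
  then show ?thesis using finite_mdeg[where 'n = 'a] by (simp add: sum.delta)
qed

text \<open>Evaluating the coordinate functions at \<open>\<omega>\<close> specializes the universal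
  form to \<open>\<omega>\<close>; since this is a ring homomorphism on coefficients, it specializes
  everything built from the form.\<close>

lemma map_universal:
  assumes "hom_form d \<omega>"
  shows "map_coeffs (peval (coords \<omega>)) (universal_form d $ i) = \<omega> $ i"
proof (rule poly_mapping_eqI)
  fix m
  have "mdeg m \<noteq> d + 1 \<Longrightarrow> lookup (\<omega> $ i) m = 0"
    using assms homogD unfolding hom_form_def by blast
  then show "lookup (map_coeffs (peval (coords \<omega>)) (universal_form d $ i)) m = lookup (\<omega> $ i) m"
    by (auto simp: peval_hom.lookup_map_coeffs lookup_universal peval_simps coords_def)
qed

lemma map_contract_universal:
  assumes "hom_form d \<omega>"
  shows "peval (coords \<omega>) (lookup (contract (universal_form d)) m) = lookup (contract \<omega>) m"
proof -
  have "map_coeffs (peval (coords \<omega>)) (contract (universal_form d)) = contract \<omega>"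
    unfolding contract_def peval_hom.map_coeffs_simps map_universal[OF assms] ..
  then show ?thesis using peval_hom.lookup_map_coeffs by metis
qed

lemma map_wedge_universal:
  assumes "hom_form d \<omega>"
  shows "peval (coords \<omega>) (lookup (wedge_d (universal_form d) i j k) m) = lookup (wedge_d \<omega> i j k) m"
proof -
  have "map_coeffs (peval (coords \<omega>)) (wedge_d (universal_form d) i j k) = wedge_d \<omega> i j k"
    unfolding wedge_d_def peval_hom.map_coeffs_simps peval_hom.pdiff_map_coeffs[symmetric]
      map_universal[OF assms] ..
  then show ?thesis using peval_hom.lookup_map_coeffs by metis
qed

lemma foliation_equations_vanish:
  assumes "hom_form d \<omega>"
  shows "(\<forall>g\<in>foliation_equations d. peval (coords \<omega>) g = 0) \<longleftrightarrow> contract \<omega> = 0 \<and> integrable_form \<omega>"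
proof -
  have "(\<forall>g\<in>foliation_equations d. peval (coords \<omega>) g = 0) \<longleftrightarrow>
    (\<forall>m. lookup (contract \<omega>) m = 0) \<and> (\<forall>i j k m. lookup (wedge_d \<omega> i j k) m = 0)"
    unfolding foliation_equations_def map_contract_universal[OF assms, symmetric]
      map_wedge_universal[OF assms, symmetric] by blast
  also have "\<dots> \<longleftrightarrow> contract \<omega> = 0 \<and> integrable_form \<omega>"
    by (simp add: integrable_form_def poly_mapping_eq_iff fun_eq_iff)
  finally show ?thesis .
qed

subsection \<open>The homogeneous ideal of the equations\<close>

lemma coord_formsD: "f \<in> coord_forms d k \<Longrightarrow> f \<in> polys (coord_vars d)" "f \<in> coord_forms d k \<Longrightarrow> homog k f"
  by (simp_all add: coord_forms_def coord_ring_polys)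

lemma coord_formsI: "f \<in> polys (coord_vars d) \<Longrightarrow> homog k f \<Longrightarrow> f \<in> coord_forms d k"
  by (simp add: coord_forms_def coord_ring_polys)

lemma coord_forms_0: "0 \<in> coord_forms d k"
  by (intro coord_formsI) simp_all

lemma coord_forms_1: "1 \<in> coord_forms d 0"
  by (intro coord_formsI) simp_all

lemma coord_forms_add: "f \<in> coord_forms d k \<Longrightarrow> g \<in> coord_forms d k \<Longrightarrow> f + g \<in> coord_forms d k"
  by (intro coord_formsI polys_add homog_add) (auto dest: coord_formsD)

lemma coord_forms_diff: "f \<in> coord_forms d k \<Longrightarrow> g \<in> coord_forms d k \<Longrightarrow> f - g \<in> coord_forms d k"
  by (intro coord_formsI polys_diff homog_diff) (auto dest: coord_formsD)

lemma coord_forms_sum: "(\<And>i. i \<in> A \<Longrightarrow> f i \<in> coord_forms d k) \<Longrightarrow> sum f A \<in> coord_forms d k"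
  by (induction A rule: infinite_finite_induct) (simp_all add: coord_forms_0 coord_forms_add)

lemma coord_forms_mult: "f \<in> coord_forms d j \<Longrightarrow> g \<in> coord_forms d k \<Longrightarrow> f * g \<in> coord_forms d (j + k)"
  by (intro coord_formsI polys_mult homog_mult) (auto dest: coord_formsD)

lemma coord_forms_of_nat: "of_nat n \<in> coord_forms d 0"
  by (induction n) (simp_all add: coord_forms_0 coord_forms_1 coord_forms_add del: of_nat_Suc, simp add: coord_forms_1 coord_forms_add)

definition coeffs_in :: "'a set \<Rightarrow> ('n, 'a::comm_ring_1) mpoly \<Rightarrow> bool" where
  "coeffs_in A p \<longleftrightarrow> (\<forall>m. lookup p m \<in> A)"

lemma coeffs_in_mult:
  fixes p q :: "('n::finite, 'n coord_poly) mpoly"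
  shows "coeffs_in (coord_forms d j) p \<Longrightarrow> coeffs_in (coord_forms d k) q \<Longrightarrow> coeffs_in (coord_forms d (j + k)) (p * q)"
  unfolding coeffs_in_def lookup_mult_divisors
  by (intro allI coord_forms_sum coord_forms_mult) auto

lemma coeffs_in_add: "coeffs_in (coord_forms d k) p \<Longrightarrow> coeffs_in (coord_forms d k) q \<Longrightarrow> coeffs_in (coord_forms d k) (p + q)"
  by (simp add: coeffs_in_def lookup_add coord_forms_add)

lemma coeffs_in_diff: "coeffs_in (coord_forms d k) p \<Longrightarrow> coeffs_in (coord_forms d k) q \<Longrightarrow> coeffs_in (coord_forms d k) (p - q)"
  by (simp add: coeffs_in_def lookup_minus coord_forms_diff)

lemma coeffs_in_sum: "(\<And>i. i \<in> A \<Longrightarrow> coeffs_in (coord_forms d k) (f i)) \<Longrightarrow> coeffs_in (coord_forms d k) (sum f A)"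
  by (simp add: coeffs_in_def lookup_sum coord_forms_sum)

lemma coeffs_in_pdiff: "coeffs_in (coord_forms d k) p \<Longrightarrow> coeffs_in (coord_forms d k) (pdiff v p)"
proof -
  have "of_nat n * f \<in> coord_forms d k" if "f \<in> coord_forms d k" for n f
    using coord_forms_mult[OF coord_forms_of_nat that, of n] by simp
  then show "coeffs_in (coord_forms d k) p \<Longrightarrow> coeffs_in (coord_forms d k) (pdiff v p)"
    unfolding coeffs_in_def lookup_pdiff by blast
qed

lemma coeffs_in_universal: "coeffs_in (coord_forms d 1) (universal_form d $ i)"
  unfolding coeffs_in_def lookup_universal
proof
  fix m show "(if mdeg m = d + 1 then Var (i, m) else 0) \<in> coord_forms d 1"
    by (cases "mdeg m = d + 1")
       (auto intro: coord_forms_0 coord_formsI homog_Var simp: coord_vars_def simp del: One_nat_def)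
qed

lemma coeffs_in_Var: "coeffs_in (coord_forms d 0) (Var i)"
  by (simp add: coeffs_in_def Var_def lookup_single when_def coord_forms_0 coord_forms_1)

lemma foliation_equations_forms:
  assumes "g \<in> foliation_equations d"
  shows "\<exists>k. g \<in> coord_forms d k"
proof -
  have "coeffs_in (coord_forms d (1 + 0)) (contract (universal_form d :: ('a, 'a coord_poly) form1))"
    unfolding contract_def by (intro coeffs_in_sum coeffs_in_mult coeffs_in_universal coeffs_in_Var)
  moreover have "coeffs_in (coord_forms d (1 + 1)) (wedge_d (universal_form d :: ('a, 'a coord_poly) form1) i j k)" for i j k
    unfolding wedge_d_def
    by (intro coeffs_in_add coeffs_in_diff coeffs_in_mult coeffs_in_universal coeffs_in_pdiff)
  ultimately show ?thesis
    using assms unfolding foliation_equations_def coeffs_in_def by blast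
qed

lemma foliation_ideal_ideal: "ideal_of (polys (coord_vars d)) (foliation_ideal d :: 'n::finite coord_poly set)"
  unfolding foliation_ideal_def coord_ring_polys
  by (rule ideal_generated_ideal[OF polys_subring]) (use foliation_equations_forms coord_formsD in blast)

lemma polys_homog_component: "p \<in> polys V \<Longrightarrow> homog_component k p \<in> polys V"
  using keys_homog_component unfolding polys_def by blast

text \<open>The equations \<open>contract \<omega> = 0\<close> and \<open>\<omega> \<and> d\<omega>
  = 0\<close> are homogeneous of degrees one and two in the coefficients of
  \<open>\<omega>\<close>.\<close>

lemma homog_component_foliation_ideal:
  assumes "f \<in> foliation_ideal d"
  shows "homog_component k f \<in> foliation_ideal d"
proof -
  obtain B s where B: "f = (\<Sum>g\<in>B. s g * g)" "B \<subseteq> foliation_equations d" "s ` B \<subseteq> polys (coord_vars d)"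
    using assms unfolding foliation_ideal_def ideal_generated_def coord_ring_polys by blast
  have "homog_component k (s g * g) \<in> foliation_ideal d" if g: "g \<in> B" for g
  proof -
    obtain j where j: "g \<in> coord_forms d j" using foliation_equations_forms B(2) g by blast
    have gI: "g \<in> foliation_ideal d"
      unfolding foliation_ideal_def coord_ring_polys
      by (rule ideal_generated_incl[OF polys_subring]) (use B(2) g in auto)
    show ?thesis
    proof (cases "k < j")
      case True
      then show ?thesis
        using homog_component_mult_homog_low[OF coord_formsD(2)[OF j]] ideal_ofD(2)[OF foliation_ideal_ideal] by simp
    next
      case False
      then obtain i where "k = i + j" by (metis add.commute le_Suc_ex linorder_not_less)
      then have "homog_component k (s g * g) = homog_component i (s g) * g"
        using homog_component_mult_homog[OF coord_formsD(2)[OF j]] by simp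
      also have "\<dots> \<in> foliation_ideal d"
        by (rule ideal_ofD(4)[OF foliation_ideal_ideal polys_homog_component gI]) (use B(3) g in auto)
      finally show ?thesis .
    qed
  qed
  then show ?thesis unfolding B(1) homog_component_sum by (intro ideal_of_sum[OF foliation_ideal_ideal])
qed

text \<open>Since the ideal is homogeneous, a denominator may be replaced by one of its
  components.\<close>

lemma homogeneous_denominator:
  assumes h: "h \<in> polys (coord_vars d)" "peval e h \<noteq> 0" "h * f \<in> foliation_ideal d" and f: "f \<in> coord_forms d k"
  shows "\<exists>h' j. h' \<in> coord_forms d j \<and> peval e h' \<noteq> 0 \<and> h' * f \<in> foliation_ideal d"
proof -
  obtain n where n: "h = (\<Sum>j<n. homog_component j h)" using sum_homog_component by blast
  have "(\<Sum>j<n. peval e (homog_component j h)) \<noteq> 0"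
    using h(2) unfolding id_hom.eval_sum[symmetric] n[symmetric] .
  then obtain j where j: "peval e (homog_component j h) \<noteq> 0" by (meson sum.not_neutral_contains_not_neutral)
  have "homog_component j h * f = homog_component (j + k) (h * f)"
    using homog_component_mult_homog[OF coord_formsD(2)[OF f]] by simp
  also have "\<dots> \<in> foliation_ideal d" by (rule homog_component_foliation_ideal[OF h(3)])
  finally have "homog_component j h * f \<in> foliation_ideal d" .
  moreover have "homog_component j h \<in> coord_forms d j" using polys_homog_component[OF h(1)] by (intro coord_formsI) simp_all
  ultimately show ?thesis using j by blast
qed

subsection \<open>The Zariski topology\<close>

lemma coords_scale: "coords (Const c *s \<omega>) v = c * coords \<omega> v"
  by (cases v) (simp add: coords_def lookup_Const_mult)

lemma peval_coords_scale: "f \<in> coord_forms d k \<Longrightarrow> peval (coords (Const c *s \<omega>)) f = c ^ k * peval (coords \<omega>) f"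
  using peval_scale[OF coord_formsD(2), of f d k c "coords \<omega>"] unfolding coords_scale[abs_def, symmetric]
  by (simp add: coords_scale)

lemma proj_pt_self: "\<omega> \<in> proj_pt \<omega>"
proof -
  have "\<omega> = Const 1 *s \<omega>" by (simp add: vec_eq_iff)
  then show ?thesis unfolding proj_pt_def by blast
qed

lemma proj_pt_eqD:
  assumes "proj_pt \<omega> = proj_pt \<omega>'"
  shows "\<exists>c. \<omega> = Const c *s \<omega>'"
proof -
  have "\<omega> \<in> proj_pt \<omega>'" using proj_pt_self[of \<omega>] assms by simp
  then show ?thesis by (auto simp: proj_pt_def)
qed

lemma Const_smult_zero [simp]: "Const 0 *s \<omega> = 0"
  by (simp add: vec_eq_iff)

lemma proj_pt_scale:
  assumes "c \<noteq> 0"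
  shows "proj_pt (Const c *s \<omega>) = proj_pt \<omega>"
proof -
  have 1: "Const b *s (Const a *s \<omega>) = Const (b * a) *s \<omega>" for a b
    by (simp add: Const_mult)
  have "Const b *s \<omega> = Const (b / c) *s (Const c *s \<omega>)" for b 
    using assms by (simp add: Const_mult[symmetric])
  then show ?thesis unfolding proj_pt_def using 1 by blast
qed

lemma twisted_scale: "\<omega> \<in> twisted_forms d \<Longrightarrow> Const c *s \<omega> \<in> twisted_forms d"
proof -
  assume a: "\<omega> \<in> twisted_forms d"
  have "homog (0 + (d + 1)) (Const c * \<omega> $ i)" for i
    using a by (intro homog_mult) (simp_all add: twisted_forms_def)
  moreover have "contract (Const c *s \<omega>) = Const c * contract \<omega>"
    by (simp add: contract_def sum_distrib_left mult.assoc)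
  ultimately show ?thesis using a by (simp add: twisted_forms_def)
qed

definition proj_space :: "nat \<Rightarrow> ('n::finite, complex) form1 set set" where
  "proj_space d = {proj_pt \<omega> | \<omega>. \<omega> \<in> twisted_forms d \<and> \<omega> \<noteq> 0}"

lemma basic_open_iff:
  assumes f: "f \<in> coord_forms d k" and \<omega>: "\<omega> \<in> twisted_forms d" "\<omega> \<noteq> 0"
  shows "proj_pt \<omega> \<in> basic_open d f \<longleftrightarrow> peval (coords \<omega>) f \<noteq> 0"
proof
  assume "proj_pt \<omega> \<in> basic_open d f"
  then obtain \<omega>' where w: "proj_pt \<omega> = proj_pt \<omega>'" "peval (coords \<omega>') f \<noteq> 0"
    by (auto simp: basic_open_def)
  obtain c where c: "\<omega> = Const c *s \<omega>'" using proj_pt_eqD[OF w(1)] by blast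
  then have "c \<noteq> 0" using \<omega>(2) by auto
  then show "peval (coords \<omega>) f \<noteq> 0" using w(2) unfolding c peval_coords_scale[OF f] by simp
next
  assume "peval (coords \<omega>) f \<noteq> 0"
  then show "proj_pt \<omega> \<in> basic_open d f" using \<omega> unfolding basic_open_def by blast
qed

lemma basic_open_subset: "basic_open d f \<subseteq> proj_space d"
  by (auto simp: basic_open_def proj_space_def)

lemma basic_open_mult:
  assumes f: "f \<in> coord_forms d j" and g: "g \<in> coord_forms d k"
  shows "basic_open d (f * g) = basic_open d f \<inter> basic_open d g"
proof -
  have "proj_pt \<omega> \<in> basic_open d (f * g) \<longleftrightarrow> proj_pt \<omega> \<in> basic_open d f \<inter> basic_open d g"
    if "\<omega> \<in> twisted_forms d" "\<omega> \<noteq> 0" for \<omega>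
    using basic_open_iff[OF f that] basic_open_iff[OF g that] basic_open_iff[OF coord_forms_mult[OF f g] that]
    by (simp add: peval_simps)
  then have "x \<in> basic_open d (f * g) \<longleftrightarrow> x \<in> basic_open d f \<inter> basic_open d g" if "x \<in> proj_space d" for x
    using that unfolding proj_space_def by blast
  then show ?thesis using basic_open_subset by blast
qed

lemma topspace_zariski: "topspace (zariski d) = proj_space d"
proof -
  have "proj_space d = basic_open d 1"
    by (auto simp: proj_space_def basic_open_def peval_simps)
  then have "proj_space d \<in> {basic_open d f |f k. f \<in> coord_forms d k}" using coord_forms_1 by blast
  then show ?thesis unfolding zariski_def topology_generated_by_topspace
    using basic_open_subset by blast
qed

lemma openin_basic_open: "f \<in> coord_forms d k \<Longrightarrow> openin (zariski d) (basic_open d f)"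
  unfolding zariski_def by (rule topology_generated_by_Basis) blast

text \<open>Basic open sets are closed under intersection, by multiplying the forms that define
  them.\<close>

lemma zariski_base:
  assumes "openin (zariski d) U" "x \<in> U"
  shows "\<exists>f k. f \<in> coord_forms d k \<and> x \<in> basic_open d f \<and> basic_open d f \<subseteq> U"
proof -
  have "generate_topology_on {basic_open d f |f k. f \<in> coord_forms d k} U"
    using assms(1) unfolding zariski_def by (simp add: openin_topology_generated_by_iff)
  then show ?thesis using assms(2)
  proof (induction)
    case (Int a b)
    then obtain f j g k where f: "f \<in> coord_forms d j" "x \<in> basic_open d f" "basic_open d f \<subseteq> a"
      and g: "g \<in> coord_forms d k" "x \<in> basic_open d g" "basic_open d g \<subseteq> b" by blast
    have "x \<in> basic_open d (f * g)" "basic_open d (f * g) \<subseteq> a \<inter> b"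
      using basic_open_mult[OF f(1) g(1)] f g by auto
    then show ?case using coord_forms_mult[OF f(1) g(1)] by blast
  next
    case (UN K)
    then obtain k where "k \<in> K" "x \<in> k" by blast
    with UN.IH[OF this] show ?case by blast
  next
    case (Basis s)
    then show ?case by blast
  qed simp
qed

lemma closed_separation:
  assumes "closedin (zariski d) C" "x \<in> proj_space d" "x \<notin> C"
  shows "\<exists>f k. f \<in> coord_forms d k \<and> x \<in> basic_open d f \<and> basic_open d f \<inter> C = {}"
proof -
  have "openin (zariski d) (proj_space d - C)" "x \<in> proj_space d - C"
    using assms by (auto simp: closedin_def topspace_zariski)
  from zariski_base[OF this] show ?thesis by blast
qed

section \<open>Infinitesimally rigid foliations\<close>

subsection \<open>Orbits\<close>

abbreviation pull :: "complex ^ 'n ^ 'n \<Rightarrow> ('n::finite, complex) form1 \<Rightarrow> ('n, complex) form1" where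
  "pull g \<equiv> pullback (linear_map g)"

definition vanishes_on_orbit :: "('n::finite, complex) form1 \<Rightarrow> 'n coord_poly \<Rightarrow> bool" where
  "vanishes_on_orbit \<eta> f \<longleftrightarrow> (\<forall>g. invertible g \<longrightarrow> peval (coords (pull g \<eta>)) f = 0)"

lemma invertible_id: "invertible (mat 1 :: complex ^ 'n::finite ^ 'n)"
  unfolding invertible_def by (intro exI[of _ "mat 1"]) simp

lemma vanishes_self: "vanishes_on_orbit \<eta> f \<Longrightarrow> peval (coords \<eta>) f = 0"
  unfolding vanishes_on_orbit_def using pullback_id[of \<eta>] invertible_id by metis

lemma det_line_poly:
  fixes a b :: "complex ^ 'n ^ 'n"
  shows "\<exists>q. \<forall>t. det (line_mat b a t) = poly q t"
  unfolding det_def line_mat_nth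
proof (rule poly_fun_sum, rule poly_fun_mult)
  fix p :: "'n \<Rightarrow> 'n"
  show "\<exists>q. \<forall>t. of_int (sign p) = poly q (t :: complex)" by (rule exI[of _ "[:of_int (sign p):]"]) simp
  have "\<forall>t. (\<Prod>i\<in>UNIV. b $ i $ p i + t * a $ i $ p i) = poly (\<Prod>i\<in>UNIV. [:b $ i $ p i, a $ i $ p i:]) t"
    by (simp add: poly_prod)
  then show "\<exists>q. \<forall>t. (\<Prod>i\<in>UNIV. b $ i $ p i + t * a $ i $ p i) = poly q t" by blast
qed

lemma coords_line_poly: "\<exists>q. \<forall>t. peval (coords (pull (line_mat b a t) \<eta>)) f = poly q t"
proof (rule poly_family_peval)
  fix v :: "'a \<times> 'a monomial"
  show "\<exists>q. \<forall>t. coords (pull (line_mat b a t) \<eta>) v = poly q t"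
    using pullback_poly_family[of b a \<eta> "fst v"] unfolding poly_family_def coords_def
    by (cases v) simp
qed

text \<open>The orbit is irreducible because any two points of the general linear group lie on an
  affine line that meets the group in the complement of a finite set.\<close>

lemma orbit_prime:
  assumes "\<not> vanishes_on_orbit \<eta> f1" "\<not> vanishes_on_orbit \<eta> f2"
  shows "\<exists>g. invertible g \<and> peval (coords (pull g \<eta>)) f1 \<noteq> 0 \<and> peval (coords (pull g \<eta>)) f2 \<noteq> 0"
proof -
  obtain g1 where g1: "invertible g1" "peval (coords (pull g1 \<eta>)) f1 \<noteq> 0"
    using assms(1) by (auto simp: vanishes_on_orbit_def)
  obtain g2 where g2: "invertible g2" "peval (coords (pull g2 \<eta>)) f2 \<noteq> 0"
    using assms(2) by (auto simp: vanishes_on_orbit_def)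
  define l where "l t = line_mat g1 (g2 - g1) t" for t
  have l: "l 0 = g1" "l 1 = g2" by (simp_all add: l_def vec_eq_iff)
  obtain q1 where q1: "\<forall>t. peval (coords (pull (l t) \<eta>)) f1 = poly q1 t" unfolding l_def using coords_line_poly by blast
  obtain q2 where q2: "\<forall>t. peval (coords (pull (l t) \<eta>)) f2 = poly q2 t" unfolding l_def using coords_line_poly by blast
  obtain q3 where q3: "\<forall>t. det (l t) = poly q3 t" unfolding l_def using det_line_poly by blast
  have "poly q1 0 \<noteq> 0" "poly q2 1 \<noteq> 0" "poly q3 0 \<noteq> 0"
    using q1 q2 q3 g1 g2 l invertible_det_nz by metis+
  then have "q1 * q2 * q3 \<noteq> 0" by auto
  then have "finite {t. poly (q1 * q2 * q3) t = 0}" by (rule poly_roots_finite)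
  then have "\<exists>t. t \<notin> {t. poly (q1 * q2 * q3) t = 0}" using infinite_UNIV_char_0 ex_new_if_finite by blast
  then obtain t where "poly q1 t \<noteq> 0" "poly q2 t \<noteq> 0" "poly q3 t \<noteq> 0" by auto
  then have "invertible (l t)" "peval (coords (pull (l t) \<eta>)) f1 \<noteq> 0" "peval (coords (pull (l t) \<eta>)) f2 \<noteq> 0"
    using q1 q2 q3 invertible_det_nz by metis+
  then show ?thesis by blast
qed

locale twisted_form =
  fixes d :: nat and \<eta> :: "('n::finite, complex) form1"
  assumes twisted: "\<eta> \<in> twisted_forms d" and nonzero: "\<eta> \<noteq> 0" and integrable: "integrable_form \<eta>"
begin

lemma pull_props:
  assumes "invertible g"
  shows "pull g \<eta> \<in> twisted_forms d" "pull g \<eta> \<noteq> 0" "integrable_form (pull g \<eta>)" "proj_pt (pull g \<eta>) \<in> proj_space d"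
  using twisted_pullback[OF twisted] pullback_invertible_nonzero[OF assms nonzero] integrable_pullback[OF integrable]
  by (auto simp: proj_space_def)

lemma orbit_subset: "orbit \<eta> \<subseteq> proj_space d"
  using pull_props by (auto simp: orbit_def)

abbreviation "E \<equiv> zariski d closure_of orbit \<eta>"

lemma orbit_in_closure: "orbit \<eta> \<subseteq> E"
  by (rule closure_of_subset) (simp add: topspace_zariski orbit_subset)

lemma pull_in_closure: "invertible g \<Longrightarrow> proj_pt (pull g \<eta>) \<in> E"
  using orbit_in_closure by (auto simp: orbit_def)

lemma self_in_closure: "proj_pt \<eta> \<in> E"
  using pull_in_closure[OF invertible_id] by (simp add: pullback_id)

lemma in_closure_iff:
  assumes \<omega>: "\<omega> \<in> twisted_forms d" "\<omega> \<noteq> 0"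
  shows "proj_pt \<omega> \<in> E \<longleftrightarrow> (\<forall>f k. f \<in> coord_forms d k \<and> vanishes_on_orbit \<eta> f \<longrightarrow> peval (coords \<omega>) f = 0)"
proof (intro iffI allI impI)
  fix f k assume x: "proj_pt \<omega> \<in> E" and f: "f \<in> coord_forms d k \<and> vanishes_on_orbit \<eta> f"
  show "peval (coords \<omega>) f = 0"
  proof (rule ccontr)
    assume "peval (coords \<omega>) f \<noteq> 0"
    then have "proj_pt \<omega> \<in> basic_open d f" using basic_open_iff[of f d k \<omega>] \<omega> f by blast
    then obtain y where y: "y \<in> orbit \<eta>" "y \<in> basic_open d f"
      using x openin_basic_open[of f d k] f unfolding in_closure_of by blast
    then obtain g where g: "y = proj_pt (pull g \<eta>)" "invertible g" by (auto simp: orbit_def)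
    then have "peval (coords (pull g \<eta>)) f \<noteq> 0"
      using basic_open_iff[of f d k "pull g \<eta>"] pull_props[OF g(2)] f y(2) by blast
    then show False using f g(2) by (simp add: vanishes_on_orbit_def)
  qed
next
  assume v: "\<forall>f k. f \<in> coord_forms d k \<and> vanishes_on_orbit \<eta> f \<longrightarrow> peval (coords \<omega>) f = 0"
  show "proj_pt \<omega> \<in> E"
  proof (rule ccontr)
    assume "proj_pt \<omega> \<notin> E"
    moreover have "proj_pt \<omega> \<in> proj_space d" using \<omega> by (auto simp: proj_space_def)
    ultimately obtain f k where f: "f \<in> coord_forms d k" "proj_pt \<omega> \<in> basic_open d f" "basic_open d f \<inter> E = {}"
      using closed_separation[OF closedin_closure_of] by blast
    have "vanishes_on_orbit \<eta> f"
      unfolding vanishes_on_orbit_def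
    proof (intro allI impI)
      fix g :: "complex ^ 'n ^ 'n" assume g: "invertible g"
      then have "proj_pt (pull g \<eta>) \<notin> basic_open d f" using f(3) pull_in_closure by blast
      then show "peval (coords (pull g \<eta>)) f = 0" using basic_open_iff[OF f(1)] pull_props[OF g] by blast
    qed
    then have "peval (coords \<omega>) f = 0" using v f(1) by blast
    then show False using f(2) basic_open_iff[OF f(1) \<omega>] by blast
  qed
qed

lemma closure_subset: "E \<subseteq> proj_space d"
  using closure_of_subset_topspace[of "zariski d"] by (simp add: topspace_zariski)

lemma vanishing_ideal_iff:
  assumes f: "f \<in> coord_forms d k"
  shows "f \<in> vanishing_ideal d E \<longleftrightarrow> vanishes_on_orbit \<eta> f"
proof
  assume "f \<in> vanishing_ideal d E"
  then show "vanishes_on_orbit \<eta> f"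
    using pull_props pull_in_closure unfolding vanishing_ideal_def vanishes_on_orbit_def by blast
next
  assume v: "vanishes_on_orbit \<eta> f"
  have "peval (coords \<omega>) f = 0" if w: "\<omega> \<noteq> 0" "proj_pt \<omega> \<in> E" for \<omega>
  proof -
    obtain \<omega>' where w': "proj_pt \<omega> = proj_pt \<omega>'" "\<omega>' \<in> twisted_forms d"
      using w(2) closure_subset by (auto simp: proj_space_def)
    obtain c where "\<omega> = Const c *s \<omega>'" using proj_pt_eqD[OF w'(1)] by blast
    then have "\<omega> \<in> twisted_forms d" using twisted_scale[OF w'(2)] by simp
    then show ?thesis using in_closure_iff[of \<omega>] w v f by blast
  qed
  then show "f \<in> vanishing_ideal d E"
    using f by (auto simp: vanishing_ideal_def coord_forms_def)
qed

lemma foliation_ideal_vanishes: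
  assumes "f \<in> foliation_ideal d" "\<omega> \<in> twisted_forms d" "integrable_form \<omega>"
  shows "peval (coords \<omega>) f = 0"
proof -
  obtain B s where B: "f = (\<Sum>g\<in>B. s g * g)" "B \<subseteq> foliation_equations d"
    using assms(1) unfolding foliation_ideal_def ideal_generated_def by blast
  have "\<forall>g\<in>foliation_equations d. peval (coords \<omega>) g = 0"
    using foliation_equations_vanish[of d \<omega>] assms(2,3) by (simp add: twisted_forms_iff)
  then have "peval (coords \<omega>) g = 0" if "g \<in> B" for g using that B(2) by blast
  then show ?thesis by (simp add: B(1) peval_simps)
qed

lemma foliation_ideal_vanishes_orbit: "f \<in> foliation_ideal d \<Longrightarrow> vanishes_on_orbit \<eta> f"
  using foliation_ideal_vanishes pull_props unfolding vanishes_on_orbit_def by blast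

lemma closure_foliations: "E \<subseteq> foliations d"
proof
  fix x assume x: "x \<in> E"
  then obtain \<omega> where \<omega>: "x = proj_pt \<omega>" "\<omega> \<in> twisted_forms d" "\<omega> \<noteq> 0"
    using closure_subset by (auto simp: proj_space_def)
  have "peval (coords \<omega>) g = 0" if g: "g \<in> foliation_equations d" for g
  proof -
    obtain k where k: "g \<in> coord_forms d k" using foliation_equations_forms[OF g] by blast
    have "g \<in> foliation_ideal d" unfolding foliation_ideal_def coord_ring_polys
      by (rule ideal_generated_incl[OF polys_subring g])
    then have "vanishes_on_orbit \<eta> g" by (rule foliation_ideal_vanishes_orbit)
    then show ?thesis using in_closure_iff[OF \<omega>(2,3)] x k unfolding \<omega>(1) by blast
  qed
  then have "integrable_form \<omega>"
    using foliation_equations_vanish[of d \<omega>] \<omega>(2) by (simp add: twisted_forms_iff)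
  then show "x \<in> foliations d" using \<omega> unfolding foliations_def by blast
qed

lemma foliations_subset: "foliations d \<subseteq> proj_space d"
  by (auto simp: foliations_def proj_space_def)

lemma topspace_foliations: "topspace (subtopology (zariski d) (foliations d)) = foliations d"
  using foliations_subset by (auto simp: topspace_zariski)

lemma closedin_zero_set:
  assumes "f \<in> coord_forms d k"
  shows "closedin (subtopology (zariski d) (foliations d)) (foliations d - basic_open d f)"
proof -
  have "closedin (zariski d) (topspace (zariski d) - basic_open d f)"
    using openin_basic_open[OF assms] by (rule closedin_diff[OF closedin_topspace])
  moreover have "foliations d - basic_open d f = (topspace (zariski d) - basic_open d f) \<inter> foliations d"
    using foliations_subset by (auto simp: topspace_zariski)
  ultimately show ?thesis unfolding closedin_subtopology by blast
qed

lemma closure_irreducible: "irreducible_in (subtopology (zariski d) (foliations d)) E"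
  unfolding irreducible_in_def topspace_foliations
proof (intro conjI allI impI)
  show "E \<subseteq> foliations d" by (rule closure_foliations)
  show "E \<noteq> {}" using self_in_closure by blast
  fix A B
  assume AB: "closedin (subtopology (zariski d) (foliations d)) A \<and>
    closedin (subtopology (zariski d) (foliations d)) B \<and> E \<subseteq> A \<union> B"
  then obtain A' B' where A: "closedin (zariski d) A'" "A = A' \<inter> foliations d"
    and B: "closedin (zariski d) B'" "B = B' \<inter> foliations d"
    unfolding closedin_subtopology by blast
  have sep: "\<exists>f k. f \<in> coord_forms d k \<and> \<not> vanishes_on_orbit \<eta> f \<and> basic_open d f \<inter> C = {}"
    if C: "closedin (zariski d) C" "\<not> E \<subseteq> C \<inter> foliations d" for C
  proof -
    have "\<not> orbit \<eta> \<subseteq> C"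
      using closure_of_minimal[OF _ C(1)] C(2) closure_foliations by blast
    then obtain g where g: "invertible g" "proj_pt (pull g \<eta>) \<notin> C" by (auto simp: orbit_def)
    obtain f k where f: "f \<in> coord_forms d k" "proj_pt (pull g \<eta>) \<in> basic_open d f" "basic_open d f \<inter> C = {}"
      using closed_separation[OF C(1) pull_props(4)[OF g(1)] g(2)] by blast
    have "peval (coords (pull g \<eta>)) f \<noteq> 0"
      using basic_open_iff[OF f(1)] pull_props[OF g(1)] f(2) by blast
    then show ?thesis using f g(1) unfolding vanishes_on_orbit_def by blast
  qed
  show "E \<subseteq> A \<or> E \<subseteq> B"
  proof (rule ccontr)
    assume n: "\<not> (E \<subseteq> A \<or> E \<subseteq> B)"
    obtain f1 k1 where f1: "f1 \<in> coord_forms d k1" "\<not> vanishes_on_orbit \<eta> f1" "basic_open d f1 \<inter> A' = {}"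
      using sep[OF A(1)] n A(2) by blast
    obtain f2 k2 where f2: "f2 \<in> coord_forms d k2" "\<not> vanishes_on_orbit \<eta> f2" "basic_open d f2 \<inter> B' = {}"
      using sep[OF B(1)] n B(2) by blast
    obtain g where g: "invertible g" "peval (coords (pull g \<eta>)) f1 \<noteq> 0" "peval (coords (pull g \<eta>)) f2 \<noteq> 0"
      using orbit_prime[OF f1(2) f2(2)] by blast
    have "proj_pt (pull g \<eta>) \<in> basic_open d f1" "proj_pt (pull g \<eta>) \<in> basic_open d f2"
      using basic_open_iff[OF f1(1)] basic_open_iff[OF f2(1)] pull_props[OF g(1)] g(2,3) by blast+
    then have "proj_pt (pull g \<eta>) \<notin> A \<union> B" using f1(3) f2(3) A(2) B(2) by blast
    then show False using AB pull_in_closure[OF g(1)] by blast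
  qed
qed

end

subsection \<open>First order deformations\<close>

definition lin_wedge :: "('n::finite, complex) form1 \<Rightarrow> ('n, complex) form1 \<Rightarrow> 'n \<Rightarrow> 'n \<Rightarrow> 'n \<Rightarrow> ('n, complex) mpoly" where
  "lin_wedge \<eta> \<omega> i j k =
     \<eta> $ i * (pdiff j (\<omega> $ k) - pdiff k (\<omega> $ j)) + \<omega> $ i * (pdiff j (\<eta> $ k) - pdiff k (\<eta> $ j)) +
     \<eta> $ j * (pdiff k (\<omega> $ i) - pdiff i (\<omega> $ k)) + \<omega> $ j * (pdiff k (\<eta> $ i) - pdiff i (\<eta> $ k)) +
     \<eta> $ k * (pdiff i (\<omega> $ j) - pdiff j (\<omega> $ i)) + \<omega> $ k * (pdiff i (\<eta> $ j) - pdiff j (\<eta> $ i))"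

lemma wedge_d_perturb:
  "wedge_d (\<chi> i. \<eta> $ i + Const t * \<omega> $ i) i j k =
    wedge_d \<eta> i j k + Const t * lin_wedge \<eta> \<omega> i j k + Const (t * t) * wedge_d \<omega> i j k"
  by (simp add: wedge_d_def lin_wedge_def pdiff_add pdiff_mult Const_mult algebra_simps)

text \<open>The Zariski tangent space of the scheme of foliations at the form is the tangent space
  of its orbit under the linear group.\<close>

definition infinitesimally_rigid :: "nat \<Rightarrow> ('n::finite, complex) form1 \<Rightarrow> bool" where
  "infinitesimally_rigid d \<eta> \<longleftrightarrow>
    (\<forall>\<omega>. \<omega> \<in> twisted_forms d \<and> (\<forall>i j k. lin_wedge \<eta> \<omega> i j k = 0) \<longrightarrow> (\<exists>a. \<omega> = lie a \<eta>))"

definition form_of_coords :: "nat \<Rightarrow> ('n \<times> 'n monomial \<Rightarrow> complex) \<Rightarrow> ('n::finite, complex) form1" where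
  "form_of_coords d w = (\<chi> i. \<Sum>m\<in>{m. mdeg m = d + 1}. single m (w (i, m)))"

lemma lookup_form_of_coords:
  "lookup (form_of_coords d w $ i) m = (if mdeg m = d + 1 then w (i, m) else 0)"
proof -
  have "lookup (form_of_coords d w $ i) m = (\<Sum>n\<in>{n. mdeg n = d + 1}. if n = m then w (i, n) else 0)"
    by (simp add: form_of_coords_def lookup_sum lookup_single when_def)
  then show ?thesis using finite_mdeg[where 'n = 'a] by (simp add: sum.delta)
qed

lemma hom_form_of_coords: "hom_form d (form_of_coords d w)"
  unfolding hom_form_def by (auto intro!: homogI simp: lookup_form_of_coords split: if_splits)

context twisted_form
begin

sublocale point "coord_vars d :: ('n \<times> 'n monomial) set" "coords \<eta>"
  by standard (rule finite_coord_vars)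

text \<open>On the line through \<open>\<eta>\<close> in direction \<open>\<omega>\<close> the
  equations take the coefficients of \<open>contract\<close> and \<open>wedge_d\<close> of
  \<open>\<eta> + t \<omega>\<close> as values; the terms linear in \<open>t\<close> have to
  vanish.\<close>

lemma tangent_vector_deformation:
  assumes w: "\<And>l. l \<in> linear_parts (foliation_ideal d) \<Longrightarrow> (\<Sum>v\<in>coord_vars d. l v * w v) = 0"
  defines "\<omega> \<equiv> form_of_coords d w"
  shows "\<omega> \<in> twisted_forms d" "lin_wedge \<eta> \<omega> i j k = 0"
proof -
  have hom\<eta>: "hom_form d \<eta>" using twisted by (simp add: twisted_forms_iff)
  have hom\<omega>: "hom_form d \<omega>" unfolding \<omega>_def by (rule hom_form_of_coords)
  define \<eta>t where "\<eta>t t = (\<chi> i. \<eta> $ i + Const t * \<omega> $ i)" for t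
  have homt: "hom_form d (\<eta>t t)" for t
  proof -
    have "homog (0 + (d + 1)) (Const t * \<omega> $ i)" for i
      using hom\<omega> by (intro homog_mult) (simp_all add: hom_form_def)
    then show ?thesis using hom\<eta> by (simp add: hom_form_def \<eta>t_def homog_add)
  qed
  have line: "peval (\<lambda>v. coords \<eta> v + t * w v) g = peval (coords (\<eta>t t)) g" if "g \<in> polys (coord_vars d)" for g t
  proof (rule peval_cong_polys[OF that])
    fix v :: "'n \<times> 'n monomial" assume "v \<in> coord_vars d"
    then show "coords \<eta> v + t * w v = coords (\<eta>t t) v"
      by (cases v) (simp add: coord_vars_def coords_def \<eta>t_def lookup_add lookup_Const_mult \<omega>_def lookup_form_of_coords)
  qed
  have lim: "((\<lambda>t. peval (coords (\<eta>t t)) g / t) \<longlongrightarrow> 0) (at 0)" if g: "g \<in> foliation_equations d" for g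
  proof -
    have gI: "g \<in> foliation_ideal d" unfolding foliation_ideal_def coord_ring_polys
      by (rule ideal_generated_incl[OF polys_subring g])
    have gp: "g \<in> polys (coord_vars d)" by (rule ideal_ofD(1)[OF foliation_ideal_ideal gI])
    have "((\<lambda>t. peval (\<lambda>v. coords \<eta> v + t * w v) g / t) \<longlongrightarrow> 0) (at 0)"
      by (rule derivative_along_tangent[OF foliation_ideal_ideal gI _ w])
         (rule foliation_ideal_vanishes[OF gI twisted integrable])
    then show ?thesis by (simp only: line[OF gp])
  qed
  have "lookup (contract \<omega>) m = 0" for m
  proof -
    have c: "contract (\<eta>t t) = Const t * contract \<omega>" for t
      using twisted by (simp add: \<eta>t_def contract_def twisted_forms_def algebra_simps sum.distrib sum_distrib_left)
    have "((\<lambda>t. peval (coords (\<eta>t t)) (lookup (contract (universal_form d)) m) / t) \<longlongrightarrow> 0) (at 0)"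
      by (rule lim) (unfold foliation_equations_def, blast)
    then have "((\<lambda>t. t * lookup (contract \<omega>) m / t) \<longlongrightarrow> 0) (at 0)"
      unfolding map_contract_universal[OF homt] c lookup_Const_mult .
    moreover have "((\<lambda>t. t * lookup (contract \<omega>) m / t) \<longlongrightarrow> lookup (contract \<omega>) m) (at 0)"
      by (rule tendsto_eventually, rule eventually_mono[OF eventually_neq_at_within[of 0 0 UNIV]]) simp
    ultimately show ?thesis by (rule LIM_unique[symmetric])
  qed
  then have "contract \<omega> = 0" by (intro poly_mapping_eqI) simp
  then show "\<omega> \<in> twisted_forms d" using hom\<omega> by (simp add: twisted_forms_iff)
  have "lookup (lin_wedge \<eta> \<omega> i j k) m = 0" for m
  proof -
    let ?a = "lookup (lin_wedge \<eta> \<omega> i j k) m" and ?b = "lookup (wedge_d \<omega> i j k) m"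
    have c: "lookup (wedge_d (\<eta>t t) i j k) m = t * ?a + t * t * ?b" for t
      using integrable unfolding \<eta>t_def wedge_d_perturb by (simp add: lookup_add lookup_Const_mult integrable_form_def)
    have "((\<lambda>t. peval (coords (\<eta>t t)) (lookup (wedge_d (universal_form d) i j k) m) / t) \<longlongrightarrow> 0) (at 0)"
      by (rule lim) (unfold foliation_equations_def, blast)
    then have 1: "((\<lambda>t. (t * ?a + t * t * ?b) / t) \<longlongrightarrow> 0) (at 0)"
      unfolding map_wedge_universal[OF homt] c .
    have "((\<lambda>t. ?a + t * ?b) \<longlongrightarrow> ?a + 0 * ?b) (at 0)" by (intro tendsto_intros)
    moreover have "\<forall>\<^sub>F t in at 0. ?a + t * ?b = (t * ?a + t * t * ?b) / t"
      using eventually_neq_at_within[of 0 0 UNIV] by eventually_elim (simp add: field_simps)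
    ultimately have "((\<lambda>t. (t * ?a + t * t * ?b) / t) \<longlongrightarrow> ?a) (at 0)"
      using tendsto_cong by fastforce
    then show ?thesis using LIM_unique[OF 1] by simp
  qed
  then show "lin_wedge \<eta> \<omega> i j k = 0" by (intro poly_mapping_eqI) simp
qed

lemma orbit_curve:
  assumes "\<And>v. v \<in> coord_vars d \<Longrightarrow> w v = coords (lie a \<eta>) v"
  shows "curve_to (\<lambda>t. coords (pull (line_mat (mat 1) a t) \<eta>)) w"
  unfolding curve_to_def
proof (intro ballI conjI)
  fix v :: "'n \<times> 'n monomial" assume v: "v \<in> coord_vars d"
  show "coords (pull (line_mat (mat 1) a 0) \<eta>) v = coords \<eta> v" by (simp add: pullback_id)
  have "((\<lambda>t. lookup (pull (line_mat (mat 1) a t) \<eta> $ fst v) (snd v)) has_field_derivative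
      lookup (lie a \<eta> $ fst v) (snd v)) (at 0)"
    using pullback_has_coeff_derivative unfolding has_coeff_derivative_def by blast
  then show "((\<lambda>t. coords (pull (line_mat (mat 1) a t) \<eta>) v) has_field_derivative w v) (at 0)"
    unfolding assms[OF v] coords_def by (cases v) simp
qed

lemma eventually_invertible: "\<forall>\<^sub>F t in at 0. invertible (line_mat (mat 1) a t :: complex ^ 'n ^ 'n)"
proof -
  obtain q where q: "\<forall>t. det (line_mat (mat 1) a t :: complex ^ 'n ^ 'n) = poly q t" using det_line_poly by blast
  have "poly q 0 = 1" using q[rule_format, of 0] by (simp add: det_I)
  moreover have "isCont (poly q) 0" by (rule poly_isCont)
  then have "(poly q \<longlongrightarrow> poly q 0) (at 0)" by (simp add: isCont_def)
  ultimately have "\<forall>\<^sub>F t in at 0. poly q t \<noteq> 0"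
    by (intro tendsto_imp_eventually_ne[of "poly q" 1]) auto
  then show ?thesis by eventually_elim (simp add: invertible_det_nz q)
qed

text \<open>Rigidity turns every tangent vector into the velocity of the curve \<open>(1 + t
  a)\<^sup>*\<eta>\<close>, which stays in the orbit for small \<open>t\<close>, so the tangent
  space criterion applies.\<close>

lemma local_equation:
  assumes rigid: "infinitesimally_rigid d \<eta>" and f: "f \<in> coord_forms d k" "vanishes_on_orbit \<eta> f"
  shows "\<exists>h j. h \<in> coord_forms d j \<and> peval (coords \<eta>) h \<noteq> 0 \<and> h * f \<in> foliation_ideal d"
proof -
  have "\<exists>h\<in>polys (coord_vars d). peval (coords \<eta>) h \<noteq> 0 \<and> h * f \<in> foliation_ideal d"
  proof (rule tangent_criterion[OF foliation_ideal_ideal coord_formsD(1)[OF f(1)]])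
    fix w assume w: "\<And>l. l \<in> linear_parts (foliation_ideal d) \<Longrightarrow> (\<Sum>v\<in>coord_vars d. l v * w v) = 0"
    obtain a where a: "form_of_coords d w = lie a \<eta>"
      using rigid tangent_vector_deformation[OF w] unfolding infinitesimally_rigid_def by blast
    have c: "curve_to (\<lambda>t. coords (pull (line_mat (mat 1) a t) \<eta>)) w"
    proof (rule orbit_curve)
      fix v :: "'n \<times> 'n monomial" assume "v \<in> coord_vars d"
      then show "w v = coords (lie a \<eta>) v"
        unfolding a[symmetric] coords_def by (cases v) (simp add: lookup_form_of_coords coord_vars_def)
    qed
    have "\<forall>\<^sub>F t in at 0. peval (coords (pull (line_mat (mat 1) a t) \<eta>)) g = 0" if g: "g \<in> insert f (foliation_ideal d)" for g
    proof -
      have "vanishes_on_orbit \<eta> g" using g f(2) foliation_ideal_vanishes_orbit by blast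
      then show ?thesis using eventually_invertible[of a]
        by (auto simp: vanishes_on_orbit_def elim!: eventually_mono)
    qed
    then show "\<exists>\<gamma>. curve_to \<gamma> w \<and> (\<forall>g\<in>insert f (foliation_ideal d). \<forall>\<^sub>F t in at 0. peval (\<gamma> t) g = 0)"
      using c by blast
  qed
  then show ?thesis using homogeneous_denominator f(1) by blast
qed

text \<open>On an irreducible \<open>T\<close> containing the orbit closure the product \<open>h
  f\<close> of a local equation vanishes, while \<open>h\<close> does not vanish at
  \<open>\<eta>\<close>; so \<open>f\<close> vanishes on \<open>T\<close>.\<close>

theorem rigid_component:
  assumes rigid: "infinitesimally_rigid d \<eta>"
  shows "irreducible_component_of (subtopology (zariski d) (foliations d)) E"
  unfolding irreducible_component_of_def
proof (intro conjI allI impI closure_irreducible)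
  fix T assume T: "irreducible_in (subtopology (zariski d) (foliations d)) T \<and> E \<subseteq> T"
  have TF: "T \<subseteq> foliations d" using T unfolding irreducible_in_def topspace_foliations by blast
  have "T \<subseteq> E"
  proof
    fix x assume x: "x \<in> T"
    then obtain \<omega> where \<omega>: "x = proj_pt \<omega>" "\<omega> \<in> twisted_forms d" "\<omega> \<noteq> 0"
      using TF foliations_subset unfolding proj_space_def by blast
    have "peval (coords \<omega>) f = 0" if f: "f \<in> coord_forms d k" "vanishes_on_orbit \<eta> f" for f k
    proof -
      obtain h j where h: "h \<in> coord_forms d j" "peval (coords \<eta>) h \<noteq> 0" "h * f \<in> foliation_ideal d"
        using local_equation[OF rigid f] by blast
      have "T \<subseteq> (foliations d - basic_open d h) \<union> (foliations d - basic_open d f)"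
      proof
        fix y assume "y \<in> T"
        then have yF: "y \<in> foliations d" using TF by blast
        then obtain \<omega>' where w': "y = proj_pt \<omega>'" "\<omega>' \<in> twisted_forms d" "\<omega>' \<noteq> 0" "integrable_form \<omega>'"
          unfolding foliations_def by blast
        have "peval (coords \<omega>') (h * f) = 0" by (rule foliation_ideal_vanishes[OF h(3) w'(2,4)])
        then have "peval (coords \<omega>') h = 0 \<or> peval (coords \<omega>') f = 0" by (simp add: peval_simps)
        then show "y \<in> (foliations d - basic_open d h) \<union> (foliations d - basic_open d f)"
          using yF basic_open_iff[OF h(1) w'(2,3)] basic_open_iff[OF f(1) w'(2,3)] w'(1) by blast
      qed
      then have "T \<subseteq> foliations d - basic_open d h \<or> T \<subseteq> foliations d - basic_open d f"
        using T closedin_zero_set[OF h(1)] closedin_zero_set[OF f(1)] unfolding irreducible_in_def by blast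
      moreover have "\<not> T \<subseteq> foliations d - basic_open d h"
        using self_in_closure T basic_open_iff[OF h(1) twisted nonzero] h(2) by blast
      ultimately have "x \<notin> basic_open d f" using x by blast
      then show ?thesis using basic_open_iff[OF f(1) \<omega>(2,3)] \<omega>(1) by blast
    qed
    then show "x \<in> E" using in_closure_iff[OF \<omega>(2,3)] \<omega>(1) by blast
  qed
  then show "T = E" using T by blast
qed

text \<open>A nilpotent fraction has a numerator vanishing on the orbit, because the orbit is
  irreducible, and a local equation with such a numerator has its factor \<open>h\<close> outside
  the ideal of the orbit.\<close>

theorem rigid_reduced:
  assumes rigid: "infinitesimally_rigid d \<eta>"
  shows "reduced_at_generic_point d E"
  unfolding reduced_at_generic_point_def
proof (clarify)
  fix f g and n :: nat
  assume fg: "(f, g) \<in> stalk_fractions d E" and eq: "stalk_eq d E (f ^ n, g ^ n) (0, 1)"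
  obtain k where f: "f \<in> coord_forms d k" using fg unfolding stalk_fractions_def by blast
  obtain h j where h: "h \<in> coord_forms d j" "h \<notin> vanishing_ideal d E" "h * (f ^ n * 1 - 0 * g ^ n) \<in> foliation_ideal d"
    using eq unfolding stalk_eq_def by auto
  have "h * f ^ n \<in> foliation_ideal d" using h(3) by simp
  then have hf: "vanishes_on_orbit \<eta> (h * f ^ n)" by (rule foliation_ideal_vanishes_orbit)
  have "\<not> vanishes_on_orbit \<eta> h" using h vanishing_ideal_iff by blast
  have "vanishes_on_orbit \<eta> f"
  proof (rule ccontr)
    assume "\<not> vanishes_on_orbit \<eta> f"
    then obtain a where "invertible a" "peval (coords (pull a \<eta>)) h \<noteq> 0" "peval (coords (pull a \<eta>)) f \<noteq> 0"
      using orbit_prime \<open>\<not> vanishes_on_orbit \<eta> h\<close> by blast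
    then show False using hf unfolding vanishes_on_orbit_def peval_simps by fastforce
  qed
  then obtain h' i where h': "h' \<in> coord_forms d i" "peval (coords \<eta>) h' \<noteq> 0" "h' * f \<in> foliation_ideal d"
    using local_equation[OF rigid f] by blast
  have "h' \<notin> vanishing_ideal d E" using h'(2) vanishing_ideal_iff[OF h'(1)] vanishes_self by blast
  moreover have "h' * (f * 1 - 0 * g) \<in> foliation_ideal d" using h'(3) by simp
  ultimately show "stalk_eq d E (f, g) (0, 1)" unfolding stalk_eq_def using h'(1) by blast
qed

end

subsection \<open>Lie derivatives are first order deformations\<close>

lemma has_coeff_derivative_pdiff: "has_coeff_derivative F p \<Longrightarrow> has_coeff_derivative (\<lambda>t. pdiff v (F t)) (pdiff v p)"
  unfolding has_coeff_derivative_def lookup_pdiff by (intro allI DERIV_cmult) blast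

lemma has_coeff_derivative_diff: "has_coeff_derivative F p \<Longrightarrow> has_coeff_derivative G q \<Longrightarrow> has_coeff_derivative (\<lambda>t. F t - G t) (p - q)"
  unfolding has_coeff_derivative_def lookup_minus by (intro allI DERIV_diff) auto

lemma has_coeff_derivative_unique: "has_coeff_derivative F p \<Longrightarrow> has_coeff_derivative F q \<Longrightarrow> p = q"
  unfolding has_coeff_derivative_def by (rule poly_mapping_eqI) (blast intro: DERIV_unique)

text \<open>Differentiate the conditions that hold along the curve \<open>(1 + t
  a)\<^sup>*\<eta>\<close>.\<close>

lemma lie_deformation:
  assumes "\<eta> \<in> twisted_forms d" "integrable_form \<eta>"
  shows "lie a \<eta> \<in> twisted_forms d" "lin_wedge \<eta> (lie a \<eta>) i j k = 0"
proof -
  define F where "F i t = pull (line_mat (mat 1) a t) \<eta> $ i" for i t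
  have F0: "F i 0 = \<eta> $ i" for i by (simp add: F_def pullback_id)
  have F: "has_coeff_derivative (F i) (lie a \<eta> $ i)" for i
    unfolding F_def by (rule pullback_has_coeff_derivative)
  have tw: "pull (line_mat (mat 1) a t) \<eta> \<in> twisted_forms d" for t
    by (rule twisted_pullback[OF assms(1)])
  have "homog (d + 1) (lie a \<eta> $ i)" for i
  proof (rule homogI, rule ccontr)
    fix m assume m: "lookup (lie a \<eta> $ i) m \<noteq> 0" "mdeg m \<noteq> d + 1"
    have z: "lookup (F i t) m = 0" for t
      using tw[of t] homogD m(2) unfolding F_def twisted_forms_def by blast
    have "((\<lambda>t. lookup (F i t) m) has_field_derivative lookup (lie a \<eta> $ i) m) (at 0)"
      using F[of i] unfolding has_coeff_derivative_def by blast
    then have "((\<lambda>t. 0) has_field_derivative lookup (lie a \<eta> $ i) m) (at 0)"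
      unfolding z .
    then show False using m(1) DERIV_unique[OF _ DERIV_const] by blast
  qed
  moreover have "contract (lie a \<eta>) = 0"
  proof -
    have "has_coeff_derivative (\<lambda>t. \<Sum>i\<in>UNIV. F i t * Var i) (\<Sum>i\<in>UNIV. lie a \<eta> $ i * Var i + F i 0 * 0)"
      by (intro has_coeff_derivative_sum has_coeff_derivative_mult F has_coeff_derivative_const)
    moreover have "(\<lambda>t. \<Sum>i\<in>UNIV. F i t * Var i) = (\<lambda>t. 0)"
      using tw by (simp add: F_def twisted_forms_def contract_def)
    ultimately have "has_coeff_derivative (\<lambda>t. 0) (contract (lie a \<eta>))" by (simp add: contract_def)
    then show ?thesis using has_coeff_derivative_unique has_coeff_derivative_const by blast
  qed
  ultimately show "lie a \<eta> \<in> twisted_forms d" by (simp add: twisted_forms_def)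
  have "has_coeff_derivative (\<lambda>t. wedge_d (pull (line_mat (mat 1) a t) \<eta>) i j k) (lin_wedge \<eta> (lie a \<eta>) i j k)"
  proof -
    have t: "has_coeff_derivative (\<lambda>t. F i t * (pdiff j (F k t) - pdiff k (F j t)))
      (lie a \<eta> $ i * (pdiff j (\<eta> $ k) - pdiff k (\<eta> $ j)) + \<eta> $ i * (pdiff j (lie a \<eta> $ k) - pdiff k (lie a \<eta> $ j)))" for i j k
      using has_coeff_derivative_mult[OF F[of i] has_coeff_derivative_diff[OF has_coeff_derivative_pdiff[OF F[of k], of j] has_coeff_derivative_pdiff[OF F[of j], of k]]]
      by (simp add: F0)
    show ?thesis
      using has_coeff_derivative_add[OF has_coeff_derivative_add[OF t[of i j k] t[of j k i]] t[of k i j]]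
      unfolding wedge_d_def lin_wedge_def F_def[symmetric] by (simp add: add.assoc add.commute add.left_commute)
  qed
  moreover have "integrable_form (pull (line_mat (mat 1) a t) \<eta>)" for t
    by (rule integrable_pullback[OF assms(2)])
  ultimately have "has_coeff_derivative (\<lambda>t. 0) (lin_wedge \<eta> (lie a \<eta>) i j k)" by (simp add: integrable_form_def)
  then show "lin_wedge \<eta> (lie a \<eta>) i j k = 0" using has_coeff_derivative_unique has_coeff_derivative_const by blast
qed

lemma lin_wedge_diff: "lin_wedge \<eta> (\<omega> - \<omega>') i j k = lin_wedge \<eta> \<omega> i j k - lin_wedge \<eta> \<omega>' i j k"
  by (simp add: lin_wedge_def pdiff_diff algebra_simps)

lemma twisted_diff: "\<omega> \<in> twisted_forms d \<Longrightarrow> \<omega>' \<in> twisted_forms d \<Longrightarrow> \<omega> - \<omega>' \<in> twisted_forms d"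
  by (simp add: twisted_forms_def homog_diff contract_def left_diff_distrib sum_subtractf)

section \<open>The exceptional form\<close>

subsection \<open>Polynomials in four variables\<close>

lemma UNIV_four: "(UNIV :: 4 set) = {0, 1, 2, 3}"
proof -
  have 4: "(4 :: 4) = 0" by simp
  show ?thesis unfolding UNIV_4 4 by blast
qed

lemma sum_four: "sum f (UNIV :: 4 set) = f 0 + f 1 + f 2 + f 3"
  unfolding UNIV_four by (simp add: add.assoc)

lemma all_four: "(\<forall>i :: 4. P i) \<longleftrightarrow> P 0 \<and> P 1 \<and> P 2 \<and> P 3"
proof -
  have "(\<forall>i :: 4. P i) \<longleftrightarrow> (\<forall>i\<in>UNIV. P i)" by simp
  then show ?thesis unfolding UNIV_four by simp
qed

definition mon4 :: "nat \<Rightarrow> nat \<Rightarrow> nat \<Rightarrow> nat \<Rightarrow> 4 monomial" where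
  "mon4 a b c d = single 0 a + single 1 b + single 2 c + single 3 d"

lemma lookup_mon4 [simp]:
  "lookup (mon4 a b c d) 0 = a" "lookup (mon4 a b c d) 1 = b"
  "lookup (mon4 a b c d) 2 = c" "lookup (mon4 a b c d) 3 = d"
  by (simp_all add: mon4_def lookup_add lookup_single when_def)

lemma eq_mon4: "m = mon4 (lookup m 0) (lookup m 1) (lookup m 2) (lookup m 3)"
  by (simp add: poly_mapping_eq_iff fun_eq_iff all_four)

lemma mdeg_mon4: "mdeg (mon4 a b c d) = a + b + c + d"
  by (simp add: mon4_def mdeg_add)

text \<open>Coefficients are indexed by integer exponents, with value zero when an exponent is
  negative, so that multiplication by a variable is a shift without side conditions.\<close>

definition cf :: "(4, complex) mpoly \<Rightarrow> int \<Rightarrow> int \<Rightarrow> int \<Rightarrow> int \<Rightarrow> complex" where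
  "cf p a b c d = (if 0 \<le> a \<and> 0 \<le> b \<and> 0 \<le> c \<and> 0 \<le> d
     then lookup p (mon4 (nat a) (nat b) (nat c) (nat d)) else 0)"

lemma lookup_Var_mult:
  "lookup (Var v * p) m = (if lookup m v > 0 then lookup p (m - single v 1) else 0)"
proof (induction p rule: mpoly_additive_induct)
  case (single n c)
  have "single v 1 + n = m \<longleftrightarrow> lookup m v > 0 \<and> n = m - single v 1"
  proof
    assume "single v 1 + n = m"
    then show "lookup m v > 0 \<and> n = m - single v 1" by (auto simp: lookup_add)
  next
    assume a: "lookup m v > 0 \<and> n = m - single v 1"
    show "single v 1 + n = m"
      by (rule poly_mapping_eqI) (use a in \<open>auto simp: lookup_add lookup_minus lookup_single when_def\<close>)
  qed
  then show ?case by (auto simp: Var_def mult_single lookup_single when_def simp del: One_nat_def)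
qed (simp_all add: lookup_add algebra_simps)

lemma mon4_minus:
  "mon4 (Suc a) b c d - single 0 (Suc 0) = mon4 a b c d" "mon4 a (Suc b) c d - single 1 (Suc 0) = mon4 a b c d"
  "mon4 a b (Suc c) d - single 2 (Suc 0) = mon4 a b c d" "mon4 a b c (Suc d) - single 3 (Suc 0) = mon4 a b c d"
  by (simp_all add: poly_mapping_eq_iff fun_eq_iff all_four lookup_minus lookup_single when_def)

lemma mon4_plus:
  "mon4 a b c d + single 0 (Suc 0) = mon4 (Suc a) b c d" "mon4 a b c d + single 1 (Suc 0) = mon4 a (Suc b) c d"
  "mon4 a b c d + single 2 (Suc 0) = mon4 a b (Suc c) d" "mon4 a b c d + single 3 (Suc 0) = mon4 a b c (Suc d)"
  by (simp_all add: poly_mapping_eq_iff fun_eq_iff all_four lookup_add lookup_single when_def)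

lemma nat_pred: "a > 0 \<Longrightarrow> nat a = Suc (nat (a - 1))" for a :: int
  by simp

lemma cf_Var:
  "cf (Var 0 * p) a b c d = cf p (a - 1) b c d" "cf (Var 1 * p) a b c d = cf p a (b - 1) c d"
  "cf (Var 2 * p) a b c d = cf p a b (c - 1) d" "cf (Var 3 * p) a b c d = cf p a b c (d - 1)"
proof -
  show "cf (Var 0 * p) a b c d = cf p (a - 1) b c d"
    by (cases "a > 0") (auto simp: cf_def lookup_Var_mult nat_pred[of a] mon4_minus)
  show "cf (Var 1 * p) a b c d = cf p a (b - 1) c d"
    by (cases "b > 0") (auto simp: cf_def lookup_Var_mult nat_pred[of b] mon4_minus)
  show "cf (Var 2 * p) a b c d = cf p a b (c - 1) d"
    by (cases "c > 0") (auto simp: cf_def lookup_Var_mult nat_pred[of c] mon4_minus)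
  show "cf (Var 3 * p) a b c d = cf p a b c (d - 1)"
    by (cases "d > 0") (auto simp: cf_def lookup_Var_mult nat_pred[of d] mon4_minus)
qed

lemma cf_pdiff:
  "cf (pdiff 0 p) a b c d = of_int (a + 1) * cf p (a + 1) b c d"
  "cf (pdiff 1 p) a b c d = of_int (b + 1) * cf p a (b + 1) c d"
  "cf (pdiff 2 p) a b c d = of_int (c + 1) * cf p a b (c + 1) d"
  "cf (pdiff 3 p) a b c d = of_int (d + 1) * cf p a b c (d + 1)"
proof -
  have n: "nat (a + 1) = Suc (nat a)" if "0 \<le> a" for a using that by simp
  show "cf (pdiff 0 p) a b c d = of_int (a + 1) * cf p (a + 1) b c d"
    by (cases "0 \<le> a"; cases "a = - 1") (auto simp: cf_def lookup_pdiff mon4_plus n)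
  show "cf (pdiff 1 p) a b c d = of_int (b + 1) * cf p a (b + 1) c d"
    by (cases "0 \<le> b"; cases "b = - 1") (auto simp: cf_def lookup_pdiff mon4_plus n)
  show "cf (pdiff 2 p) a b c d = of_int (c + 1) * cf p a b (c + 1) d"
    by (cases "0 \<le> c"; cases "c = - 1") (auto simp: cf_def lookup_pdiff mon4_plus n)
  show "cf (pdiff 3 p) a b c d = of_int (d + 1) * cf p a b c (d + 1)"
    by (cases "0 \<le> d"; cases "d = - 1") (auto simp: cf_def lookup_pdiff mon4_plus n)
qed

lemma cf_0: "cf 0 a b c d = 0" by (simp add: cf_def)
lemma cf_add: "cf (p + q) a b c d = cf p a b c d + cf q a b c d" by (simp add: cf_def lookup_add)
lemma cf_minus: "cf (p - q) a b c d = cf p a b c d - cf q a b c d" by (simp add: cf_def lookup_minus)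
lemma cf_uminus: "cf (- p) a b c d = - cf p a b c d" by (simp add: cf_def)
lemma cf_Const: "cf (Const k * p) a b c d = k * cf p a b c d" by (simp add: cf_def lookup_Const_mult)
lemma cf_numeral: "cf (numeral k * p) a b c d = numeral k * cf p a b c d"
  using cf_Const[of "numeral k" p] by (simp add: Const_numeral)

lemma cf_one: "cf 1 a b c d = (if a = 0 \<and> b = 0 \<and> c = 0 \<and> d = 0 then 1 else 0)"
proof -
  have "mon4 a b c d = 0 \<longleftrightarrow> a = 0 \<and> b = 0 \<and> c = 0 \<and> d = 0" for a b c d
    by (simp add: poly_mapping_eq_iff fun_eq_iff all_four)
  then show ?thesis by (auto simp: cf_def lookup_one when_def)
qed

lemma cf_Var0:
  "cf (Var 0) a b c d = cf 1 (a - 1) b c d" "cf (Var 1) a b c d = cf 1 a (b - 1) c d"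
  "cf (Var 2) a b c d = cf 1 a b (c - 1) d" "cf (Var 3) a b c d = cf 1 a b c (d - 1)"
  using cf_Var[of 1] by simp_all

lemma cf_expand:
  "cf ((p + q) * r) a b c d = cf (p * r) a b c d + cf (q * r) a b c d"
  "cf ((p - q) * r) a b c d = cf (p * r) a b c d - cf (q * r) a b c d"
  "cf ((- p) * r) a b c d = - cf (p * r) a b c d"
  "cf ((p * q) * r) a b c d = cf (p * (q * r)) a b c d"
  by (simp_all add: cf_add cf_minus cf_uminus left_diff_distrib distrib_right mult.assoc)

lemma cf_neg:
  "cf p (- 1) b c d = 0" "cf p a (- 1) c d = 0" "cf p a b (- 1) d = 0" "cf p a b c (- 1) = 0"
  "cf p (- numeral k) b c d = 0" "cf p a (- numeral k) c d = 0"
  "cf p a b (- numeral k) d = 0" "cf p a b c (- numeral k) = 0"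
  by (simp_all add: cf_def)

lemmas cf_simps = cf_neg cf_Var cf_pdiff cf_expand cf_0 cf_add cf_minus cf_uminus cf_Const cf_numeral

lemma cubic_zero:
  assumes "homog 3 p" and
    "cf p 0 0 0 3 = 0"
    "cf p 0 0 1 2 = 0"
    "cf p 0 0 2 1 = 0"
    "cf p 0 0 3 0 = 0"
    "cf p 0 1 0 2 = 0"
    "cf p 0 1 1 1 = 0"
    "cf p 0 1 2 0 = 0"
    "cf p 0 2 0 1 = 0"
    "cf p 0 2 1 0 = 0"
    "cf p 0 3 0 0 = 0"
    "cf p 1 0 0 2 = 0"
    "cf p 1 0 1 1 = 0"
    "cf p 1 0 2 0 = 0"
    "cf p 1 1 0 1 = 0"
    "cf p 1 1 1 0 = 0"
    "cf p 1 2 0 0 = 0"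
    "cf p 2 0 0 1 = 0"
    "cf p 2 0 1 0 = 0"
    "cf p 2 1 0 0 = 0"
    "cf p 3 0 0 0 = 0"
  shows "p = 0"
proof (rule poly_mapping_eqI)
  fix m :: "4 monomial"
  define a b c d where "a = lookup m 0" and "b = lookup m 1" and "c = lookup m 2" and "d = lookup m 3"
  have m: "m = mon4 a b c d" unfolding a_def b_def c_def d_def by (rule eq_mon4)
  show "lookup p m = lookup 0 m"
  proof (cases "mdeg m = 3")
    case False
    then show ?thesis using homogD[OF assms(1)] by auto
  next
    case True
    then have s: "a + b + c + d = 3" by (simp add: m mdeg_mon4)
    have "lookup p m = cf p (int a) (int b) (int c) (int d)" by (simp add: cf_def m)
    moreover have "cf p (int a) (int b) (int c) (int d) = 0"
    proof -
      have "a = 0 \<or> a = 1 \<or> a = 2 \<or> a = 3" "b = 0 \<or> b = 1 \<or> b = 2 \<or> b = 3" "c = 0 \<or> c = 1 \<or> c = 2 \<or> c = 3"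
        using s by linarith+
      then show ?thesis using s by (elim disjE) (simp_all add: assms(2-))
    qed
    ultimately show ?thesis by simp
  qed
qed

subsection \<open>Rigidity\<close>

abbreviation x_coord :: "4 \<Rightarrow> (4, complex) mpoly" (\<open>\<x>\<close>) where
  "\<x> \<equiv> Var"

text \<open>The restriction of \<open>2 Q dC - 3 C dQ\<close> to \<open>a\<^sub>4 = 0\<close>,
  divided by \<open>2 a\<^sub>3\<close>. Products are nested to the right, the shape in which
  coefficients are computed.\<close>

definition eta0 :: "(4, complex) form1" where
  "eta0 = (\<chi> i.
    if i = 0 then 4 * (\<x> 1 * (\<x> 3 * \<x> 3)) - 3 * (\<x> 2 * (\<x> 2 * \<x> 3))
    else if i = 1 then 4 * (\<x> 1 * (\<x> 2 * \<x> 3)) - 6 * (\<x> 0 * (\<x> 3 * \<x> 3))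
    else if i = 2 then 9 * (\<x> 0 * (\<x> 2 * \<x> 3)) - 8 * (\<x> 1 * (\<x> 1 * \<x> 3))
    else 2 * (\<x> 0 * (\<x> 1 * \<x> 3)) + 4 * (\<x> 1 * (\<x> 1 * \<x> 2)) - 6 * (\<x> 0 * (\<x> 2 * \<x> 2)))"

lemma eta0_simps:
  "eta0 $ 0 = 4 * (\<x> 1 * (\<x> 3 * \<x> 3)) - 3 * (\<x> 2 * (\<x> 2 * \<x> 3))"
  "eta0 $ 1 = 4 * (\<x> 1 * (\<x> 2 * \<x> 3)) - 6 * (\<x> 0 * (\<x> 3 * \<x> 3))"
  "eta0 $ 2 = 9 * (\<x> 0 * (\<x> 2 * \<x> 3)) - 8 * (\<x> 1 * (\<x> 1 * \<x> 3))"
  "eta0 $ 3 = 2 * (\<x> 0 * (\<x> 1 * \<x> 3)) + 4 * (\<x> 1 * (\<x> 1 * \<x> 2)) - 6 * (\<x> 0 * (\<x> 2 * \<x> 2))"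
  by (simp_all add: eta0_def)

lemmas pdiff_simps = pdiff_add pdiff_diff pdiff_uminus pdiff_mult pdiff_Var

lemma d_eta0_01: "pdiff 0 (eta0 $ 1) - pdiff 1 (eta0 $ 0) = - (10 * (\<x> 3 * \<x> 3))"
  by (simp add: eta0_simps pdiff_simps algebra_simps)

lemma d_eta0_10: "pdiff 1 (eta0 $ 0) - pdiff 0 (eta0 $ 1) = 10 * (\<x> 3 * \<x> 3)"
  by (simp add: eta0_simps pdiff_simps algebra_simps)

lemma d_eta0_02: "pdiff 0 (eta0 $ 2) - pdiff 2 (eta0 $ 0) = 15 * (\<x> 2 * \<x> 3)"
  by (simp add: eta0_simps pdiff_simps algebra_simps)

lemma d_eta0_20: "pdiff 2 (eta0 $ 0) - pdiff 0 (eta0 $ 2) = - (15 * (\<x> 2 * \<x> 3))"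
  by (simp add: eta0_simps pdiff_simps algebra_simps)

lemma d_eta0_03: "pdiff 0 (eta0 $ 3) - pdiff 3 (eta0 $ 0) = - (6 * (\<x> 1 * \<x> 3)) - 3 * (\<x> 2 * \<x> 2)"
  by (simp add: eta0_simps pdiff_simps algebra_simps)

lemma d_eta0_30: "pdiff 3 (eta0 $ 0) - pdiff 0 (eta0 $ 3) = 6 * (\<x> 1 * \<x> 3) + 3 * (\<x> 2 * \<x> 2)"
  by (simp add: eta0_simps pdiff_simps algebra_simps)

lemma d_eta0_12: "pdiff 1 (eta0 $ 2) - pdiff 2 (eta0 $ 1) = - (20 * (\<x> 1 * \<x> 3))"
  by (simp add: eta0_simps pdiff_simps algebra_simps)

lemma d_eta0_21: "pdiff 2 (eta0 $ 1) - pdiff 1 (eta0 $ 2) = 20 * (\<x> 1 * \<x> 3)"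
  by (simp add: eta0_simps pdiff_simps algebra_simps)

lemma d_eta0_13: "pdiff 1 (eta0 $ 3) - pdiff 3 (eta0 $ 1) = 14 * (\<x> 0 * \<x> 3) + 4 * (\<x> 1 * \<x> 2)"
  by (simp add: eta0_simps pdiff_simps algebra_simps)

lemma d_eta0_31: "pdiff 3 (eta0 $ 1) - pdiff 1 (eta0 $ 3) = - (14 * (\<x> 0 * \<x> 3)) - 4 * (\<x> 1 * \<x> 2)"
  by (simp add: eta0_simps pdiff_simps algebra_simps)

lemma d_eta0_23: "pdiff 2 (eta0 $ 3) - pdiff 3 (eta0 $ 2) = - (21 * (\<x> 0 * \<x> 2)) + 12 * (\<x> 1 * \<x> 1)"
  by (simp add: eta0_simps pdiff_simps algebra_simps)

lemma d_eta0_32: "pdiff 3 (eta0 $ 2) - pdiff 2 (eta0 $ 3) = 21 * (\<x> 0 * \<x> 2) - 12 * (\<x> 1 * \<x> 1)"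
  by (simp add: eta0_simps pdiff_simps algebra_simps)

lemmas d_eta0 = d_eta0_01 d_eta0_10 d_eta0_02 d_eta0_20 d_eta0_03 d_eta0_30 d_eta0_12 d_eta0_21 d_eta0_13 d_eta0_31 d_eta0_23 d_eta0_32

lemma lin_wedge_eta0:
  "lin_wedge eta0 \<omega> i j k =
     eta0 $ i * (pdiff j (\<omega> $ k) - pdiff k (\<omega> $ j)) + (pdiff j (eta0 $ k) - pdiff k (eta0 $ j)) * \<omega> $ i +
     eta0 $ j * (pdiff k (\<omega> $ i) - pdiff i (\<omega> $ k)) + (pdiff k (eta0 $ i) - pdiff i (eta0 $ k)) * \<omega> $ j +
     eta0 $ k * (pdiff i (\<omega> $ j) - pdiff j (\<omega> $ i)) + (pdiff i (eta0 $ j) - pdiff j (eta0 $ i)) * \<omega> $ k"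
  by (simp add: lin_wedge_def mult.commute)

text \<open>With weight \<open>i\<close> for the variable \<open>x\<^sub>i\<close> and its
  differential, \<open>eta0\<close> is homogeneous, so the linear system splits into one block for
  each weight from 0 to 12, with at most twelve unknowns. The 14 normalized coefficients are chosen
  so that in most blocks the equations, taken in a suitable order, each contain only one coefficient
  not yet known to vanish; in three blocks a small system is left and solved at once.\<close>

lemma normalized_deformation_zero:
  assumes tw: "\<omega> \<in> twisted_forms 2" and W: "\<And>i j k. lin_wedge eta0 \<omega> i j k = 0"
    and N: "cf (\<omega> $ 0) 0 2 1 0 = 0"
    "cf (\<omega> $ 0) 0 1 2 0 = 0"
    "cf (\<omega> $ 0) 1 0 1 1 = 0"
    "cf (\<omega> $ 0) 0 0 3 0 = 0"
    "cf (\<omega> $ 0) 0 1 1 1 = 0"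
    "cf (\<omega> $ 0) 1 0 0 2 = 0"
    "cf (\<omega> $ 0) 0 0 2 1 = 0"
    "cf (\<omega> $ 0) 0 1 0 2 = 0"
    "cf (\<omega> $ 1) 0 1 1 1 = 0"
    "cf (\<omega> $ 0) 0 0 1 2 = 0"
    "cf (\<omega> $ 1) 0 0 2 1 = 0"
    "cf (\<omega> $ 0) 0 0 0 3 = 0"
    "cf (\<omega> $ 1) 0 0 1 2 = 0"
    "cf (\<omega> $ 1) 0 0 0 3 = 0"
  shows "\<omega> = 0"
proof -
  have ct: "cf (\<x> 0 * \<omega> $ 0 + \<x> 1 * \<omega> $ 1 + \<x> 2 * \<omega> $ 2 + \<x> 3 * \<omega> $ 3) a b c d = 0" for a b c d
    using tw by (simp add: twisted_forms_def contract_def sum_four mult.commute cf_0)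
  note w012 = arg_cong[OF W[of 0 1 2], of cf, THEN fun_cong, THEN fun_cong, THEN fun_cong, THEN fun_cong,
      unfolded lin_wedge_eta0 d_eta0, unfolded eta0_simps cf_0]
  note w013 = arg_cong[OF W[of 0 1 3], of cf, THEN fun_cong, THEN fun_cong, THEN fun_cong, THEN fun_cong,
      unfolded lin_wedge_eta0 d_eta0, unfolded eta0_simps cf_0]
  note w023 = arg_cong[OF W[of 0 2 3], of cf, THEN fun_cong, THEN fun_cong, THEN fun_cong, THEN fun_cong,
      unfolded lin_wedge_eta0 d_eta0, unfolded eta0_simps cf_0]
  note w123 = arg_cong[OF W[of 1 2 3], of cf, THEN fun_cong, THEN fun_cong, THEN fun_cong, THEN fun_cong,
      unfolded lin_wedge_eta0 d_eta0, unfolded eta0_simps cf_0]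
  have z0_3000: "cf (\<omega> $ 0) 3 0 0 0 = 0"
    using ct[of 4 0 0 0]  by (simp add: cf_simps)
  have z0_2100: "cf (\<omega> $ 0) 2 1 0 0 = 0"
    using w023[of 2 3 0 0]  by (simp add: cf_simps)
  have z1_3000: "cf (\<omega> $ 1) 3 0 0 0 = 0"
    using w013[of 2 2 1 0]  by (simp add: cf_simps)
  have z0_1200: "cf (\<omega> $ 0) 1 2 0 0 = 0"
    using w023[of 1 4 0 0]  by (simp add: cf_simps)
  have z0_2010: "cf (\<omega> $ 0) 2 0 1 0 = 0"
    using w013[of 3 0 1 1]  by (simp add: cf_simps)
  have z2_3000: "cf (\<omega> $ 2) 3 0 0 0 = 0"
    using w023[of 3 1 0 1] z0_2010 by (simp add: cf_simps)
  have z1_2100: "cf (\<omega> $ 1) 2 1 0 0 = 0"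
    using w123[of 2 3 0 0]  by (simp add: cf_simps)
  have z0_0300: "cf (\<omega> $ 0) 0 3 0 0 = 0"
    using w023[of 0 5 0 0]  by (simp add: cf_simps)
  have z1_1200: "cf (\<omega> $ 1) 1 2 0 0 = 0"
    using w123[of 1 4 0 0]  by (simp add: cf_simps)
  have z1_2010: "cf (\<omega> $ 1) 2 0 1 0 = 0"
    using w123[of 2 2 1 0] z1_1200 by (simp add: cf_simps)
  have z2_2100: "cf (\<omega> $ 2) 2 1 0 0 = 0"
    using w123[of 3 0 2 0] z1_2010 by (simp add: cf_simps)
  have z0_1110: "cf (\<omega> $ 0) 1 1 1 0 = 0"
    using w012[of 1 2 1 1] z0_0300 z1_1200 z1_2010 z2_2100 by (simp add: cf_simps)
  have z0_2001: "cf (\<omega> $ 0) 2 0 0 1 = 0"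
    using w012[of 2 1 0 2] z0_1110 z1_2010 z2_2100 by (simp add: cf_simps)
  have z3_3000: "cf (\<omega> $ 3) 3 0 0 0 = 0"
    using w013[of 2 1 1 1] z0_1110 z0_2001 z1_2010 by (simp add: cf_simps)
  have z2_1200: "cf (\<omega> $ 2) 1 2 0 0 = 0"
    using w023[of 0 4 1 0] N(1) by (simp add: cf_simps)
  have z1_0300: "cf (\<omega> $ 1) 0 3 0 0 = 0"
    using ct[of 0 4 0 0]  by (simp add: cf_simps)
  have z1_1110: "cf (\<omega> $ 1) 1 1 1 0 = 0"
    using w012[of 0 3 1 1] z1_0300 z2_1200 by (simp add: cf_simps)
  have z2_2010: "cf (\<omega> $ 2) 2 0 1 0 = 0"
    using w123[of 2 1 2 0] z1_1110 z2_1200 by (simp add: cf_simps)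
  have z0_1020: "cf (\<omega> $ 0) 1 0 2 0 = 0"
    using w012[of 1 1 2 1] N(1) z1_1110 z2_1200 z2_2010 by (simp add: cf_simps)
  have e4_0: "(-12) * cf (\<omega> $ 0) 1 1 0 1 + (-16) * cf (\<omega> $ 1) 2 0 0 1 = 0"
    using w012[of 1 2 0 2] N(1) z1_1110 z2_1200 by (simp add: cf_simps)
  have e4_1: "(-9) * cf (\<omega> $ 0) 1 1 0 1 + (3) * cf (\<omega> $ 1) 2 0 0 1 = 0"
    using w012[of 2 0 1 2] z0_1020 z2_2010 by (simp add: cf_simps)
  have e4_2: "(4) * cf (\<omega> $ 0) 1 1 0 1 + (16) * cf (\<omega> $ 3) 2 1 0 0 = 0"
    using w023[of 1 3 0 1] N(1) z2_1200 by (simp add: cf_simps)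
  have z0_1101: "cf (\<omega> $ 0) 1 1 0 1 = 0"
    using e4_0 e4_1 e4_2 by algebra
  have z1_2001: "cf (\<omega> $ 1) 2 0 0 1 = 0"
    using e4_0 e4_1 e4_2 by algebra
  have z3_2100: "cf (\<omega> $ 3) 2 1 0 0 = 0"
    using e4_0 e4_1 e4_2 by algebra
  have z2_1110: "cf (\<omega> $ 2) 1 1 1 0 = 0"
    using w012[of 1 0 3 1] N(2) by (simp add: cf_simps)
  have z1_1020: "cf (\<omega> $ 1) 1 0 2 0 = 0"
    using w013[of 1 0 4 0] N(2) by (simp add: cf_simps)
  have z2_0300: "cf (\<omega> $ 2) 0 3 0 0 = 0"
    using w023[of 0 3 2 0] N(2) z2_1110 by (simp add: cf_simps)
  have z2_2001: "cf (\<omega> $ 2) 2 0 0 1 = 0"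
    using w012[of 2 0 0 3] N(3) by (simp add: cf_simps)
  have z3_2010: "cf (\<omega> $ 3) 2 0 1 0 = 0"
    using w013[of 2 0 1 2] N(3) by (simp add: cf_simps)
  have z1_0210: "cf (\<omega> $ 1) 0 2 1 0 = 0"
    using ct[of 0 3 1 0] z2_0300 by (simp add: cf_simps)
  have e5_0: "(-4) * cf (\<omega> $ 0) 0 2 0 1 + (-8) * cf (\<omega> $ 1) 1 1 0 1 = 0"
    using w012[of 0 3 0 2] z1_0210 z2_0300 by (simp add: cf_simps)
  have e5_1: "(-18) * cf (\<omega> $ 0) 0 2 0 1 + (-6) * cf (\<omega> $ 1) 1 1 0 1 = 0"
    using w012[of 1 1 1 2] N(2) N(3) z1_1020 z2_2001 by (simp add: cf_simps)
  have e5_2: "(4) * cf (\<omega> $ 1) 1 1 0 1 + (-4) * cf (\<omega> $ 3) 1 2 0 0 = 0"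
    using w013[of 0 3 1 1] z1_0210 by (simp add: cf_simps)
  have z0_0201: "cf (\<omega> $ 0) 0 2 0 1 = 0"
    using e5_0 e5_1 e5_2 by algebra
  have z1_1101: "cf (\<omega> $ 1) 1 1 0 1 = 0"
    using e5_0 e5_1 e5_2 by algebra
  have z3_1200: "cf (\<omega> $ 3) 1 2 0 0 = 0"
    using e5_0 e5_1 e5_2 by algebra
  have z2_1020: "cf (\<omega> $ 2) 1 0 2 0 = 0"
    using ct[of 1 0 3 0] N(4) by (simp add: cf_simps)
  have z3_1110: "cf (\<omega> $ 3) 1 1 1 0 = 0"
    using w013[of 1 0 3 1] N(4) N(5) by (simp add: cf_simps)
  have z1_0120: "cf (\<omega> $ 1) 0 1 2 0 = 0"
    using w013[of 0 1 4 0] N(4) by (simp add: cf_simps)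
  have z1_1011: "cf (\<omega> $ 1) 1 0 1 1 = 0"
    using w012[of 1 1 0 3] N(5) N(6) by (simp add: cf_simps)
  have z3_2001: "cf (\<omega> $ 3) 2 0 0 1 = 0"
    using w013[of 1 1 1 2] N(5) N(6) z1_1011 by (simp add: cf_simps)
  have z2_1101: "cf (\<omega> $ 2) 1 1 0 1 = 0"
    using w023[of 1 2 0 2] N(5) N(6) z3_1110 z3_2001 by (simp add: cf_simps)
  have z2_0210: "cf (\<omega> $ 2) 0 2 1 0 = 0"
    using ct[of 0 2 2 0] z1_0120 by (simp add: cf_simps)
  have z3_0300: "cf (\<omega> $ 3) 0 3 0 0 = 0"
    using w023[of 0 3 1 1] z2_0210 z2_1101 z3_1110 by (simp add: cf_simps)
  have z1_0201: "cf (\<omega> $ 1) 0 2 0 1 = 0"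
    using w012[of 0 2 1 2] N(5) z1_0120 z1_1011 z2_0210 z2_1101 by (simp add: cf_simps)
  have z1_0030: "cf (\<omega> $ 1) 0 0 3 0 = 0"
    using w013[of 0 0 5 0]  by (simp add: cf_simps)
  have z2_0120: "cf (\<omega> $ 2) 0 1 2 0 = 0"
    using w123[of 1 0 4 0] z1_0030 by (simp add: cf_simps)
  have e7_0: "(1) * cf (\<omega> $ 2) 0 2 0 1 + (1) * cf (\<omega> $ 3) 0 2 1 0 = 0"
    using ct[of 0 2 1 1] N(9) by (simp add: cf_simps)
  have e7_1: "(1) * cf (\<omega> $ 2) 1 0 1 1 + (1) * cf (\<omega> $ 3) 1 0 2 0 = 0"
    using ct[of 1 0 2 1] N(7) by (simp add: cf_simps)
  have e7_2: "(1) * cf (\<omega> $ 1) 1 0 0 2 + (1) * cf (\<omega> $ 3) 1 1 0 1 = 0"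
    using ct[of 1 1 0 2] N(8) by (simp add: cf_simps)
  have e7_3: "(-6) * cf (\<omega> $ 2) 0 2 0 1 + (-4) * cf (\<omega> $ 2) 1 0 1 1 = 0"
    using w012[of 0 1 2 2] N(7) z1_0030 N(9) z2_0120 by (simp add: cf_simps)
  have e7_4: "(-8) * cf (\<omega> $ 1) 1 0 0 2 + (-2) * cf (\<omega> $ 2) 0 2 0 1 = 0"
    using w012[of 0 2 0 3] N(8) N(9) by (simp add: cf_simps, metis add.inverse_inverse)
  have e7_5: "(-6) * cf (\<omega> $ 1) 1 0 0 2 + (-4) * cf (\<omega> $ 2) 1 0 1 1 = 0"
    using w012[of 1 0 1 3] N(7) N(8) by (simp add: cf_simps, metis add.inverse_inverse)
  have z1_1002: "cf (\<omega> $ 1) 1 0 0 2 = 0"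
    using e7_0 e7_1 e7_2 e7_3 e7_4 e7_5 by algebra
  have z2_0201: "cf (\<omega> $ 2) 0 2 0 1 = 0"
    using e7_0 e7_1 e7_2 e7_3 e7_4 e7_5 by algebra
  have z2_1011: "cf (\<omega> $ 2) 1 0 1 1 = 0"
    using e7_0 e7_1 e7_2 e7_3 e7_4 e7_5 by algebra
  have z3_0210: "cf (\<omega> $ 3) 0 2 1 0 = 0"
    using e7_0 e7_1 e7_2 e7_3 e7_4 e7_5 by algebra
  have z3_1020: "cf (\<omega> $ 3) 1 0 2 0 = 0"
    using e7_0 e7_1 e7_2 e7_3 e7_4 e7_5 by algebra
  have z3_1101: "cf (\<omega> $ 3) 1 1 0 1 = 0"
    using e7_0 e7_1 e7_2 e7_3 e7_4 e7_5 by algebra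
  have z2_1002: "cf (\<omega> $ 2) 1 0 0 2 = 0"
    using w012[of 1 0 0 4] N(10) by (simp add: cf_simps)
  have z3_1011: "cf (\<omega> $ 3) 1 0 1 1 = 0"
    using w013[of 1 0 1 3] N(10) by (simp add: cf_simps)
  have z3_0120: "cf (\<omega> $ 3) 0 1 2 0 = 0"
    using w013[of 0 0 4 1] N(11) by (simp add: cf_simps)
  have z2_0111: "cf (\<omega> $ 2) 0 1 1 1 = 0"
    using w123[of 0 2 2 1] N(11) z3_0120 by (simp add: cf_simps)
  have z2_0030: "cf (\<omega> $ 2) 0 0 3 0 = 0"
    using ct[of 0 0 4 0]  by (simp add: cf_simps)
  have z1_0102: "cf (\<omega> $ 1) 0 1 0 2 = 0"
    using w012[of 0 1 1 3] N(10) N(11) z2_0111 z2_1002 by (simp add: cf_simps)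
  have z3_0201: "cf (\<omega> $ 3) 0 2 0 1 = 0"
    using w013[of 0 1 2 2] N(10) N(11) z1_0102 z3_0120 z3_1011 by (simp add: cf_simps)
  have z3_1002: "cf (\<omega> $ 3) 1 0 0 2 = 0"
    using ct[of 1 0 0 3] N(12) by (simp add: cf_simps)
  have z2_0102: "cf (\<omega> $ 2) 0 1 0 2 = 0"
    using w012[of 0 1 0 4] N(12) N(13) by (simp add: cf_simps)
  have z3_0111: "cf (\<omega> $ 3) 0 1 1 1 = 0"
    using w013[of 0 1 1 3] N(12) N(13) z3_1002 by (simp add: cf_simps)
  have z2_0021: "cf (\<omega> $ 2) 0 0 2 1 = 0"
    using w012[of 0 0 2 3] N(13) z2_0102 by (simp add: cf_simps)
  have z3_0030: "cf (\<omega> $ 3) 0 0 3 0 = 0"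
    using w013[of 0 0 3 2] N(13) z3_0111 by (simp add: cf_simps)
  have z3_0102: "cf (\<omega> $ 3) 0 1 0 2 = 0"
    using ct[of 0 1 0 3] N(14) by (simp add: cf_simps)
  have z2_0012: "cf (\<omega> $ 2) 0 0 1 2 = 0"
    using w012[of 0 0 1 4] N(14) by (simp add: cf_simps)
  have z3_0021: "cf (\<omega> $ 3) 0 0 2 1 = 0"
    using w013[of 0 0 2 3] N(14) z3_0102 by (simp add: cf_simps)
  have z2_0003: "cf (\<omega> $ 2) 0 0 0 3 = 0"
    using w012[of 0 0 0 5]  by (simp add: cf_simps)
  have z3_0012: "cf (\<omega> $ 3) 0 0 1 2 = 0"
    using w023[of 0 1 0 4] z2_0003 by (simp add: cf_simps)
  have z3_0003: "cf (\<omega> $ 3) 0 0 0 3 = 0"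
    using ct[of 0 0 0 4]  by (simp add: cf_simps)
  have h: "homog 3 (\<omega> $ i)" for i
    using tw unfolding twisted_forms_def by simp
  have "\<omega> $ 0 = 0"
    by (rule cubic_zero[OF h
      N(12)
      N(10)
      N(7)
      N(4)
      N(8)
      N(5)
      N(2)
      z0_0201
      N(1)
      z0_0300
      N(6)
      N(3)
      z0_1020
      z0_1101
      z0_1110
      z0_1200
      z0_2001
      z0_2010
      z0_2100
      z0_3000])
  moreover have "\<omega> $ 1 = 0"
    by (rule cubic_zero[OF h
      N(14)
      N(13)
      N(11)
      z1_0030
      z1_0102
      N(9)
      z1_0120
      z1_0201
      z1_0210
      z1_0300
      z1_1002
      z1_1011
      z1_1020
      z1_1101
      z1_1110
      z1_1200
      z1_2001
      z1_2010
      z1_2100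
      z1_3000])
  moreover have "\<omega> $ 2 = 0"
    by (rule cubic_zero[OF h
      z2_0003
      z2_0012
      z2_0021
      z2_0030
      z2_0102
      z2_0111
      z2_0120
      z2_0201
      z2_0210
      z2_0300
      z2_1002
      z2_1011
      z2_1020
      z2_1101
      z2_1110
      z2_1200
      z2_2001
      z2_2010
      z2_2100
      z2_3000])
  moreover have "\<omega> $ 3 = 0"
    by (rule cubic_zero[OF h
      z3_0003
      z3_0012
      z3_0021
      z3_0030
      z3_0102
      z3_0111
      z3_0120
      z3_0201
      z3_0210
      z3_0300
      z3_1002
      z3_1011
      z3_1020
      z3_1101
      z3_1110
      z3_1200
      z3_2001
      z3_2010
      z3_2100
      z3_3000])
  ultimately show ?thesis by (simp add: vec_eq_iff all_four)
qed

lemma eta0_twisted: "eta0 \<in> twisted_forms 2"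
proof -
  have v: "homog 3 (\<x> i * (\<x> j * \<x> k))" for i j k
    using homog_mult[OF homog_Var homog_mult[OF homog_Var homog_Var], of i j k] by (simp add: numeral_3_eq_3)
  have n: "homog 3 (numeral c * (\<x> i * (\<x> j * \<x> k)))" for c i j k
    using homog_mult[OF homog_Const v, of "numeral c" i j k] by (simp add: Const_numeral)
  have "\<forall>i. homog 3 (eta0 $ i)"
    unfolding all_four eta0_simps by (intro conjI homog_add homog_diff n)
  moreover have "contract eta0 = 0"
    unfolding contract_def sum_four eta0_simps by (simp add: algebra_simps)
  ultimately show ?thesis by (simp add: twisted_forms_def numeral_3_eq_3 numeral_2_eq_2)
qed

lemma eta0_integrable: "integrable_form eta0"
proof -
  have w: "wedge_d eta0 0 1 2 = 0" "wedge_d eta0 0 1 3 = 0" "wedge_d eta0 0 2 3 = 0" "wedge_d eta0 1 2 3 = 0"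
    unfolding wedge_d_def d_eta0 unfolding eta0_simps by (simp_all add: algebra_simps)
  have c: "wedge_d eta0 i j k = wedge_d eta0 j k i" for i j k by (simp add: wedge_d_def)
  have a: "wedge_d eta0 i j k = - wedge_d eta0 j i k" for i j k by (simp add: wedge_d_def algebra_simps)
  have z: "wedge_d eta0 i i k = 0" for i k by (simp add: wedge_d_def algebra_simps)
  have p: "wedge_d eta0 i j k = 0 \<Longrightarrow> wedge_d eta0 j i k = 0 \<and> wedge_d eta0 j k i = 0 \<and> wedge_d eta0 k j i = 0
    \<and> wedge_d eta0 k i j = 0 \<and> wedge_d eta0 i k j = 0" for i j k
    using c[of i j k] c[of j k i] a[of i j k] c[of j i k] c[of i k j] by simp
  have z': "wedge_d eta0 i k i = 0" "wedge_d eta0 k i i = 0" for i k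
    using z[of i k] c[of i i k] c[of i k i] by simp_all
  show ?thesis unfolding integrable_form_def all_four
    using w w[THEN p] by (simp add: z z')
qed

lemma eta0_nonzero: "eta0 \<noteq> 0"
proof
  assume "eta0 = 0"
  then have "cf (eta0 $ 0) 0 1 0 2 = 0" by (simp add: cf_0)
  then show False unfolding eta0_simps by (simp add: cf_simps cf_Var0 cf_one)
qed

lemma cf_lie:
  "cf (lie a \<omega> $ j) p q r s =
    cf (\<Sum>l\<in>UNIV. \<Sum>i\<in>UNIV. Const (a $ l $ i) * (\<x> i * pdiff l (\<omega> $ j))) p q r s +
    cf (\<Sum>i\<in>UNIV. Const (a $ i $ j) * \<omega> $ i) p q r s"
  by (simp add: lie_def linear_map_def cf_add sum_distrib_left algebra_simps)

lemma cf_lie_eta0: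
  "cf (lie a eta0 $ 0) 0 2 1 0 = 4 * a $ 3 $ 0"
  "cf (lie a eta0 $ 0) 0 1 2 0 = - 3 * a $ 3 $ 1"
  "cf (lie a eta0 $ 0) 1 0 1 1 = 3 * a $ 2 $ 0"
  "cf (lie a eta0 $ 0) 0 0 3 0 = - 3 * a $ 3 $ 2"
  "cf (lie a eta0 $ 0) 0 1 1 1 = 4 * a $ 1 $ 0 - 6 * a $ 2 $ 1 + 8 * a $ 3 $ 2"
  "cf (lie a eta0 $ 0) 1 0 0 2 = - 2 * a $ 1 $ 0"
  "cf (lie a eta0 $ 0) 0 0 2 1 = - 3 * a $ 0 $ 0 - 6 * a $ 2 $ 2 - 3 * a $ 3 $ 3"
  "cf (lie a eta0 $ 0) 0 1 0 2 = 4 * a $ 0 $ 0 + 4 * a $ 1 $ 1 + 8 * a $ 3 $ 3"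
  "cf (lie a eta0 $ 1) 0 1 1 1 = 8 * a $ 1 $ 1 + 4 * a $ 2 $ 2 + 4 * a $ 3 $ 3"
  "cf (lie a eta0 $ 0) 0 0 1 2 = 4 * a $ 1 $ 2 - 6 * a $ 2 $ 3"
  "cf (lie a eta0 $ 1) 0 0 2 1 = - 3 * a $ 0 $ 1 + 4 * a $ 1 $ 2"
  "cf (lie a eta0 $ 0) 0 0 0 3 = 4 * a $ 1 $ 3"
  "cf (lie a eta0 $ 1) 0 0 1 2 = - 6 * a $ 0 $ 2 + 4 * a $ 1 $ 3"
  "cf (lie a eta0 $ 1) 0 0 0 3 = - 6 * a $ 0 $ 3"
  unfolding cf_lie sum_four eta0_simps
  by (simp_all add: cf_simps cf_Var0 cf_one)

definition mat4 :: "(4 \<Rightarrow> 4 \<Rightarrow> complex) \<Rightarrow> complex ^ 4 ^ 4" where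
  "mat4 f = (\<chi> i j. f i j)"

text \<open>The matrix \<open>a\<close> makes the 14 normalized coefficients of
  \<open>\<omega>\<close> and of the Lie derivative agree, by solving the equations
  \<open>cf_lie_eta0\<close>. They determine \<open>a\<close> up to the two-dimensional stabilizer
  of \<open>eta0\<close>; the entries \<open>(2, 3)\<close> and \<open>(3, 3)\<close> are set to
  zero.\<close>

theorem eta0_rigid: "infinitesimally_rigid 2 eta0"
  unfolding infinitesimally_rigid_def
proof (intro allI impI, elim conjE)
  fix \<omega> :: "(4, complex) form1"
  assume tw: "\<omega> \<in> twisted_forms 2" and W: "\<forall>i j k. lin_wedge eta0 \<omega> i j k = 0"
  define A B C where "A = cf (\<omega> $ 0) 0 0 2 1" and "B = cf (\<omega> $ 0) 0 1 0 2" and "C = cf (\<omega> $ 1) 0 1 1 1"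
  define a00 where "a00 = (2 * B - 2 / 3 * A - C) / 10"
  define a10 where "a10 = - cf (\<omega> $ 0) 1 0 0 2 / 2"
  define a32 where "a32 = - cf (\<omega> $ 0) 0 0 3 0 / 3"
  define a where "a = mat4 (\<lambda>i j.
    if (i, j) = (3, 0) then cf (\<omega> $ 0) 0 2 1 0 / 4
    else if (i, j) = (3, 1) then - cf (\<omega> $ 0) 0 1 2 0 / 3
    else if (i, j) = (2, 0) then cf (\<omega> $ 0) 1 0 1 1 / 3
    else if (i, j) = (3, 2) then a32
    else if (i, j) = (1, 0) then a10
    else if (i, j) = (2, 1) then - (cf (\<omega> $ 0) 0 1 1 1 - 4 * a10 - 8 * a32) / 6
    else if (i, j) = (0, 0) then a00
    else if (i, j) = (1, 1) then B / 4 - a00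
    else if (i, j) = (2, 2) then - (A + 3 * a00) / 6
    else if (i, j) = (1, 2) then cf (\<omega> $ 0) 0 0 1 2 / 4
    else if (i, j) = (0, 1) then (cf (\<omega> $ 0) 0 0 1 2 - cf (\<omega> $ 1) 0 0 2 1) / 3
    else if (i, j) = (1, 3) then cf (\<omega> $ 0) 0 0 0 3 / 4
    else if (i, j) = (0, 2) then (cf (\<omega> $ 0) 0 0 0 3 - cf (\<omega> $ 1) 0 0 1 2) / 6
    else if (i, j) = (0, 3) then - cf (\<omega> $ 1) 0 0 0 3 / 6
    else 0)"
  have "\<omega> - lie a eta0 = 0"
  proof (rule normalized_deformation_zero)
    show "\<omega> - lie a eta0 \<in> twisted_forms 2"
      by (rule twisted_diff[OF tw lie_deformation(1)[OF eta0_twisted eta0_integrable]])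
    show "lin_wedge eta0 (\<omega> - lie a eta0) i j k = 0" for i j k
      using W lie_deformation(2)[OF eta0_twisted eta0_integrable] by (simp add: lin_wedge_diff)
  qed (simp_all add: cf_minus cf_lie_eta0 a_def mat4_def A_def B_def C_def a00_def a10_def a32_def field_simps)
  then show "\<exists>a. \<omega> = lie a eta0" by (intro exI[of _ a]) simp
qed

section \<open>Binary quartics with a root at a given point\<close>

subsection \<open>Invariance of the form\<close>

lemma UNIV_five: "(UNIV :: 5 set) = {0, 1, 2, 3, 4}"
proof -
  have "card {0, 1, 2, 3, 4 :: 5} = card (UNIV :: 5 set)" by simp
  then show ?thesis using card_subset_eq[of "UNIV :: 5 set" "{0, 1, 2, 3, 4}"] by simp
qed

lemma sum_five: "sum f (UNIV :: 5 set) = f 0 + f 1 + f 2 + f 3 + f 4"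
  unfolding UNIV_five by (simp add: add.assoc)

lemma all_five: "(\<forall>i :: 5. P i) \<longleftrightarrow> P 0 \<and> P 1 \<and> P 2 \<and> P 3 \<and> P 4"
proof -
  have "(\<forall>i :: 5. P i) \<longleftrightarrow> (\<forall>i\<in>UNIV. P i)" by simp
  then show ?thesis unfolding UNIV_five by simp
qed

definition Qv :: "complex ^ 5 \<Rightarrow> complex" where
  "Qv y = y $ 0 * y $ 4 - 4 * y $ 1 * y $ 3 + 3 * (y $ 2)\<^sup>2"

definition Cv :: "complex ^ 5 \<Rightarrow> complex" where
  "Cv y = y $ 0 * y $ 2 * y $ 4 - y $ 0 * (y $ 3)\<^sup>2 + 2 * y $ 1 * y $ 2 * y $ 3 - (y $ 1)\<^sup>2 * y $ 4 - (y $ 2) ^ 3"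

definition vec5 :: "complex \<Rightarrow> complex \<Rightarrow> complex \<Rightarrow> complex \<Rightarrow> complex \<Rightarrow> complex ^ 5" where
  "vec5 a b c d e = (\<chi> i. if i = 0 then a else if i = 1 then b else if i = 2 then c else if i = 3 then d else e)"

lemma vec5_nth [simp]:
  "vec5 a b c d e $ 0 = a" "vec5 a b c d e $ 1 = b" "vec5 a b c d e $ 2 = c" "vec5 a b c d e $ 3 = d" "vec5 a b c d e $ 4 = e"
  by (simp_all add: vec5_def)

definition dQv :: "complex ^ 5 \<Rightarrow> complex ^ 5" where
  "dQv y = vec5 (y $ 4) (- 4 * y $ 3) (6 * y $ 2) (- 4 * y $ 1) (y $ 0)"

definition dCv :: "complex ^ 5 \<Rightarrow> complex ^ 5" where
  "dCv y = vec5 (y $ 2 * y $ 4 - (y $ 3)\<^sup>2) (2 * y $ 2 * y $ 3 - 2 * y $ 1 * y $ 4)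
    (y $ 0 * y $ 4 + 2 * y $ 1 * y $ 3 - 3 * (y $ 2)\<^sup>2) (2 * y $ 1 * y $ 2 - 2 * y $ 0 * y $ 3) (y $ 0 * y $ 2 - (y $ 1)\<^sup>2)"

lemma peval_quartic_form: "peval (($) y) (quartic_form $ i) = 2 * Qv y * dCv y $ i - 3 * Cv y * dQv y $ i"
proof -
  have Q: "peval (($) y) Q_inv = Qv y" and C: "peval (($) y) C_inv = Cv y"
    by (simp_all add: Q_inv_def C_inv_def Qv_def Cv_def peval_simps)
  have "\<forall>i. peval (($) y) (pdiff i Q_inv) = dQv y $ i"
    unfolding all_five by (simp add: Q_inv_def dQv_def pdiff_simps pdiff_power peval_simps)
  moreover have "\<forall>i. peval (($) y) (pdiff i C_inv) = dCv y $ i"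
    unfolding all_five by (simp add: C_inv_def dCv_def pdiff_simps pdiff_power peval_simps algebra_simps power2_eq_square)
  ultimately show ?thesis by (simp add: quartic_form_def ext_deriv_def peval_simps Q C)
qed

text \<open>Invariance of \<open>Q\<close> and \<open>C\<close> under a linear substitution,
  together with the equations for the gradients that the chain rule gives, evaluated as
  functions.\<close>

definition preserves_form :: "complex ^ 5 ^ 5 \<Rightarrow> bool" where
  "preserves_form S \<longleftrightarrow> (\<forall>y. Qv (S *v y) = Qv y \<and> Cv (S *v y) = Cv y \<and>
     dQv (S *v y) v* S = dQv y \<and> dCv (S *v y) v* S = dCv y)"

lemma preserves_formD:
  assumes "preserves_form S"
  shows "(\<Sum>k\<in>UNIV. peval (($) (S *v y)) (quartic_form $ k) * S $ k $ i) = peval (($) y) (quartic_form $ i)"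
proof -
  have 1: "dQv y $ i = (\<Sum>k\<in>UNIV. dQv (S *v y) $ k * S $ k $ i)" "dCv y $ i = (\<Sum>k\<in>UNIV. dCv (S *v y) $ k * S $ k $ i)"
  proof -
    have "dQv y $ i = (dQv (S *v y) v* S) $ i" "dCv y $ i = (dCv (S *v y) v* S) $ i"
      using assms by (simp_all add: preserves_form_def)
    then show "dQv y $ i = (\<Sum>k\<in>UNIV. dQv (S *v y) $ k * S $ k $ i)" "dCv y $ i = (\<Sum>k\<in>UNIV. dCv (S *v y) $ k * S $ k $ i)"
      by (simp_all add: vector_matrix_mult_def mult.commute)
  qed
  have 2: "Qv (S *v y) = Qv y" "Cv (S *v y) = Cv y" using assms by (simp_all add: preserves_form_def)
  show ?thesis unfolding peval_quartic_form 1 2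
    by (simp add: left_diff_distrib sum_subtractf sum_distrib_left mult.assoc)
qed

text \<open>The action of \<open>t\<^sub>0 \<mapsto> t\<^sub>0 - c t\<^sub>1\<close> on the
  coefficients of a quartic.\<close>

definition shear :: "complex \<Rightarrow> complex ^ 5 ^ 5" where
  "shear c = (\<chi> i. if i = 0 then vec5 1 0 0 0 0 else if i = 1 then vec5 (- c) 1 0 0 0
     else if i = 2 then vec5 (c\<^sup>2) (- 2 * c) 1 0 0 else if i = 3 then vec5 (- (c ^ 3)) (3 * c\<^sup>2) (- 3 * c) 1 0
     else vec5 (c ^ 4) (- 4 * c ^ 3) (6 * c\<^sup>2) (- 4 * c) 1)"

lemma shear_rows:
  "shear c $ 0 = vec5 1 0 0 0 0" "shear c $ 1 = vec5 (- c) 1 0 0 0" "shear c $ 2 = vec5 (c\<^sup>2) (- 2 * c) 1 0 0"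
  "shear c $ 3 = vec5 (- (c ^ 3)) (3 * c\<^sup>2) (- 3 * c) 1 0"
  "shear c $ 4 = vec5 (c ^ 4) (- 4 * c ^ 3) (6 * c\<^sup>2) (- 4 * c) 1"
  by (simp_all add: shear_def)

lemma shear_apply:
  "(shear c *v y) $ 0 = y $ 0"
  "(shear c *v y) $ 1 = y $ 1 - c * y $ 0"
  "(shear c *v y) $ 2 = y $ 2 - 2 * c * y $ 1 + c\<^sup>2 * y $ 0"
  "(shear c *v y) $ 3 = y $ 3 - 3 * c * y $ 2 + 3 * c\<^sup>2 * y $ 1 - c ^ 3 * y $ 0"
  "(shear c *v y) $ 4 = y $ 4 - 4 * c * y $ 3 + 6 * c\<^sup>2 * y $ 2 - 4 * c ^ 3 * y $ 1 + c ^ 4 * y $ 0"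
  by (simp_all add: matrix_vector_mult_def sum_five shear_rows)

lemma shear_preserves: "preserves_form (shear c)"
  unfolding preserves_form_def
proof (intro allI conjI)
  fix y :: "complex ^ 5"
  show "Qv (shear c *v y) = Qv y"
    unfolding Qv_def shear_apply by algebra
  show "Cv (shear c *v y) = Cv y"
    unfolding Cv_def shear_apply by algebra
  show "dQv (shear c *v y) v* shear c = dQv y"
    unfolding vec_eq_iff all_five vector_matrix_mult_def sum_five vec_lambda_beta shear_rows dQv_def vec5_nth shear_apply
    by (simp add: algebra_simps power2_eq_square power3_eq_cube power4_eq_xxxx)
  show "dCv (shear c *v y) v* shear c = dCv y"
    unfolding vec_eq_iff all_five vector_matrix_mult_def sum_five vec_lambda_beta shear_rows dCv_def vec5_nth shear_apply
    by (simp add: algebra_simps power2_eq_square power3_eq_cube power4_eq_xxxx)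
qed

lemma shear_inj: "shear c *v y = 0 \<Longrightarrow> y = 0"
proof -
  assume "shear c *v y = 0"
  then have z: "(shear c *v y) $ i = 0" for i by simp
  have y0: "y $ 0 = 0" using z[of 0] by (simp add: shear_apply)
  have y1: "y $ 1 = 0" using z[of 1] y0 by (simp add: shear_apply)
  have y2: "y $ 2 = 0" using z[of 2] y0 y1 by (simp add: shear_apply)
  have y3: "y $ 3 = 0" using z[of 3] y0 y1 y2 by (simp add: shear_apply)
  have y4: "y $ 4 = 0" using z[of 4] y0 y1 y2 y3 by (simp add: shear_apply)
  show "y = 0" unfolding vec_eq_iff all_five by (simp add: y0 y1 y2 y3 y4)
qed

text \<open>The action of exchanging \<open>t\<^sub>0\<close> and \<open>t\<^sub>1\<close> on the
  coefficients of a quartic.\<close>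

definition reversal :: "complex ^ 5 ^ 5" where
  "reversal = (\<chi> i. if i = 0 then vec5 0 0 0 0 1 else if i = 1 then vec5 0 0 0 1 0
     else if i = 2 then vec5 0 0 1 0 0 else if i = 3 then vec5 0 1 0 0 0 else vec5 1 0 0 0 0)"

lemma reversal_rows:
  "reversal $ 0 = vec5 0 0 0 0 1" "reversal $ 1 = vec5 0 0 0 1 0" "reversal $ 2 = vec5 0 0 1 0 0"
  "reversal $ 3 = vec5 0 1 0 0 0" "reversal $ 4 = vec5 1 0 0 0 0"
  by (simp_all add: reversal_def)

lemma reversal_apply:
  "(reversal *v y) $ 0 = y $ 4" "(reversal *v y) $ 1 = y $ 3" "(reversal *v y) $ 2 = y $ 2"
  "(reversal *v y) $ 3 = y $ 1" "(reversal *v y) $ 4 = y $ 0"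
  by (simp_all add: matrix_vector_mult_def sum_five reversal_rows)

lemma reversal_preserves: "preserves_form reversal"
  unfolding preserves_form_def
proof (intro allI conjI)
  fix y :: "complex ^ 5"
  show "Qv (reversal *v y) = Qv y"
    unfolding Qv_def reversal_apply by algebra
  show "Cv (reversal *v y) = Cv y"
    unfolding Cv_def reversal_apply by algebra
  show "dQv (reversal *v y) v* reversal = dQv y"
    unfolding vec_eq_iff all_five vector_matrix_mult_def sum_five vec_lambda_beta reversal_rows dQv_def vec5_nth reversal_apply
    by (simp add: algebra_simps power2_eq_square power3_eq_cube power4_eq_xxxx)
  show "dCv (reversal *v y) v* reversal = dCv y"
    unfolding vec_eq_iff all_five vector_matrix_mult_def sum_five vec_lambda_beta reversal_rows dCv_def vec5_nth reversal_apply
    by (simp add: algebra_simps power2_eq_square power3_eq_cube power4_eq_xxxx)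
qed

lemma reversal_inj: "reversal *v y = 0 \<Longrightarrow> y = 0"
proof -
  assume "reversal *v y = 0"
  then have "\<forall>i. (reversal *v y) $ i = 0" by simp
  then show "y = 0" unfolding all_five reversal_apply vec_eq_iff by simp
qed

subsection \<open>The restriction to an osculating hyperplane\<close>

lemma homog_1_expand:
  fixes p :: "('v::finite, 'a::comm_ring_1) mpoly"
  assumes "homog 1 p"
  shows "p = (\<Sum>v\<in>UNIV. Const (lookup p (single v 1)) * Var v)"
proof (rule poly_mapping_eqI)
  fix m
  have C: "Const c * Var v = single (single v 1) c" for c :: 'a and v :: 'v
    by (simp add: Const_def Var_def mult_single)
  have R: "lookup (\<Sum>v\<in>UNIV. Const (lookup p (single v 1)) * Var v) m
      = (\<Sum>v\<in>UNIV. if single v 1 = m then lookup p m else 0)"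
    unfolding C lookup_sum by (rule sum.cong) (auto simp: lookup_single when_def)
  show "lookup p m = lookup (\<Sum>v\<in>UNIV. Const (lookup p (single v 1)) * Var v) m"
  proof (cases "\<exists>v. m = single v 1")
    case True
    then obtain u where u: "m = single u 1" by blast
    have "single v (1::nat) = m \<longleftrightarrow> v = u" for v
      unfolding u by (metis lookup_single_eq lookup_single_not_eq one_neq_zero)
    then show ?thesis unfolding R by simp
  next
    case False
    have "mdeg m \<noteq> 1"
    proof
      assume d: "mdeg m = 1"
      then have "keys m \<noteq> {}" by (auto simp: mdeg_def)
      then obtain v where "v \<in> keys m" by blast
      then have v: "lookup m v > 0" by (simp add: in_keys_iff)
      have "m = single v 1 + (m - single v 1)"
        by (rule poly_mapping_eqI) (use v in \<open>auto simp: lookup_add lookup_minus lookup_single when_def\<close>)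
      moreover from this have "mdeg (m - single v 1) = 0" using d mdeg_add[of "single v 1" "m - single v 1"] by simp
      then have "m - single v 1 = 0"
        by (intro poly_mapping_eqI) (auto simp: mdeg_def in_keys_iff)
      ultimately have "m = single v 1" by (metis add.right_neutral)
      then show False using False by blast
    qed
    then have "lookup p m = 0" using homogD[OF assms] by blast
    moreover have "(\<Sum>v\<in>UNIV. if single v 1 = m then lookup p m else 0) = 0"
      using False by (intro sum.neutral) auto
    ultimately show ?thesis unfolding R by simp
  qed
qed

lemma peval_binary_quartic:
  "peval z (binary_quartic a) = a $ 0 * z 0 ^ 4 + 4 * a $ 1 * z 0 ^ 3 * z 1 + 6 * a $ 2 * (z 0)\<^sup>2 * (z 1)\<^sup>2
    + 4 * a $ 3 * z 0 * z 1 ^ 3 + a $ 4 * z 1 ^ 4"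
proof -
  have S: "{..4::nat} = {0, 1, 2, 3, 4}" by auto
  have c: "(4::nat) choose 2 = 6" "(4::nat) choose 3 = 4" "(4::nat) choose 4 = 1" "(4::nat) choose 1 = 4"
    by (simp_all add: numeral_eq_Suc)
  show ?thesis
    unfolding binary_quartic_def S by (simp add: peval_simps c)
qed

text \<open>A quartic divisible by \<open>p\<close> vanishes at the root of \<open>p\<close>. A
  substitution that moves this root to a coordinate point makes the vanishing the equation
  \<open>a\<^sub>4 = 0\<close>.\<close>

lemma hyperplane_normalization:
  assumes p: "homog 1 p" "p \<noteq> 0"
  shows "\<exists>S. preserves_form S \<and> (\<forall>y. S *v y = 0 \<longrightarrow> y = 0) \<and>
    (\<forall>a\<in>insert 0 (osculating_cone p). (S *v a) $ 4 = 0)"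
proof -
  define \<alpha> \<beta> where "\<alpha> = lookup p (single 0 1)" and "\<beta> = lookup p (single 1 1)"
  have U: "(UNIV :: 2 set) = {0, 1}"
  proof -
    have 2: "(2 :: 2) = 0" by simp
    show ?thesis unfolding UNIV_2 2 by blast
  qed
  have pe: "p = Const \<alpha> * Var 0 + Const \<beta> * Var 1"
    using homog_1_expand[OF p(1)] unfolding U \<alpha>_def \<beta>_def by simp
  have cone: "peval z (binary_quartic a) = 0" if "a \<in> insert 0 (osculating_cone p)" "\<alpha> * z 0 + \<beta> * z 1 = 0" for a z
  proof (cases "a = 0")
    case True
    then show ?thesis by (simp add: peval_binary_quartic)
  next
    case False
    then have "a \<in> osculating_cone p" using that(1) by simp
    then obtain q r s where "binary_quartic a = p * q * r * s" unfolding osculating_cone_def by blast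
    moreover have "peval z p = 0" using that(2) by (subst pe) (simp add: peval_simps)
    ultimately show ?thesis by (simp add: peval_simps)
  qed
  show ?thesis
  proof (cases "\<alpha> = 0")
    case True
    have "(reversal *v a) $ 4 = 0" if "a \<in> insert 0 (osculating_cone p)" for a
      using cone[OF that, of "\<lambda>i. if i = 0 then 1 else 0"] True by (simp add: peval_binary_quartic reversal_apply)
    then show ?thesis using reversal_preserves reversal_inj by blast
  next
    case False
    have "(shear (\<beta> / \<alpha>) *v a) $ 4 = 0" if "a \<in> insert 0 (osculating_cone p)" for a
      using cone[OF that, of "\<lambda>i. if i = 0 then \<beta> / \<alpha> else - 1"] False
      by (simp add: peval_binary_quartic shear_apply algebra_simps)
    then show ?thesis using shear_preserves shear_inj by blast
  qed
qed

lemma quartic_form_on_hyperplane: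
  fixes y :: "complex ^ 5" and z :: "complex ^ 4"
  assumes "y $ 0 = z $ 0" "y $ 1 = z $ 1" "y $ 2 = z $ 2" "y $ 3 = z $ 3" "y $ 4 = 0"
  shows "peval (($) y) (quartic_form $ 0) = 2 * z $ 3 * peval (($) z) (eta0 $ 0)"
    "peval (($) y) (quartic_form $ 1) = 2 * z $ 3 * peval (($) z) (eta0 $ 1)"
    "peval (($) y) (quartic_form $ 2) = 2 * z $ 3 * peval (($) z) (eta0 $ 2)"
    "peval (($) y) (quartic_form $ 3) = 2 * z $ 3 * peval (($) z) (eta0 $ 3)"
  unfolding peval_quartic_form Qv_def Cv_def dQv_def dCv_def vec5_nth eta0_simps peval_simps assms by algebra+

text \<open>The parametrization followed by the normalizing substitution has image in
  \<open>a\<^sub>4 = 0\<close>, and dropping the last coordinate leaves an invertible matrix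
  \<open>B\<close>.\<close>

lemma restriction_to_hyperplane:
  fixes A :: "complex ^ 4 ^ 5" and S :: "complex ^ 5 ^ 5"
  assumes S: "preserves_form S" "\<And>y. S *v y = 0 \<Longrightarrow> y = 0" and A: "inj ((*v) A)"
    and 4: "\<And>x. (S *v (A *v x)) $ 4 = 0"
  shows "\<exists>B. invertible B \<and> pullback (linear_map A) quartic_form = (2 * linear_map B $ 3) *s pull B eta0"
proof -
  define M where "M = S ** A"
  define B :: "complex ^ 4 ^ 4" where
    "B = (\<chi> k j. if k = 0 then M $ 0 $ j else if k = 1 then M $ 1 $ j else if k = 2 then M $ 2 $ j else M $ 3 $ j)"
  have Bn: "B $ 0 = M $ 0" "B $ 1 = M $ 1" "B $ 2 = M $ 2" "B $ 3 = M $ 3"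
    by (simp_all add: B_def vec_eq_iff)
  have SA: "S *v (A *v x) = M *v x" for x by (simp add: M_def matrix_vector_mul_assoc)
  have Bv: "(M *v x) $ 0 = (B *v x) $ 0" "(M *v x) $ 1 = (B *v x) $ 1" "(M *v x) $ 2 = (B *v x) $ 2" "(M *v x) $ 3 = (B *v x) $ 3" for x
    by (simp_all add: matrix_vector_mult_def Bn)
  have M4: "(M *v x) $ 4 = 0" for x using 4[of x] by (simp add: SA)
  have M4j: "M $ 4 $ j = 0" for j
    using M4[of "axis j 1"] by (simp add: matrix_vector_mult_def axis_def if_distrib cong: if_cong)
  have "x = 0" if "B *v x = 0" for x
  proof -
    have "\<forall>i. (M *v x) $ i = 0" unfolding all_five using that M4 by (simp add: Bv)
    then have "M *v x = 0" by (simp add: vec_eq_iff)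
    then have "A *v x = A *v 0" using S(2)[of "A *v x"] by (simp add: SA)
    then show ?thesis by (rule injD[OF A])
  qed
  then have "\<exists>D. D ** B = mat 1" unfolding matrix_left_invertible_ker by blast
  then have inv: "invertible B" by (simp add: invertible_left_inverse)
  have "pullback (linear_map A) quartic_form $ j = (2 * linear_map B $ 3) * pull B eta0 $ j" for j
  proof (rule peval_inj)
    fix x :: "4 \<Rightarrow> complex"
    let ?x = "\<chi> v. x v"
    have "peval x (pullback (linear_map A) quartic_form $ j)
        = (\<Sum>i\<in>UNIV. (\<Sum>k\<in>UNIV. peval (($) (M *v ?x)) (quartic_form $ k) * S $ k $ i) * A $ i $ j)"
      unfolding peval_pullback using preserves_formD[OF S(1), of "A *v ?x"] by (simp add: SA)
    also have "\<dots> = (\<Sum>k\<in>UNIV. peval (($) (M *v ?x)) (quartic_form $ k) * M $ k $ j)"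
      unfolding M_def matrix_matrix_mult_def sum_distrib_right vec_lambda_beta sum_distrib_left
      by (subst sum.swap) (simp add: algebra_simps)
    also have "\<dots> = 2 * (B *v ?x) $ 3 * (\<Sum>k\<in>UNIV. peval (($) (B *v ?x)) (eta0 $ k) * B $ k $ j)"
      unfolding sum_five sum_four M4j Bn
        quartic_form_on_hyperplane[of "M *v ?x" "B *v ?x", OF Bv M4]
      by (simp add: algebra_simps)
    also have "\<dots> = peval x ((2 * linear_map B $ 3) * pull B eta0 $ j)"
      by (simp add: peval_simps peval_pullback psubst_linear)
    finally show "peval x (pullback (linear_map A) quartic_form $ j) = peval x ((2 * linear_map B $ 3) * pull B eta0 $ j)" .
  qed
  then have "pullback (linear_map A) quartic_form = (2 * linear_map B $ 3) *s pull B eta0"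
    by (simp add: vec_eq_iff)
  then show ?thesis using inv by blast
qed

subsection \<open>Division by the codimension one zeros\<close>

lemma mpoly_no_zero_divisors:
  fixes p q :: "('v, complex) mpoly"
  assumes "p * q = 0" "q \<noteq> 0"
  shows "p = 0"
proof -
  obtain z where z: "peval z q \<noteq> 0" using assms(2) peval_inj_zero by blast
  show ?thesis
  proof (rule peval_inj_zero)
    fix x
    obtain a where a: "\<forall>t. peval (\<lambda>v. x v + t * (z v - x v)) p = poly a t"
      using peval_on_line[of x "\<lambda>v. z v - x v" p] by blast
    obtain b where b: "\<forall>t. peval (\<lambda>v. x v + t * (z v - x v)) q = poly b t"
      using peval_on_line[of x "\<lambda>v. z v - x v" q] by blast
    have "poly (a * b) t = 0" for t
    proof -
      have "peval (\<lambda>v. x v + t * (z v - x v)) (p * q) = 0" unfolding assms(1) by (simp add: peval_simps)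
      then show ?thesis using a b by (simp add: peval_simps)
    qed
    then have "a * b = 0" using poly_all_0_iff_0 by blast
    moreover have "poly b 1 \<noteq> 0" using b[rule_format, of 1] z by simp
    ultimately have "a = 0" by auto
    then show "peval x p = 0" using a[rule_format, of 0] by simp
  qed
qed

lemma Var_nonzero: "Var v \<noteq> (0 :: ('v, complex) mpoly)"
proof
  assume "Var v = (0 :: ('v, complex) mpoly)"
  then have "lookup (Var v :: ('v, complex) mpoly) (single v 1) = 0" by simp
  then show False by (simp add: Var_def)
qed

lemma nonvanishing_on_line:
  assumes "\<exists>q. \<forall>t. f t = poly q t" "\<And>t. f t \<noteq> 0"
  shows "f s = f (t :: complex)"
proof -
  obtain q where q: "\<forall>t. f t = poly q t" using assms(1) by blast
  then have "constant (poly q)" using fundamental_theorem_of_algebra[of q] assms(2) by auto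
  then show ?thesis using q by (simp add: constant_def)
qed

definition pt4 :: "complex \<Rightarrow> complex \<Rightarrow> complex \<Rightarrow> complex \<Rightarrow> 4 \<Rightarrow> complex" where
  "pt4 a b c d = (\<lambda>i. if i = 0 then a else if i = 1 then b else if i = 2 then c else d)"

lemma pt4_nth [simp]: "pt4 a b c d 0 = a" "pt4 a b c d 1 = b" "pt4 a b c d 2 = c" "pt4 a b c d 3 = d"
  by (simp_all add: pt4_def)

lemma eq_pt4: "y = pt4 (y 0) (y 1) (y 2) (y 3)"
  by (simp add: fun_eq_iff all_four)

text \<open>The form \<open>eta0\<close> vanishes only in codimension two. A divisor
  \<open>F\<close> of \<open>x\<^sub>3 eta0\<close> therefore has no zeros on general lines in the
  affine space \<open>x\<^sub>3 = 1\<close>, so it is constant on them by the fundamental theorem of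
  algebra; moving along such lines in coordinate directions, \<open>F\<close> is constant there and
  equals a multiple of \<open>x\<^sub>3\<^sup>k\<close>. As \<open>x\<^sub>3\<close> does not divide
  \<open>eta0\<close>, the exponent is one.\<close>

lemma divisor_of_eta0:
  assumes F: "homog k F" and div: "\<And>i. F * \<zeta> $ i = 2 * \<x> 3 * eta0 $ i" and k: "k \<ge> 1"
  shows "\<exists>c. c \<noteq> 0 \<and> \<zeta> = Const c *s eta0"
proof -
  define f where "f a b c = peval (pt4 a b c 1) F" for a b c
  have val: "peval y F * peval y (\<zeta> $ i) = 2 * y 3 * peval y (eta0 $ i)" for y i
    using arg_cong[OF div[of i], of "peval y"] by (simp add: peval_simps)
  \<comment> \<open>The inequalities say that one of the first two coefficients of \<open>eta0\<close> is nonzero.\<close>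
  have nz: "f a b c \<noteq> 0" if "4 * b \<noteq> 3 * c\<^sup>2 \<or> 2 * b * c \<noteq> 3 * a" for a b c
  proof
    assume "f a b c = 0"
    then have "peval (pt4 a b c 1) (eta0 $ 0) = 0" "peval (pt4 a b c 1) (eta0 $ 1) = 0"
      using val[of "pt4 a b c 1" 0] val[of "pt4 a b c 1" 1] by (simp_all add: f_def)
    then have "4 * b - 3 * c\<^sup>2 = 0" "4 * (b * c) - 6 * a = 0"
      by (simp_all add: eta0_simps peval_simps power2_eq_square)
    then show False using that by (auto simp: mult.assoc)
  qed
  have pl: "\<exists>q. \<forall>t. peval (pt4 (a + t * a') (b + t * b') (c + t * c') 1) F = poly q t" for a a' b b' c c'
  proof -
    have e: "pt4 (a + t * a') (b + t * b') (c + t * c') 1 = (\<lambda>v. pt4 a b c 1 v + t * pt4 a' b' c' 0 v)" for t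
      by (simp add: fun_eq_iff all_four)
    show ?thesis unfolding e by (rule peval_on_line)
  qed
  have mv1: "f a b c = f a' b c" if "4 * b \<noteq> 3 * c\<^sup>2" for a a' b c
  proof (rule nonvanishing_on_line[where f = "\<lambda>t. f t b c"])
    show "\<exists>q. \<forall>t. f t b c = poly q t" using pl[of 0 1 b 0 c 0] by (simp add: f_def)
    show "f t b c \<noteq> 0" for t using nz that by blast
  qed
  have mv2: "f a b c = f a b' c" if "2 * a \<noteq> c ^ 3" for a b b' c
  proof (rule nonvanishing_on_line[where f = "\<lambda>t. f a t c"])
    show "\<exists>q. \<forall>t. f a t c = poly q t" using pl[of a 0 0 1 c 0] by (simp add: f_def)
    fix t
    have "2 * a = c ^ 3" if "4 * t = 3 * c\<^sup>2" "2 * t * c = 3 * a" using that by algebra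
    then show "f a t c \<noteq> 0" using nz that by blast
  qed
  have mv3: "f a 0 c = f a 0 c'" if "a \<noteq> 0" for a c c'
  proof (rule nonvanishing_on_line[where f = "\<lambda>t. f a 0 t"])
    show "\<exists>q. \<forall>t. f a 0 t = poly q t" using pl[of a 0 0 0 0 1] by (simp add: f_def)
    show "f a 0 t \<noteq> 0" for t using nz[of 0 t a] that by simp
  qed
  define C where "C = f 1 0 1"
  have C0: "C \<noteq> 0" unfolding C_def by (rule nz) simp
  have const: "f a b c = C" if "4 * b \<noteq> 3 * c\<^sup>2" for a b c
  proof -
    \<comment> \<open>Moving first to \<open>a1\<close> keeps the following two segments away from the zeros of \<open>eta0\<close>.\<close>
    obtain a1 :: complex where a1: "a1 \<notin> {0, c ^ 3 / 2}" using ex_new_if_finite[OF infinite_UNIV_char_0] by (metis finite.emptyI finite.insertI)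
    then have n: "a1 \<noteq> 0" "2 * a1 \<noteq> c ^ 3" by (auto simp: field_simps)
    have "f a b c = f a1 b c" by (rule mv1[OF that])
    also have "\<dots> = f a1 0 c" by (rule mv2[OF n(2)])
    also have "\<dots> = f a1 0 1" by (rule mv3[OF n(1)])
    also have "\<dots> = f 1 0 1" by (rule mv1) simp
    finally show ?thesis by (simp add: C_def)
  qed
  have "(F - Const C * \<x> 3 ^ k) * eta0 $ 0 = 0"
  proof (rule peval_inj_zero)
    fix y :: "4 \<Rightarrow> complex"
    define a b c d where "a = y 0" and "b = y 1" and "c = y 2" and "d = y 3"
    have y: "y = pt4 a b c d" unfolding a_def b_def c_def d_def by (rule eq_pt4)
    have e: "peval y (eta0 $ 0) = d * (4 * b * d - 3 * c\<^sup>2)"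
      by (simp add: eta0_simps peval_simps y power2_eq_square algebra_simps)
    show "peval y ((F - Const C * \<x> 3 ^ k) * eta0 $ 0) = 0"
    proof (cases "peval y (eta0 $ 0) = 0")
      case False
      then have d: "d \<noteq> 0" and g: "4 * b * d \<noteq> 3 * c\<^sup>2" by (auto simp: e)
      have "4 * (b / d) \<noteq> 3 * (c / d)\<^sup>2" using d g by (simp add: field_simps power2_eq_square)
      then have "f (a / d) (b / d) (c / d) = C" by (rule const)
      moreover have "y = (\<lambda>v. d * pt4 (a / d) (b / d) (c / d) 1 v)"
        unfolding y using d by (simp add: fun_eq_iff all_four)
      ultimately have "peval y F = d ^ k * C" using peval_scale[OF F, of d "pt4 (a / d) (b / d) (c / d) 1"] by (simp add: f_def)
      then show ?thesis by (simp add: peval_simps y)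
    qed (simp add: peval_simps)
  qed
  moreover have "eta0 $ 0 \<noteq> 0"
  proof
    assume "eta0 $ 0 = 0"
    then have "peval (pt4 0 1 0 1) (eta0 $ 0) = 0" by (simp add: peval_simps)
    then show False by (simp add: eta0_simps peval_simps)
  qed
  ultimately have "F - Const C * \<x> 3 ^ k = 0" by (rule mpoly_no_zero_divisors)
  then have FC: "F = Const C * \<x> 3 ^ k" by simp
  obtain k' where k': "k = Suc k'" using k by (cases k) auto
  have x3: "\<x> 3 \<noteq> 0" by (rule Var_nonzero)
  have Z: "Const C * \<x> 3 ^ k' * \<zeta> $ i = 2 * eta0 $ i" for i
  proof -
    have "(Const C * \<x> 3 ^ k' * \<zeta> $ i - 2 * eta0 $ i) * \<x> 3 = 0"
      using div[of i] unfolding FC k' by (simp add: algebra_simps)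
    then have "Const C * \<x> 3 ^ k' * \<zeta> $ i - 2 * eta0 $ i = 0" by (rule mpoly_no_zero_divisors[OF _ x3])
    then show ?thesis by simp
  qed
  have "k' = 0"
  proof (rule ccontr)
    assume "k' \<noteq> 0"
    then have "peval (pt4 0 1 1 0) (Const C * \<x> 3 ^ k' * \<zeta> $ 3) = 0" by (simp add: peval_simps)
    then show False unfolding Z by (simp add: peval_simps eta0_simps)
  qed
  then have z: "Const C * \<zeta> $ i = 2 * eta0 $ i" for i using Z[of i] by simp
  have "\<zeta> $ i = Const (2 / C) * eta0 $ i" for i
  proof -
    have "Const (inverse C) * (Const C * \<zeta> $ i) = Const (inverse C) * (Const 2 * eta0 $ i)"
      unfolding z by (simp add: Const_numeral)
    then show ?thesis using C0 by (simp add: mult.assoc[symmetric] Const_mult[symmetric] divide_inverse mult.commute)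
  qed
  then have "\<zeta> = Const (2 / C) *s eta0" by (simp add: vec_eq_iff)
  then show ?thesis using C0 by (intro exI[of _ "2 / C"]) simp
qed

lemma pull_smult: "pull g (f *s \<omega>) = psubst (($) (linear_map g)) f *s pull g \<omega>"
  by (simp add: vec_eq_iff pullback_linear psubst_simps sum_distrib_left mult.assoc)

text \<open>The linear form \<open>x\<^sub>3\<close> pulled back by \<open>B\<close> divides the
  restricted form, so the divisor of maximal degree has positive degree. Pulling everything back by
  the inverse of \<open>B\<close> reduces to \<open>divisor_of_eta0\<close>.\<close>

lemma codim1_quotient_eta0:
  assumes B: "invertible B" and q: "codim1_quotient ((2 * linear_map B $ 3) *s pull B eta0) \<eta>"
  shows "\<exists>c. c \<noteq> 0 \<and> \<eta> = Const c *s pull B eta0"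
proof -
  obtain D where D: "B ** D = mat 1" "D ** B = mat 1" using B by (auto simp: invertible_def)
  let ?D = "psubst (($) (linear_map D))"
  obtain F k where F: "homog k F" "(2 * linear_map B $ 3) *s pull B eta0 = F *s \<eta>"
    and max: "\<forall>G l. homog l G \<and> G \<noteq> 0 \<and> (\<forall>i. G dvd ((2 * linear_map B $ 3) *s pull B eta0) $ i) \<longrightarrow> l \<le> k"
    using q unfolding codim1_quotient_def by blast
  have L: "?D (linear_map B $ 3) = \<x> 3"
  proof (rule peval_inj)
    fix x
    have "peval x (?D (linear_map B $ 3)) = (B *v (D *v (\<chi> v. x v))) $ 3"
      by (simp add: peval_psubst psubst_linear matrix_vector_mul_assoc)
    then show "peval x (?D (linear_map B $ 3)) = peval x (\<x> 3)" by (simp add: matrix_vector_mul_assoc D peval_simps)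
  qed
  have "linear_map B $ 3 \<noteq> 0"
  proof
    assume "linear_map B $ 3 = 0"
    then have "\<x> 3 = 0" using L by (simp add: psubst_simps)
    then show False by (simp add: Var_nonzero)
  qed
  moreover have "linear_map B $ 3 dvd ((2 * linear_map B $ 3) *s pull B eta0) $ i" for i
  proof (rule dvdI)
    show "((2 * linear_map B $ 3) *s pull B eta0) $ i = linear_map B $ 3 * (2 * pull B eta0 $ i)"
      by (simp add: mult.assoc mult.left_commute)
  qed
  ultimately have k: "1 \<le> k" using max homog_linear_map[of B 3] by blast
  have "pull D ((2 * linear_map B $ 3) *s pull B eta0) = (2 * \<x> 3) *s eta0"
    unfolding pull_smult pullback_compose D pullback_id by (simp add: psubst_simps L)
  then have e: "?D F *s pull D \<eta> = (2 * \<x> 3) *s eta0"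
    unfolding F(2) pull_smult .
  have e': "?D F * pull D \<eta> $ i = 2 * \<x> 3 * eta0 $ i" for i
    using arg_cong[OF e, of "\<lambda>w. w $ i"] by (simp only: vector_smult_component)
  have h: "homog k (?D F)" by (rule homog_psubst[OF F(1) homog_linear_map])
  have "\<exists>c. c \<noteq> 0 \<and> pull D \<eta> = Const c *s eta0" by (rule divisor_of_eta0[OF h e' k])
  then obtain c where c: "c \<noteq> 0" "pull D \<eta> = Const c *s eta0" by (elim exE conjE)
  have "\<eta> = pull B (pull D \<eta>)" by (simp add: pullback_compose D pullback_id)
  also have "\<dots> = Const c *s pull B eta0" unfolding c(2) by (rule pullback_scale)
  finally show ?thesis using c(1) by blast
qed

lemma orbit_eq:
  assumes B: "invertible B" and c: "c \<noteq> 0"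
  shows "orbit (Const c *s pull B \<omega>) = orbit \<omega>"
proof -
  have e: "proj_pt (pull g (Const c *s pull B \<omega>)) = proj_pt (pull (B ** g) \<omega>)" for g
    by (simp add: pullback_scale pullback_compose proj_pt_scale[OF c])
  obtain D where D: "B ** D = mat 1" "D ** B = mat 1" using B by (auto simp: invertible_def)
  have Di: "invertible D" using D by (auto simp: invertible_def)
  have "\<exists>g'. invertible g' \<and> B ** g' = g" if "invertible g" for g
    using invertible_mult[OF Di that] D by (intro exI[of _ "D ** g"]) (simp add: matrix_mul_assoc)
  then show ?thesis using invertible_mult[OF B] unfolding orbit_def e by (metis (no_types, lifting))
qed

theorem mainTheorem1:
  fixes p :: "(2, complex) mpoly"
    and A :: "complex ^ 4 ^ 5"
    and eta :: "(4, complex) form1"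
  assumes "homog 1 p" and "p \<noteq> 0"
    and "bij_betw ((*v) A) UNIV (insert 0 (osculating_cone p))"
    and "codim1_quotient (pullback (linear_map A) quartic_form) eta"
  shows "irreducible_component_of (subtopology (zariski 2) (foliations 2))
           (zariski 2 closure_of orbit eta)
       \<and> reduced_at_generic_point 2 (zariski 2 closure_of orbit eta)"
proof -
  obtain S where S: "preserves_form S" "\<And>y. S *v y = 0 \<Longrightarrow> y = 0"
    "\<And>a. a \<in> insert 0 (osculating_cone p) \<Longrightarrow> (S *v a) $ 4 = 0"
    using hyperplane_normalization[OF assms(1,2)] by blast
  have A: "inj ((*v) A)" using assms(3) by (rule bij_betw_imp_inj_on)
  have range: "A *v x \<in> insert 0 (osculating_cone p)" for x
    using assms(3) by (auto simp: bij_betw_def)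
  obtain B where B: "invertible B" "pullback (linear_map A) quartic_form = (2 * linear_map B $ 3) *s pull B eta0"
    using restriction_to_hyperplane[OF S(1,2) A S(3)[OF range]] by blast
  obtain c where c: "c \<noteq> 0" "eta = Const c *s pull B eta0"
    using codim1_quotient_eta0[OF B(1)] assms(4) unfolding B(2) by blast
  have orb: "orbit eta = orbit eta0" unfolding c(2) by (rule orbit_eq[OF B(1) c(1)])
  interpret twisted_form 2 eta0
    by standard (rule eta0_twisted eta0_nonzero eta0_integrable)+
  show ?thesis unfolding orb using rigid_component[OF eta0_rigid] rigid_reduced[OF eta0_rigid] by blast
qed

end
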